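(* Assume the Black–Scholes setting of the context with volatility $\sigma>0$ and $\tau\in(0,1)$. If $K>S_0$, then $$\lim_{T\to0}T\log C(T)=-\frac{1}{2\sigma^2(1-\tau)^2}\Big(\tau\beta^2\tanh^2\tfrac{\beta}{2}+(1-\tau)\beta^2-2(1-\tau)\beta\tanh\tfrac\beta2\Big),$$ where $\beta\in(0,\infty)$ is the unique solution of $\frac{\sinh\beta}{\beta}=\frac{K}{S_0}\exp\big(-\frac{\tau}{1-\tau}\beta\tanh\frac\beta2\big)$. If $0<K<S_0$, then $$\lim_{T\to0}T\log P(T)=-\frac{2}{\sigma^2(1-\tau)^2}\Big(\tau\xi^2\tan^2\xi-(1-\tau)\xi^2+(1-\tau)\xi\tan\xi\Big),$$ where $\xi\in(0,\pi/2)$ is the unique solution of $\frac{\sin(2\xi)}{2\xi}=\frac{K}{S_0}\exp\big(\frac{2\tau}{1-\tau}\xi\tan\xi\big)$.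
   Context: Black–Scholes setting: $r\ge0$, $q\ge0$, $\sigma>0$ constant, $S_t=S_0\exp\big((r-q-\tfrac12\sigma^2)t+\sigma W_t\big)$ with $S_0>0$ and $W$ a standard Brownian motion under $\mathbb P$. For $\tau\in(0,1)$, $T>0$, $K>0$: $C(T)=e^{-rT}\mathbb E[(\frac{1}{(1-\tau)T}\int_{\tau T}^TS_tdt-K)^+]$ and $P(T)=e^{-rT}\mathbb E[(K-\frac{1}{(1-\tau)T}\int_{\tau T}^TS_tdt)^+]$. *)

theory Defs
  imports "HOL-Probability.Probability"
begin

definition std_brownian_motion :: "'a measure \<Rightarrow> (real \<Rightarrow> 'a \<Rightarrow> real) \<Rightarrow> bool" where
  "std_brownian_motion M W \<longleftrightarrow>
     prob_space M \<and>
     (\<forall>t\<ge>0. W t \<in> borel_measurable M) \<and>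
     (\<forall>\<omega>\<in>space M. W 0 \<omega> = 0) \<and>
     (\<forall>\<omega>\<in>space M. continuous_on {0..} (\<lambda>t. W t \<omega>)) \<and>
     (\<forall>s t. 0 \<le> s \<and> s < t \<longrightarrow>
        distributed M lborel (\<lambda>\<omega>. W t \<omega> - W s \<omega>) (normal_density 0 (sqrt (t - s)))) \<and>
     (\<forall>(n::nat) (tt::nat \<Rightarrow> real). 0 \<le> tt 0 \<and> (\<forall>i<n. tt i < tt (Suc i)) \<longrightarrow>
        prob_space.indep_vars M (\<lambda>_. borel) (\<lambda>i \<omega>. W (tt (Suc i)) \<omega> - W (tt i) \<omega>) {..<n})"

definition bs_path :: "real \<Rightarrow> real \<Rightarrow> real \<Rightarrow> real \<Rightarrow> (real \<Rightarrow> 'a \<Rightarrow> real) \<Rightarrow> real \<Rightarrow> 'a \<Rightarrow> real" where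
  "bs_path S0 r q \<sigma> W t \<omega> = S0 * exp ((r - q - \<sigma>\<^sup>2 / 2) * t + \<sigma> * W t \<omega>)"

definition fs_average :: "real \<Rightarrow> real \<Rightarrow> real \<Rightarrow> real \<Rightarrow> (real \<Rightarrow> 'a \<Rightarrow> real) \<Rightarrow> real \<Rightarrow> real \<Rightarrow> 'a \<Rightarrow> real" where
  "fs_average S0 r q \<sigma> W \<tau> T \<omega> =
     integral {\<tau> * T..T} (\<lambda>t. bs_path S0 r q \<sigma> W t \<omega>) / ((1 - \<tau>) * T)"

definition asian_call :: "'a measure \<Rightarrow> (real \<Rightarrow> 'a \<Rightarrow> real) \<Rightarrow> real \<Rightarrow> real \<Rightarrow> real \<Rightarrow> real \<Rightarrow> real \<Rightarrow> real \<Rightarrow> real \<Rightarrow> real" where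
  "asian_call M W S0 r q \<sigma> \<tau> K T =
     exp (- r * T) * (\<integral>\<omega>. max 0 (fs_average S0 r q \<sigma> W \<tau> T \<omega> - K) \<partial>M)"

definition asian_put :: "'a measure \<Rightarrow> (real \<Rightarrow> 'a \<Rightarrow> real) \<Rightarrow> real \<Rightarrow> real \<Rightarrow> real \<Rightarrow> real \<Rightarrow> real \<Rightarrow> real \<Rightarrow> real \<Rightarrow> real" where
  "asian_put M W S0 r q \<sigma> \<tau> K T =
     exp (- r * T) * (\<integral>\<omega>. max 0 (K - fs_average S0 r q \<sigma> W \<tau> T \<omega>) \<partial>M)"

end

theory Submission
  imports Defs "HOL-Real_Asymp.Real_Asymp"
begin

text \<open>After Brownian scaling the maturity \<open>T\<close> only enters through the volatility \<open>\<sigma> * sqrt T\<close> and a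
  negligible drift of order \<open>T\<close>. For a path
  \<open>g\<close> on \<open>[\<tau>, 1]\<close>, extended linearly to \<open>[0, \<tau>]\<close> with \<open>g 0 = 0\<close>, the cost is the integral of
  \<open>g'\<^sup>2 / (2 * \<sigma>\<^sup>2)\<close>, and the claimed rates are the costs of the paths solving the Euler-Lagrange
  equation under the constraint that the average of \<open>S0 * exp g\<close> equals \<open>K\<close>.

  Lower bounds follow from an exponential change of measure that moves the Brownian motion along a
  piecewise linear approximation of a path slightly in the money. The put event is convex and lies in
  a half-space supported at the optimal path, so a Gaussian Chernoff bound gives its upper bound. The
  call event is not convex; there the call price is bounded by an integer moment of the average of
  order \<open>n \<sim> \<theta> / T\<close>, which has an explicit product bound with a free parameter. At its stationary point
  this bound has the same exponential rate as the lower bound.\<close>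

section \<open>Exponential moments of Brownian increments\<close>

text \<open>The law of the motion is used only through Laplace transforms of finitely many
  increments. This is why paths are replaced by polygons: the density that shifts to a polygon is an
  exponential of a finite sum, and no stochastic integral has to be defined. Before \<tau> the
  average sees nothing, so the straight line is the cheapest way to \<open>g \<tau>\<close>. After
  \<tau> the Euler-Lagrange equation makes \<open>g''\<close> a constant multiple of
  \<open>exp g\<close>; the end at time 1 is free, so \<open>g' = 0\<close> there, and stationarity
  in the value at \<tau> gives \<open>g \<tau> = \<tau> * g' \<tau>\<close>. The multiplier is
  negative for the call and positive for the put, which produces cosh with parameter \<beta> and cos
  with parameter \<xi>; the equations for \<beta> and \<xi> are the constraint on the average. The
  order of the moment comes from a balance: the scaled volatility s is of order
  \<open>sqrt T\<close>, the moment contributes an exponent of order \<open>(n * s)\<^sup>2\<close>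
  and the strike one of order \<open>n\<close>, and both are of order \<open>1 / T\<close> exactly
  when \<open>n\<close> is.\<close>

lemma nn_integral_exp_normal:
  assumes "0 < v"
  shows "(\<integral>\<^sup>+x. ennreal (normal_density 0 (sqrt v) x) * ennreal (exp (b * x)) \<partial>lborel)
    = ennreal (exp (b\<^sup>2 * v / 2))"
proof -
  have *: "normal_density 0 (sqrt v) x * exp (b * x)
      = exp (b\<^sup>2 * v / 2) * normal_density (b * v) (sqrt v) x" for x
  proof -
    have "- (x - 0)\<^sup>2 / (2 * (sqrt v)\<^sup>2) + b * x
        = b\<^sup>2 * v / 2 + (- (x - b * v)\<^sup>2 / (2 * (sqrt v)\<^sup>2))"
      using assms by (simp add: field_simps power2_eq_square)
    then have "exp (- (x - 0)\<^sup>2 / (2 * (sqrt v)\<^sup>2)) * exp (b * x)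
        = exp (b\<^sup>2 * v / 2) * exp (- (x - b * v)\<^sup>2 / (2 * (sqrt v)\<^sup>2))"
      by (metis exp_add)
    then show ?thesis
      unfolding normal_density_def by simp
  qed
  have "(\<integral>\<^sup>+x. ennreal (normal_density 0 (sqrt v) x) * ennreal (exp (b * x)) \<partial>lborel)
      = (\<integral>\<^sup>+x. ennreal (exp (b\<^sup>2 * v / 2)) * ennreal (normal_density (b * v) (sqrt v) x) \<partial>lborel)"
    by (intro nn_integral_cong) (simp add: * normal_density_nonneg flip: ennreal_mult)
  also have "\<dots> = ennreal (exp (b\<^sup>2 * v / 2))
      * (\<integral>\<^sup>+x. ennreal (normal_density (b * v) (sqrt v) x) \<partial>lborel)"
    by (rule nn_integral_cmult) simp
  also have "(\<integral>\<^sup>+x. ennreal (normal_density (b * v) (sqrt v) x) \<partial>lborel) = 1"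
    using assms by (subst nn_integral_eq_integral)
      (auto simp: normal_density_nonneg integrable_normal_density integral_normal_density)
  finally show ?thesis by simp
qed

text \<open>The covariance of the increments of a Brownian motion over two intervals \<open>[a, b]\<close> and
  \<open>[c, d]\<close>, that is, the length of their intersection.\<close>

definition overlap :: "real \<Rightarrow> real \<Rightarrow> real \<Rightarrow> real \<Rightarrow> real" where
  "overlap a b c d = min b d - min b c - min a d + min a c"

lemma overlap_scale:
  assumes "0 \<le> T"
  shows "overlap (T * a) (T * b) (T * c) (T * d) = T * overlap a b c d"
  using assms by (simp add: overlap_def min_mult_distrib_left algebra_simps)

text \<open>The last axiom is the only distributional assumption. It admits overlapping and
  degenerate intervals, so grid increments and a value \<open>B t\<close> can occur in one sum
  without refining the grid. The interpretations are the rescaled motions, one for each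
  maturity.\<close>

locale brownian = prob_space M for M :: "'a measure" +
  fixes B :: "real \<Rightarrow> 'a \<Rightarrow> real"
  assumes B_measurable: "0 \<le> t \<Longrightarrow> B t \<in> borel_measurable M"
    and B_zero: "\<omega> \<in> space M \<Longrightarrow> B 0 \<omega> = 0"
    and B_continuous: "\<omega> \<in> space M \<Longrightarrow> continuous_on {0..} (\<lambda>t. B t \<omega>)"
    and B_exp: "finite (I :: nat set) \<Longrightarrow> (\<And>i. i \<in> I \<Longrightarrow> 0 \<le> lo i \<and> lo i \<le> hi i) \<Longrightarrow>
      (\<integral>\<^sup>+\<omega>. ennreal (exp (\<Sum>i\<in>I. a i * (B (hi i) \<omega> - B (lo i) \<omega>))) \<partial>M)
      = ennreal (exp ((\<Sum>i\<in>I. \<Sum>j\<in>I. a i * a j * overlap (lo i) (hi i) (lo j) (hi j)) / 2))"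

text \<open>The indicators select exactly the cells to the left of a grid point. With
  \<open>\<phi>\<close> a Brownian path this writes a value as a sum of grid increments, with
  \<open>\<phi>\<close> the identity it evaluates lengths; both the linear and the quadratic part of
  the Laplace transform use it.\<close>

lemma grid_telescope:
  fixes tt :: "nat \<Rightarrow> real" and \<phi> :: "real \<Rightarrow> real"
  assumes less: "\<And>j k. j < k \<Longrightarrow> k \<le> n \<Longrightarrow> tt j < tt k" and m: "m \<le> n"
  shows "(\<Sum>k<n. of_bool (tt k < tt m) * (\<phi> (tt (Suc k)) - \<phi> (tt k))) = \<phi> (tt m) - \<phi> (tt 0)"
proof -
  have iff: "tt k < tt m \<longleftrightarrow> k < m" if "k < n" for k
    using less[of k m] less[of m k] that m by (metis less_imp_le_nat linorder_neqE_nat order_less_irrefl order_less_asym)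
  have "(\<Sum>k<n. of_bool (tt k < tt m) * (\<phi> (tt (Suc k)) - \<phi> (tt k)))
      = (\<Sum>k<n. if k < m then \<phi> (tt (Suc k)) - \<phi> (tt k) else 0)"
    by (intro sum.cong) (auto simp: iff)
  also have "\<dots> = (\<Sum>k<m. \<phi> (tt (Suc k)) - \<phi> (tt k))"
    using m by (intro sum.mono_neutral_cong_right) auto
  also have "\<dots> = \<phi> (tt m) - \<phi> (tt 0)"
    by (rule sum_lessThan_telescope)
  finally show ?thesis .
qed

text \<open>Refining all intervals to the common grid of their end points turns the sum into one
  over independent increments. Their Laplace transforms multiply, and the resulting variance is
  regrouped into pairwise overlaps.\<close>

lemma std_brownian_motion_exp:
  assumes W: "std_brownian_motion M W" and fin: "finite (I :: nat set)"
    and st: "\<And>i. i \<in> I \<Longrightarrow> 0 \<le> s i \<and> s i \<le> t i"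
  shows "(\<integral>\<^sup>+\<omega>. ennreal (exp (\<Sum>i\<in>I. a i * (W (t i) \<omega> - W (s i) \<omega>))) \<partial>M)
      = ennreal (exp ((\<Sum>i\<in>I. \<Sum>j\<in>I. a i * a j * overlap (s i) (t i) (s j) (t j)) / 2))"
proof -
  interpret prob_space M using W by (simp add: std_brownian_motion_def)
  \<comment> \<open>Inserting 0 makes the list nonempty and lets every increment be measured from
    the origin; sorting a set removes coinciding end points, so the grid is strictly increasing as
    the independence assumption demands.\<close>
  define xs where "xs = sorted_list_of_set (insert 0 (s ` I \<union> t ` I))"
  define n where "n = length xs - 1"
  define tt where "tt k = xs ! k" for k
  have set_xs: "set xs = insert 0 (s ` I \<union> t ` I)"
    unfolding xs_def using fin by (intro set_sorted_list_of_set) simp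
  have len: "length xs = Suc n"
    using set_xs unfolding n_def by (cases xs) auto
  have sorted: "sorted_wrt (<) xs"
    unfolding xs_def by simp
  have less: "tt j < tt k" if "j < k" "k \<le> n" for j k
    using sorted that len unfolding tt_def by (simp add: sorted_wrt_iff_nth_less)
  have grid: "\<exists>m\<le>n. x = tt m" if "x \<in> set xs" for x
    using that len unfolding tt_def by (metis in_set_conv_nth less_Suc_eq_le)
  have tt_nonneg: "0 \<le> tt k" if "k \<le> n" for k
  proof -
    have "tt k \<in> set xs" using that len unfolding tt_def by simp
    then show ?thesis using st set_xs by force
  qed
  have tt0: "tt 0 = 0"
    using tt_nonneg[of 0] grid[of 0] less by (metis insertI1 le_zero_eq nle_le not_less set_xs zero_order(3) gr0I less_le)
  \<comment> \<open>\<open>b k\<close> is the total weight of cell k: the difference of indicators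
    is 1 exactly when that cell lies in the i-th interval.\<close>
  define b where "b k = (\<Sum>i\<in>I. a i * (of_bool (tt k < t i) - of_bool (tt k < s i)))" for k
  have tele: "(\<Sum>k<n. of_bool (tt k < x) * (\<phi> (tt (Suc k)) - \<phi> (tt k))) = \<phi> x - \<phi> 0"
    if "x \<in> set xs" for x and \<phi> :: "real \<Rightarrow> real"
    using grid[OF that] grid_telescope[where n = n and tt = tt and \<phi> = \<phi>] less tt0 by auto
  have lin: "(\<Sum>i\<in>I. a i * (W (t i) \<omega> - W (s i) \<omega>))
      = (\<Sum>k<n. b k * (W (tt (Suc k)) \<omega> - W (tt k) \<omega>))" for \<omega>
  proof -
    have "(\<Sum>k<n. b k * (W (tt (Suc k)) \<omega> - W (tt k) \<omega>))
        = (\<Sum>i\<in>I. \<Sum>k<n. a i * (of_bool (tt k < t i) * (W (tt (Suc k)) \<omega> - W (tt k) \<omega>)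
            - of_bool (tt k < s i) * (W (tt (Suc k)) \<omega> - W (tt k) \<omega>)))"
      unfolding b_def sum_distrib_right by (subst sum.swap) (simp add: algebra_simps)
    also have "\<dots> = (\<Sum>i\<in>I. a i * ((W (t i) \<omega> - W 0 \<omega>) - (W (s i) \<omega> - W 0 \<omega>)))"
    proof (intro sum.cong refl)
      fix i assume "i \<in> I"
      then have "s i \<in> set xs" "t i \<in> set xs" by (auto simp: set_xs)
      note tele[of "s i" "\<lambda>t. W t \<omega>", OF this(1)] tele[of "t i" "\<lambda>t. W t \<omega>", OF this(2)]
      then show "(\<Sum>k<n. a i * (of_bool (tt k < t i) * (W (tt (Suc k)) \<omega> - W (tt k) \<omega>)
            - of_bool (tt k < s i) * (W (tt (Suc k)) \<omega> - W (tt k) \<omega>)))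
          = a i * ((W (t i) \<omega> - W 0 \<omega>) - (W (s i) \<omega> - W 0 \<omega>))"
        by (simp add: sum_subtractf flip: sum_distrib_left)
    qed
    finally show ?thesis by simp
  qed
  have var: "(\<Sum>k<n. (b k)\<^sup>2 * (tt (Suc k) - tt k))
      = (\<Sum>i\<in>I. \<Sum>j\<in>I. a i * a j * overlap (s i) (t i) (s j) (t j))"
  proof -
    let ?e = "\<lambda>i k. of_bool (tt k < t i) - of_bool (tt k < s i) :: real"
    have sq: "(b k)\<^sup>2 = (\<Sum>i\<in>I. \<Sum>j\<in>I. a i * a j * (?e i k * ?e j k))" for k
      unfolding b_def power2_eq_square sum_product by (simp add: ac_simps)
    \<comment> \<open>A product of two such indicators is the indicator for the smaller bound, so
      the four products reproduce the four minima in \<open>overlap\<close>.\<close>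
    have ex: "?e i k * ?e j k = of_bool (tt k < min (t i) (t j)) - of_bool (tt k < min (t i) (s j))
        - of_bool (tt k < min (s i) (t j)) + of_bool (tt k < min (s i) (s j))" for i j k
      by (auto simp: of_bool_def)
    have *: "(\<Sum>k<n. ?e i k * ?e j k * (tt (Suc k) - tt k)) = overlap (s i) (t i) (s j) (t j)"
      if ij: "i \<in> I" "j \<in> I" for i j
    proof -
      have mem: "min x y \<in> set xs" if "x \<in> set xs" "y \<in> set xs" for x y
        using that by (simp add: min_def)
      have "s i \<in> set xs" "t i \<in> set xs" "s j \<in> set xs" "t j \<in> set xs"
        using ij set_xs by auto
      then show ?thesis
        using tele[of "min (t i) (t j)" "\<lambda>t. t", OF mem]
          tele[of "min (t i) (s j)" "\<lambda>t. t", OF mem]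
          tele[of "min (s i) (t j)" "\<lambda>t. t", OF mem]
          tele[of "min (s i) (s j)" "\<lambda>t. t", OF mem]
        unfolding ex overlap_def
        by (simp only: distrib_right left_diff_distrib sum.distrib sum_subtractf)
    qed
    have "(\<Sum>k<n. (b k)\<^sup>2 * (tt (Suc k) - tt k))
        = (\<Sum>i\<in>I. \<Sum>j\<in>I. \<Sum>k<n. a i * a j * (?e i k * ?e j k * (tt (Suc k) - tt k)))"
      unfolding sq sum_distrib_right by (subst sum.swap, rule sum.cong[OF refl], subst sum.swap, simp add: ac_simps)
    also have "\<dots> = (\<Sum>i\<in>I. \<Sum>j\<in>I. a i * a j * overlap (s i) (t i) (s j) (t j))"
      by (intro sum.cong refl) (simp only: * flip: sum_distrib_left)
    finally show ?thesis .
  qed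
  have indep: "indep_vars (\<lambda>_. borel) (\<lambda>i \<omega>. W (tt (Suc i)) \<omega> - W (tt i) \<omega>) {..<n}"
    using W less tt0 unfolding std_brownian_motion_def by auto
  have "(\<integral>\<^sup>+\<omega>. ennreal (exp (\<Sum>i\<in>I. a i * (W (t i) \<omega> - W (s i) \<omega>))) \<partial>M)
      = (\<integral>\<^sup>+\<omega>. (\<Prod>k<n. ennreal (exp (b k * (W (tt (Suc k)) \<omega> - W (tt k) \<omega>)))) \<partial>M)"
    by (simp add: lin exp_sum prod_ennreal)
  also have "\<dots> = (\<Prod>k<n. \<integral>\<^sup>+\<omega>. ennreal (exp (b k * (W (tt (Suc k)) \<omega> - W (tt k) \<omega>))) \<partial>M)"
    by (rule indep_vars_nn_integral[OF _ indep_vars_compose2[OF indep]]) auto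
  also have "\<dots> = (\<Prod>k<n. ennreal (exp ((b k)\<^sup>2 * (tt (Suc k) - tt k) / 2)))"
  proof (intro prod.cong refl)
    fix k assume k: "k \<in> {..<n}"
    have d: "distributed M lborel (\<lambda>\<omega>. W (tt (Suc k)) \<omega> - W (tt k) \<omega>)
        (normal_density 0 (sqrt (tt (Suc k) - tt k)))"
      using W less[of k "Suc k"] tt_nonneg[of k] k unfolding std_brownian_motion_def by auto
    have "(\<integral>\<^sup>+\<omega>. ennreal (exp (b k * (W (tt (Suc k)) \<omega> - W (tt k) \<omega>))) \<partial>M)
      = (\<integral>\<^sup>+x. ennreal (normal_density 0 (sqrt (tt (Suc k) - tt k)) x) * ennreal (exp (b k * x)) \<partial>lborel)"
      by (rule distributed_nn_integral[OF d, symmetric]) simp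
    then show "(\<integral>\<^sup>+\<omega>. ennreal (exp (b k * (W (tt (Suc k)) \<omega> - W (tt k) \<omega>))) \<partial>M)
        = ennreal (exp ((b k)\<^sup>2 * (tt (Suc k) - tt k) / 2))"
      using nn_integral_exp_normal[of "tt (Suc k) - tt k" "b k"] less[of k "Suc k"] k by auto
  qed
  also have "\<dots> = ennreal (exp ((\<Sum>k<n. (b k)\<^sup>2 * (tt (Suc k) - tt k)) / 2))"
    by (simp add: prod_ennreal sum_divide_distrib flip: exp_sum)
  finally show ?thesis unfolding var .
qed

text \<open>Each overlap of the unscaled motion carries a factor \<open>T\<close>, which the two
  factors \<open>1 / sqrt T\<close> of the coefficients cancel.\<close>

lemma brownian_scaled:
  assumes W: "std_brownian_motion M W" and T: "0 < T"
  shows "brownian M (\<lambda>u \<omega>. W (T * u) \<omega> / sqrt T)"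
proof -
  interpret prob_space M using W by (simp add: std_brownian_motion_def)
  show ?thesis
  proof
    show "(\<lambda>\<omega>. W (T * t) \<omega> / sqrt T) \<in> borel_measurable M" if "0 \<le> t" for t
      using W T that unfolding std_brownian_motion_def by (intro borel_measurable_divide) auto
    show "W (T * 0) \<omega> / sqrt T = 0" if "\<omega> \<in> space M" for \<omega>
      using W that unfolding std_brownian_motion_def by auto
    show "continuous_on {0..} (\<lambda>t. W (T * t) \<omega> / sqrt T)" if "\<omega> \<in> space M" for \<omega>
    proof -
      have "continuous_on {0..} (\<lambda>t. W t \<omega>)"
        using W that unfolding std_brownian_motion_def by auto
      then have "continuous_on {0..} (\<lambda>t. W (T * t) \<omega>)"
        by (rule continuous_on_compose2) (use T in \<open>auto intro!: continuous_intros\<close>)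
      then show ?thesis by (intro continuous_intros) (use T in auto)
    qed
    show "(\<integral>\<^sup>+\<omega>. ennreal (exp (\<Sum>i\<in>I. a i * (W (T * t i) \<omega> / sqrt T - W (T * s i) \<omega> / sqrt T))) \<partial>M)
        = ennreal (exp ((\<Sum>i\<in>I. \<Sum>j\<in>I. a i * a j * overlap (s i) (t i) (s j) (t j)) / 2))"
      if "finite I" "\<And>i. i \<in> I \<Longrightarrow> 0 \<le> s i \<and> s i \<le> t i" for I :: "nat set" and s t a
    proof -
      have "(\<integral>\<^sup>+\<omega>. ennreal (exp (\<Sum>i\<in>I. a i / sqrt T * (W (T * t i) \<omega> - W (T * s i) \<omega>))) \<partial>M)
        = ennreal (exp ((\<Sum>i\<in>I. \<Sum>j\<in>I. a i / sqrt T * (a j / sqrt T)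
            * overlap (T * s i) (T * t i) (T * s j) (T * t j)) / 2))"
        using that T by (intro std_brownian_motion_exp[OF W]) auto
      moreover have "a i / sqrt T * (a j / sqrt T) * (T * x) = a i * a j * x" for i j x
        using T by (simp add: field_simps)
      ultimately show ?thesis
        using T by (simp add: overlap_scale diff_divide_distrib right_diff_distrib mult.assoc)
    qed
  qed
qed

section \<open>Moments of the integral of an exponential Brownian motion\<close>

text \<open>Path averages are gauge integrals, while exchanging the order of integration needs
  nonnegative Lebesgue integrals; this is the passage between them.\<close>

lemma nn_integral_Icc_eq_integral:
  fixes f :: "real \<Rightarrow> real"
  assumes cont: "continuous_on {a..b} f" and nonneg: "\<And>x. x \<in> {a..b} \<Longrightarrow> 0 \<le> f x"
  shows "(\<integral>\<^sup>+x. ennreal (f x) * indicator {a..b} x \<partial>lborel) = ennreal (integral {a..b} f)"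
proof -
  let ?g = "\<lambda>x. if x \<in> {a..b} then f x else 0"
  have "(f has_integral integral {a..b} f) {a..b}"
    using cont by (intro integrable_integral integrable_continuous_real)
  then have "(?g has_integral integral {a..b} f) UNIV"
    by (simp only: has_integral_restrict_UNIV)
  moreover have "?g \<in> borel_measurable borel"
    using cont by (intro borel_measurable_continuous_on_if) auto
  ultimately have "integral\<^sup>N lborel ?g = ennreal (integral {a..b} f)"
    using nonneg by (intro nn_integral_has_integral_lborel) auto
  moreover have "(\<integral>\<^sup>+x. ennreal (f x) * indicator {a..b} x \<partial>lborel) = integral\<^sup>N lborel ?g"
    by (intro nn_integral_cong) (simp add: indicator_def)
  ultimately show ?thesis by simp
qed

text \<open>The fundamental theorem applied to a power of the tail integral. In terms of the power
  as an integral over n + 1 time points, it singles out the earliest one, v, and leaves the others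
  after v.\<close>

lemma power_tail_integral:
  fixes e :: "real \<Rightarrow> real"
  assumes "continuous_on {a..b} e" "a \<le> b"
  shows "(integral {a..b} e) ^ Suc n
    = integral {a..b} (\<lambda>v. real (Suc n) * (e v * (integral {v..b} e) ^ n))"
proof -
  have "((\<lambda>v. - ((integral {v..b} e) ^ Suc n)) has_vector_derivative
      real (Suc n) * (e v * (integral {v..b} e) ^ n)) (at v within {a..b})"
    if "v \<in> {a..b}" for v
    using DERIV_minus[OF DERIV_power_Suc[OF integral_has_real_derivative'[OF assms(1) that], of n]]
    by (simp flip: has_real_derivative_iff_has_vector_derivative)
  then have "((\<lambda>v. real (Suc n) * (e v * (integral {v..b} e) ^ n)) has_integral
      (- ((integral {b..b} e) ^ Suc n) - - ((integral {a..b} e) ^ Suc n))) {a..b}"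
    using assms(2) by (intro fundamental_theorem_of_calculus) auto
  from integral_unique[OF this] show ?thesis by simp
qed

lemma tail_integral_continuous:
  fixes e :: "real \<Rightarrow> real"
  assumes "continuous_on {a..b} e"
  shows "continuous_on {a..b} (\<lambda>v. integral {v..b} e)"
  using integral_has_real_derivative'[OF assms]
  by (meson DERIV_continuous continuous_on_eq_continuous_within)

lemma floor_grid_tendsto:
  assumes "0 \<le> (x::real)"
  shows "(\<lambda>N. real (nat \<lfloor>x * real (Suc N)\<rfloor>) / real (Suc N)) \<longlonglongrightarrow> x"
proof (rule tendsto_sandwich)
  show "\<forall>\<^sub>F N in sequentially. x - 1 / real (Suc N) \<le> real (nat \<lfloor>x * real (Suc N)\<rfloor>) / real (Suc N)"
  proof (rule always_eventually, rule allI)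
    fix N
    have "x * real (Suc N) - 1 \<le> real (nat \<lfloor>x * real (Suc N)\<rfloor>)" by linarith
    then have "(x * real (Suc N) - 1) / real (Suc N) \<le> real (nat \<lfloor>x * real (Suc N)\<rfloor>) / real (Suc N)"
      by (intro divide_right_mono) auto
    then show "x - 1 / real (Suc N) \<le> real (nat \<lfloor>x * real (Suc N)\<rfloor>) / real (Suc N)"
      by (simp add: diff_divide_distrib)
  qed
  show "\<forall>\<^sub>F N in sequentially. real (nat \<lfloor>x * real (Suc N)\<rfloor>) / real (Suc N) \<le> x"
  proof (rule always_eventually, rule allI)
    fix N
    have "0 \<le> x * real (Suc N)" using assms by simp
    then have "real (nat \<lfloor>x * real (Suc N)\<rfloor>) \<le> x * real (Suc N)" by linarith
    then show "real (nat \<lfloor>x * real (Suc N)\<rfloor>) / real (Suc N) \<le> x"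
      by (simp add: divide_le_eq)
  qed
  have "(\<lambda>N. x - 1 / real (Suc N)) \<longlonglongrightarrow> x - 0"
    by (intro tendsto_intros LIMSEQ_Suc[OF lim_1_over_n])
  then show "(\<lambda>N. x - 1 / real (Suc N)) \<longlonglongrightarrow> x" by simp
qed simp

text \<open>Evaluation at the grid point below t consists of countably many measurable pieces, and
  path continuity passes to the limit. The cutoff \<open>max 0\<close> makes the process total in
  time, as integrals over \<open>lborel\<close> need, since nothing is known at negative
  times.\<close>

lemma continuous_process_jointly_measurable:
  fixes f :: "real \<Rightarrow> 'a \<Rightarrow> real"
  assumes meas: "\<And>t. 0 \<le> t \<Longrightarrow> f t \<in> borel_measurable M"
    and cont: "\<And>\<omega>. \<omega> \<in> space M \<Longrightarrow> continuous_on {0..} (\<lambda>t. f t \<omega>)"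
  shows "(\<lambda>z. f (max 0 (fst z)) (snd z)) \<in> borel_measurable (borel \<Otimes>\<^sub>M M)"
proof (rule borel_measurable_LIMSEQ_real)
  let ?q = "\<lambda>N x. real (nat \<lfloor>max 0 x * real (Suc N)\<rfloor>) / real (Suc N)"
  show "(\<lambda>N. f (?q N (fst z)) (snd z)) \<longlonglongrightarrow> f (max 0 (fst z)) (snd z)"
    if "z \<in> space (borel \<Otimes>\<^sub>M M)" for z
  proof -
    have "continuous_on {0..} (\<lambda>t. f t (snd z))"
      using that by (intro cont) (auto simp: space_pair_measure)
    then show ?thesis
      by (rule continuous_on_tendsto_compose[OF _ floor_grid_tendsto]) auto
  qed
  show "(\<lambda>z. f (?q N (fst z)) (snd z)) \<in> borel_measurable (borel \<Otimes>\<^sub>M M)" for N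
  proof (rule measurable_compose_countable[where f = "\<lambda>k z. f (real k / real (Suc N)) (snd z)"])
    show "(\<lambda>z. f (real k / real (Suc N)) (snd z)) \<in> borel_measurable (borel \<Otimes>\<^sub>M M)" for k
      by (rule measurable_compose[OF measurable_snd meas]) simp
    show "(\<lambda>z. nat \<lfloor>max 0 (fst z) * real (Suc N)\<rfloor>) \<in> borel \<Otimes>\<^sub>M M \<rightarrow>\<^sub>M count_space UNIV"
      by measurable
  qed
qed

lemma has_integral_exp_affine:
  fixes k :: real
  assumes "k \<noteq> 0" "a \<le> b"
  shows "((\<lambda>v. exp (d + k * v)) has_integral (exp (d + k * b) - exp (d + k * a)) / k) {a..b}"
proof -
  have "((\<lambda>v. exp (d + k * v) / k) has_vector_derivative exp (d + k * v)) (at v within {a..b})" for v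
    using assms(1) by (auto intro!: derivative_eq_intros simp flip: has_real_derivative_iff_has_vector_derivative)
  then have "((\<lambda>v. exp (d + k * v)) has_integral exp (d + k * b) / k - exp (d + k * a) / k) {a..b}"
    using assms(2) by (intro fundamental_theorem_of_calculus) auto
  then show ?thesis by (simp add: diff_divide_distrib)
qed

context brownian
begin

lemma B_joint [measurable]:
  "(\<lambda>z. B (max 0 (fst z)) (snd z)) \<in> borel_measurable (borel \<Otimes>\<^sub>M M)"
  by (rule continuous_process_jointly_measurable) (auto intro: B_measurable B_continuous)

lemma B_joint_compose [measurable]:
  assumes "f \<in> borel_measurable N" "g \<in> N \<rightarrow>\<^sub>M M"
  shows "(\<lambda>x. B (max 0 (f x)) (g x)) \<in> borel_measurable N"
proof -
  have "(\<lambda>x. (f x, g x)) \<in> N \<rightarrow>\<^sub>M borel \<Otimes>\<^sub>M M"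
    using assms by measurable
  from measurable_compose[OF this B_joint] show ?thesis by simp
qed

lemma continuous_on_B:
  assumes "\<omega> \<in> space M" "0 \<le> a"
  shows "continuous_on {a..b} (\<lambda>t. B t \<omega>)"
  by (rule continuous_on_subset[OF B_continuous[OF assms(1)]]) (use assms in auto)

lemma nn_integral_exp_B:
  assumes "\<omega> \<in> space M" "0 \<le> a"
  shows "(\<integral>\<^sup>+u. ennreal (exp (m * u + c * B (max 0 u) \<omega>)) * indicator {a..b} u \<partial>lborel)
    = ennreal (integral {a..b} (\<lambda>u. exp (m * u + c * B u \<omega>)))"
proof -
  have "(\<integral>\<^sup>+u. ennreal (exp (m * u + c * B (max 0 u) \<omega>)) * indicator {a..b} u \<partial>lborel)
      = (\<integral>\<^sup>+u. ennreal (exp (m * u + c * B u \<omega>)) * indicator {a..b} u \<partial>lborel)"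
    using assms(2) by (intro nn_integral_cong) (auto simp: indicator_def)
  also have "\<dots> = ennreal (integral {a..b} (\<lambda>u. exp (m * u + c * B u \<omega>)))"
    by (intro nn_integral_Icc_eq_integral continuous_intros continuous_on_B assms) auto
  finally show ?thesis .
qed

text \<open>A Lebesgue integral of a jointly measurable function depends measurably on the
  parameter; path continuity identifies it with the gauge integral.\<close>

lemma integral_exp_B_measurable:
  assumes "0 \<le> a"
  shows "(\<lambda>\<omega>. integral {a..b} (\<lambda>u. exp (m * u + c * B u \<omega>))) \<in> borel_measurable M"
proof -
  have "(\<lambda>\<omega>. enn2real (\<integral>\<^sup>+u. ennreal (exp (m * u + c * B (max 0 u) \<omega>)) * indicator {a..b} u \<partial>lborel))
      \<in> borel_measurable M"
    by measurable
  then show ?thesis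
    by (rule measurable_cong[THEN iffD1, rotated])
      (simp add: nn_integral_exp_B assms Henstock_Kurzweil_Integration.integral_nonneg integrable_continuous_real
        continuous_intros continuous_on_B)
qed

text \<open>With \<open>A s = \<integral>\<^bsub>s\<^esub>\<^bsup>1\<^esup> exp (c * B u) du\<close> the induction rests on
  \<open>A s ^ (n + 1) = (n + 1) * \<integral>\<^bsub>s\<^esub>\<^bsup>1\<^esup> exp (c * B v) * A v ^ n dv\<close>. The factor \<open>exp (lam * (1 - s))\<close> with
  a free \<open>lam\<close> replaces an integral over the ordered simplex by a product, as in a Laplace transform.\<close>

lemma moment_bound:
  fixes I :: "nat set"
  assumes "0 \<le> s" "s \<le> 1" and "\<And>k. k \<le> n \<Longrightarrow> (real k * c)\<^sup>2 / 2 < lam"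
    and "finite I" and "\<And>i. i \<in> I \<Longrightarrow> 0 \<le> t i \<and> t i \<le> s"
  shows "(\<integral>\<^sup>+\<omega>. ennreal (exp (\<Sum>i\<in>I. a i * B (t i) \<omega>)
        * (integral {s..1} (\<lambda>u. exp (c * B u \<omega>))) ^ n) \<partial>M)
    \<le> ennreal (fact n * (\<Prod>k=1..n. 1 / (lam - (real k * c)\<^sup>2 / 2)) * exp (lam * (1 - s))
        * exp (((\<Sum>i\<in>I. \<Sum>j\<in>I. a i * a j * min (t i) (t j))
            + 2 * (real n * c) * (\<Sum>i\<in>I. a i * t i) + (real n * c)\<^sup>2 * s) / 2))"
  using assms
\<comment> \<open>The index set records the time points already extracted, all of them up to
  \<open>s\<close>. It has to be arbitrary because every induction step adds one.\<close>
proof (induction n arbitrary: I t a s)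
  case 0
  have lam: "0 < lam" using "0.prems"(3)[of 0] by simp
  have "(\<integral>\<^sup>+\<omega>. ennreal (exp (\<Sum>i\<in>I. a i * B (t i) \<omega>)) \<partial>M)
      = (\<integral>\<^sup>+\<omega>. ennreal (exp (\<Sum>i\<in>I. a i * (B (t i) \<omega> - B 0 \<omega>))) \<partial>M)"
    by (intro nn_integral_cong) (simp add: B_zero)
  also have "\<dots> = ennreal (exp ((\<Sum>i\<in>I. \<Sum>j\<in>I. a i * a j * overlap 0 (t i) 0 (t j)) / 2))"
    using 0 by (intro B_exp) auto
  also have "(\<Sum>i\<in>I. \<Sum>j\<in>I. a i * a j * overlap 0 (t i) 0 (t j))
      = (\<Sum>i\<in>I. \<Sum>j\<in>I. a i * a j * min (t i) (t j))"
    using 0 by (intro sum.cong) (auto simp: overlap_def min_absorb2)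
  finally have "(\<integral>\<^sup>+\<omega>. ennreal (exp (\<Sum>i\<in>I. a i * B (t i) \<omega>)) \<partial>M)
      = ennreal (1 * exp ((\<Sum>i\<in>I. \<Sum>j\<in>I. a i * a j * min (t i) (t j)) / 2))"
    by simp
  also have "\<dots> \<le> ennreal (exp (lam * (1 - s)) * exp ((\<Sum>i\<in>I. \<Sum>j\<in>I. a i * a j * min (t i) (t j)) / 2))"
    using 0 lam by (intro ennreal_leI mult_right_mono) auto
  finally show ?case by simp
next
  case (Suc n)
  define e where "e = (\<lambda>\<omega> u. exp (c * B u \<omega>))"
  define V where "V = (\<Sum>i\<in>I. \<Sum>j\<in>I. a i * a j * min (t i) (t j)) + 2 * (real (Suc n) * c) * (\<Sum>i\<in>I. a i * t i)"
  define \<kappa> where "\<kappa> = (real (Suc n) * c)\<^sup>2 / 2"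
  define C where "C = fact n * (\<Prod>k=1..n. 1 / (lam - (real k * c)\<^sup>2 / 2))"
  have \<kappa>: "\<kappa> < lam" using Suc.prems(3)[of "Suc n"] by (simp add: \<kappa>_def)
  have C: "0 \<le> C"
    unfolding C_def using Suc.prems(3) by (intro mult_nonneg_nonneg prod_nonneg) (auto simp: less_imp_le)
  let ?Y = "\<lambda>\<omega>. exp (\<Sum>i\<in>I. a i * B (t i) \<omega>)"
  let ?A = "\<lambda>v \<omega>. integral {v..1} (e \<omega>)"
  \<comment> \<open>The form of \<open>?A\<close> that is visibly measurable in both arguments; the
    two agree at nonnegative times.\<close>
  let ?A' = "\<lambda>v \<omega>. \<integral>\<^sup>+u. ennreal (exp (c * B (max 0 u) \<omega>)) * indicator {v..1} u \<partial>lborel"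
  let ?F = "\<lambda>v \<omega>. ennreal (real (Suc n)) * (ennreal (?Y \<omega>) * ennreal (exp (c * B (max 0 v) \<omega>))
      * ?A' v \<omega> ^ n * indicator {s..1} v)"
  have e_cont: "continuous_on {v..1} (e \<omega>)" if "\<omega> \<in> space M" "0 \<le> v" for v \<omega>
    unfolding e_def by (intro continuous_intros continuous_on_B that)
  have A_nonneg: "0 \<le> ?A v \<omega>" if "\<omega> \<in> space M" "0 \<le> v" for v \<omega>
    using integrable_continuous_real[OF e_cont[OF that]]
    by (intro Henstock_Kurzweil_Integration.integral_nonneg) (auto simp: e_def)
  have A': "?A' v \<omega> = ennreal (?A v \<omega>)" if "\<omega> \<in> space M" "0 \<le> v" for v \<omega>
    using nn_integral_exp_B[OF that, of 0 c 1] by (simp add: e_def)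
  have split: "ennreal (?Y \<omega> * ?A s \<omega> ^ Suc n)
      = (\<integral>\<^sup>+v. ?F v \<omega> \<partial>lborel)" (is "?l = ?r")
    if \<omega>: "\<omega> \<in> space M" for \<omega>
  proof -
    have A_cont: "continuous_on {s..1} (\<lambda>v. ?A v \<omega>)"
      by (rule tail_integral_continuous[OF e_cont[OF \<omega> Suc.prems(1)]])
    have "?r = (\<integral>\<^sup>+v. ennreal (?Y \<omega>)
        * (ennreal (real (Suc n) * (e \<omega> v * ?A v \<omega> ^ n)) * indicator {s..1} v) \<partial>lborel)"
    proof (intro nn_integral_cong)
      fix v
      show "?F v \<omega>
          = ennreal (?Y \<omega>) * (ennreal (real (Suc n) * (e \<omega> v * ?A v \<omega> ^ n)) * indicator {s..1} v)"
      proof (cases "v \<in> {s..1}")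
        case True
        then have v: "0 \<le> v" using Suc.prems(1) by auto
        show ?thesis
          using True v A_nonneg[OF \<omega> v] unfolding A'[OF \<omega> v]
          by (simp add: e_def ennreal_power ac_simps flip: ennreal_mult del: of_nat_Suc)
      qed simp
    qed
    also have "\<dots> = ennreal (?Y \<omega>) *
        (\<integral>\<^sup>+v. ennreal (real (Suc n) * (e \<omega> v * ?A v \<omega> ^ n)) * indicator {s..1} v \<partial>lborel)"
    proof (rule nn_integral_cmult)
      have "continuous_on {s..1} (\<lambda>v. real (Suc n) * (e \<omega> v * ?A v \<omega> ^ n))"
        by (intro continuous_intros e_cont \<omega> A_cont Suc.prems(1))
      then have "(\<lambda>v. indicator {s..1} v *\<^sub>R (real (Suc n) * (e \<omega> v * ?A v \<omega> ^ n))) \<in> borel_measurable borel"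
        by (intro borel_measurable_continuous_on_indicator) simp
      from measurable_compose[OF this measurable_ennreal]
      have "(\<lambda>v. ennreal (indicator {s..1} v *\<^sub>R (real (Suc n) * (e \<omega> v * ?A v \<omega> ^ n))))
          \<in> borel_measurable lborel"
        by (simp only: measurable_lborel1 measurable_lborel2)
      also have "(\<lambda>v. ennreal (indicator {s..1} v *\<^sub>R (real (Suc n) * (e \<omega> v * ?A v \<omega> ^ n))))
          = (\<lambda>v. ennreal (real (Suc n) * (e \<omega> v * ?A v \<omega> ^ n)) * indicator {s..1} v)"
        by (auto simp: indicator_def)
      finally show "(\<lambda>v. ennreal (real (Suc n) * (e \<omega> v * ?A v \<omega> ^ n)) * indicator {s..1} v)
          \<in> borel_measurable lborel" .
    qed
    also have "(\<integral>\<^sup>+v. ennreal (real (Suc n) * (e \<omega> v * ?A v \<omega> ^ n)) * indicator {s..1} v \<partial>lborel)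
        = ennreal (integral {s..1} (\<lambda>v. real (Suc n) * (e \<omega> v * ?A v \<omega> ^ n)))"
      using Suc.prems(1) A_nonneg[OF \<omega>]
      by (intro nn_integral_Icc_eq_integral continuous_intros e_cont \<omega> A_cont) (auto simp: e_def)
    also have "\<dots> = ennreal (?A s \<omega> ^ Suc n)"
      using power_tail_integral[OF e_cont[OF \<omega> Suc.prems(1)] Suc.prems(2), of n] by simp
    finally show ?thesis
      using A_nonneg[OF \<omega> Suc.prems(1)] by (simp add: ennreal_mult')
  qed
  have Y_meas [measurable]: "(\<lambda>\<omega>. ?Y \<omega>) \<in> borel_measurable M"
    using Suc.prems by (intro borel_measurable_exp[THEN measurable_compose[rotated]] borel_measurable_sum
        borel_measurable_times B_measurable) auto
  interpret P: pair_sigma_finite lborel M ..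
  have "(\<integral>\<^sup>+\<omega>. ennreal (?Y \<omega> * ?A s \<omega> ^ Suc n) \<partial>M)
      = (\<integral>\<^sup>+\<omega>. \<integral>\<^sup>+v. ?F v \<omega> \<partial>lborel \<partial>M)"
    by (intro nn_integral_cong split)
  also have "\<dots> = (\<integral>\<^sup>+v. \<integral>\<^sup>+\<omega>. ?F v \<omega> \<partial>M \<partial>lborel)"
    proof (rule P.Fubini')
    have m1: "(\<lambda>z. ennreal (?Y (snd z))) \<in> borel_measurable (lborel \<Otimes>\<^sub>M M)"
      by measurable
    have m2: "(\<lambda>z. ennreal (exp (c * B (max 0 (fst z)) (snd z)))) \<in> borel_measurable (lborel \<Otimes>\<^sub>M M)"
      by measurable
    have [measurable]: "Measurable.pred ((borel \<Otimes>\<^sub>M M) \<Otimes>\<^sub>M borel) (\<lambda>x. snd x \<in> {fst (fst x)..1::real})"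
      unfolding atLeastAtMost_iff by measurable
    have m3 [measurable]: "(\<lambda>z. ?A' (fst z) (snd z)) \<in> borel_measurable (lborel \<Otimes>\<^sub>M M)"
      by measurable
    have m4: "(\<lambda>z. ?A' (fst z) (snd z) ^ n) \<in> borel_measurable (lborel \<Otimes>\<^sub>M M)"
      by measurable
    have m5: "(\<lambda>z. indicator {s..1} (fst z) :: ennreal) \<in> borel_measurable (lborel \<Otimes>\<^sub>M M)"
      by (rule measurable_compose[OF measurable_fst]) simp
    show "(\<lambda>(v, \<omega>). ?F v \<omega>) \<in> borel_measurable (lborel \<Otimes>\<^sub>M M)"
      unfolding split_beta by (intro borel_measurable_times_ennreal borel_measurable_const m1 m2 m4 m5)
  qed
  also have "\<dots> \<le> (\<integral>\<^sup>+v. ennreal (real (Suc n) * (C * exp (lam * (1 - v)) * exp (V / 2 + \<kappa> * v)))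
      * indicator {s..1} v \<partial>lborel)"
  proof (intro nn_integral_mono)
    fix v
    show "(\<integral>\<^sup>+\<omega>. ?F v \<omega> \<partial>M)
        \<le> ennreal (real (Suc n) * (C * exp (lam * (1 - v)) * exp (V / 2 + \<kappa> * v))) * indicator {s..1} v"
    proof (cases "v \<in> {s..1}")
      case True
      then have v: "0 \<le> v" "s \<le> v" "v \<le> 1" using Suc.prems(1) by auto
      \<comment> \<open>A fresh index carries the new time point v with weight \<open>c\<close>. All
        earlier points are at most v, so every mixed minimum is an old time and the quadratic form
        grows by explicit terms only.\<close>
      obtain k where k: "k \<notin> I" using Suc.prems(4) ex_new_if_finite infinite_UNIV_nat by blast
      define a' where "a' = a(k := c)"
      define t' where "t' = t(k := v)"
      have lin: "(\<Sum>i\<in>insert k I. a' i * B (t' i) \<omega>) = c * B v \<omega> + (\<Sum>i\<in>I. a i * B (t i) \<omega>)" for \<omega>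
      proof -
        have "(\<Sum>i\<in>I. a' i * B (t' i) \<omega>) = (\<Sum>i\<in>I. a i * B (t i) \<omega>)"
          using k by (intro sum.cong) (auto simp: a'_def t'_def)
        then show ?thesis using k Suc.prems(4) by (simp add: a'_def t'_def)
      qed
      have lin2: "(\<Sum>i\<in>insert k I. a' i * t' i) = c * v + (\<Sum>i\<in>I. a i * t i)"
      proof -
        have "(\<Sum>i\<in>I. a' i * t' i) = (\<Sum>i\<in>I. a i * t i)"
          using k by (intro sum.cong) (auto simp: a'_def t'_def)
        then show ?thesis using k Suc.prems(4) by (simp add: a'_def t'_def)
      qed
      have quad: "(\<Sum>i\<in>insert k I. \<Sum>j\<in>insert k I. a' i * a' j * min (t' i) (t' j))
          = c\<^sup>2 * v + 2 * c * (\<Sum>i\<in>I. a i * t i) + (\<Sum>i\<in>I. \<Sum>j\<in>I. a i * a j * min (t i) (t j))"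
      proof -
        have 1: "(\<Sum>j\<in>I. a' k * a' j * min (t' k) (t' j)) = c * (\<Sum>i\<in>I. a i * t i)"
          unfolding sum_distrib_left
          using k Suc.prems(5) v by (intro sum.cong) (force simp: a'_def t'_def min_absorb2)+
        have 2: "(\<Sum>i\<in>I. a' i * a' k * min (t' i) (t' k)) = c * (\<Sum>i\<in>I. a i * t i)"
          unfolding sum_distrib_left
          using k Suc.prems(5) v by (intro sum.cong) (force simp: a'_def t'_def min_absorb1)+
        have 3: "(\<Sum>i\<in>I. \<Sum>j\<in>I. a' i * a' j * min (t' i) (t' j)) = (\<Sum>i\<in>I. \<Sum>j\<in>I. a i * a j * min (t i) (t j))"
          using k by (intro sum.cong) (auto simp: a'_def t'_def)
        have 4: "a' k * a' k * min (t' k) (t' k) = c\<^sup>2 * v"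
          by (simp add: a'_def t'_def power2_eq_square)
        show ?thesis
          using k Suc.prems(4) 1 2 3 4 by (simp add: sum.distrib)
      qed
      have "(\<integral>\<^sup>+\<omega>. ?F v \<omega> \<partial>M)
          = (\<integral>\<^sup>+\<omega>. ennreal (real (Suc n)) * ennreal (exp (\<Sum>i\<in>insert k I. a' i * B (t' i) \<omega>) * ?A v \<omega> ^ n) \<partial>M)"
      proof (intro nn_integral_cong)
        fix \<omega> assume \<omega>: "\<omega> \<in> space M"
        show "?F v \<omega>
          = ennreal (real (Suc n)) * ennreal (exp (\<Sum>i\<in>insert k I. a' i * B (t' i) \<omega>) * ?A v \<omega> ^ n)"
          using True v A_nonneg[OF \<omega> v(1)] unfolding A'[OF \<omega> v(1)] lin exp_add
          by (simp add: ennreal_power ac_simps flip: ennreal_mult del: of_nat_Suc)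
      qed
      also have "\<dots> = ennreal (real (Suc n)) * (\<integral>\<^sup>+\<omega>. ennreal (exp (\<Sum>i\<in>insert k I. a' i * B (t' i) \<omega>) * ?A v \<omega> ^ n) \<partial>M)"
      proof (rule nn_integral_cmult)
        have [measurable]: "(\<lambda>\<omega>. ?A v \<omega>) \<in> borel_measurable M"
          using integral_exp_B_measurable[OF v(1), of 1 0 c] by (simp add: e_def)
        show "(\<lambda>\<omega>. ennreal (exp (\<Sum>i\<in>insert k I. a' i * B (t' i) \<omega>) * ?A v \<omega> ^ n)) \<in> borel_measurable M"
          unfolding lin exp_add using B_measurable[OF v(1)] by measurable
      qed
      also have "\<dots> \<le> ennreal (real (Suc n)) * ennreal (fact n * (\<Prod>k=1..n. 1 / (lam - (real k * c)\<^sup>2 / 2)) * exp (lam * (1 - v))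
        * exp (((\<Sum>i\<in>insert k I. \<Sum>j\<in>insert k I. a' i * a' j * min (t' i) (t' j))
            + 2 * (real n * c) * (\<Sum>i\<in>insert k I. a' i * t' i) + (real n * c)\<^sup>2 * v) / 2))"
        unfolding e_def
      proof (intro mult_left_mono Suc.IH)
        show "0 \<le> t' i \<and> t' i \<le> v" if "i \<in> insert k I" for i
          using that Suc.prems(5)[of i] v by (auto simp: t'_def)
        show "(real k * c)\<^sup>2 / 2 < lam" if "k \<le> n" for k
          using Suc.prems(3)[of k] that by simp
      qed (use v Suc.prems(4) in auto)
      also have "((\<Sum>i\<in>insert k I. \<Sum>j\<in>insert k I. a' i * a' j * min (t' i) (t' j))
            + 2 * (real n * c) * (\<Sum>i\<in>insert k I. a' i * t' i) + (real n * c)\<^sup>2 * v) / 2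
          = V / 2 + \<kappa> * v"
        unfolding quad lin2 V_def \<kappa>_def by (simp add: field_simps power2_eq_square)
      finally show ?thesis
        using True C by (simp add: C_def flip: ennreal_mult del: of_nat_Suc)
    qed simp
  qed
  also have "\<dots> = ennreal (integral {s..1} (\<lambda>v. real (Suc n) * (C * exp (lam * (1 - v)) * exp (V / 2 + \<kappa> * v))))"
    using C by (intro nn_integral_Icc_eq_integral continuous_intros) auto
  \<comment> \<open>The exponent is affine in v with slope \<open>\<kappa> - lam < 0\<close>.
    Dropping the contribution of the end point 1 leaves the new factor
    \<open>1 / (lam - \<kappa>)\<close> and the exponential at \<open>s\<close> that the claim
    requires.\<close>
  also have "\<dots> \<le> ennreal (real (Suc n) * C / (lam - \<kappa>) * (exp (lam * (1 - s)) * exp (V / 2 + \<kappa> * s)))"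
  proof (intro ennreal_leI)
    have ex: "exp (lam * (1 - v)) * exp (V / 2 + \<kappa> * v) = exp (lam + V / 2 + (\<kappa> - lam) * v)" for v
      by (simp add: algebra_simps flip: exp_add)
    have "((\<lambda>v. real (Suc n) * C * exp (lam + V / 2 + (\<kappa> - lam) * v)) has_integral
        real (Suc n) * C * ((exp (lam + V / 2 + (\<kappa> - lam) * 1) - exp (lam + V / 2 + (\<kappa> - lam) * s)) / (\<kappa> - lam))) {s..1}"
      using Suc.prems(2) \<kappa> by (intro has_integral_mult_right has_integral_exp_affine) auto
    then have "integral {s..1} (\<lambda>v. real (Suc n) * (C * exp (lam * (1 - v)) * exp (V / 2 + \<kappa> * v)))
        = real (Suc n) * C * ((exp (lam + V / 2 + (\<kappa> - lam) * 1) - exp (lam + V / 2 + (\<kappa> - lam) * s)) / (\<kappa> - lam))"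
      unfolding mult.assoc ex by (rule integral_unique)
    also have "\<dots> \<le> real (Suc n) * C * (exp (lam + V / 2 + (\<kappa> - lam) * s) / (lam - \<kappa>))"
    proof (intro mult_left_mono)
      have "(x - y) / (\<kappa> - lam) \<le> y / (lam - \<kappa>)" if "0 \<le> x" for x y
      proof -
        have "(x - y) / (\<kappa> - lam) = (y - x) / (lam - \<kappa>)"
          by (metis minus_diff_eq minus_divide_divide)
        also have "\<dots> \<le> y / (lam - \<kappa>)"
          using that \<kappa> by (intro divide_right_mono) auto
        finally show ?thesis .
      qed
      then show "(exp (lam + V / 2 + (\<kappa> - lam) * 1) - exp (lam + V / 2 + (\<kappa> - lam) * s)) / (\<kappa> - lam)
          \<le> exp (lam + V / 2 + (\<kappa> - lam) * s) / (lam - \<kappa>)"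
        by simp
    qed (use C in simp)
    finally show "integral {s..1} (\<lambda>v. real (Suc n) * (C * exp (lam * (1 - v)) * exp (V / 2 + \<kappa> * v)))
        \<le> real (Suc n) * C / (lam - \<kappa>) * (exp (lam * (1 - s)) * exp (V / 2 + \<kappa> * s))"
      unfolding ex by simp
  qed
  also have "real (Suc n) * C / (lam - \<kappa>) * (exp (lam * (1 - s)) * exp (V / 2 + \<kappa> * s))
      = fact (Suc n) * (\<Prod>k=1..Suc n. 1 / (lam - (real k * c)\<^sup>2 / 2)) * exp (lam * (1 - s))
        * exp ((V + (real (Suc n) * c)\<^sup>2 * s) / 2)"
    by (simp add: C_def \<kappa>_def add_divide_distrib)
  finally show ?case unfolding V_def e_def .
qed

end

section \<open>Exponential tilting by a piecewise linear path\<close>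

context brownian
begin

context
  fixes tt d :: "nat \<Rightarrow> real" and n :: nat
  assumes tt_mono: "mono tt" and tt_0: "tt 0 = 0"
begin

definition tilt :: "'a \<Rightarrow> real" where
  "tilt \<omega> = (\<Sum>i<n. d i * (B (tt (Suc i)) \<omega> - B (tt i) \<omega>))"

definition tilt_var :: real where
  "tilt_var = (\<Sum>i<n. (d i)\<^sup>2 * (tt (Suc i) - tt i))"

text \<open>The covariance of \<open>tilt\<close> with \<open>B t\<close>. As a function of t it is
  the polygon with slope \<open>d i\<close> on the i-th cell, by which the density proportional to
  \<open>exp tilt\<close> shifts \<open>B\<close>.\<close>

definition tilt_path :: "real \<Rightarrow> real" where
  "tilt_path t = (\<Sum>i<n. d i * (min (tt (Suc i)) t - min (tt i) t))"

lemma tt_nonneg: "0 \<le> tt i"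
  using monoD[OF tt_mono, of 0 i] tt_0 by simp

lemma tilt_measurable: "tilt \<in> borel_measurable M"
  unfolding tilt_def[abs_def]
  by (intro borel_measurable_sum borel_measurable_times borel_measurable_diff B_measurable tt_nonneg) auto

lemma overlap_grid:
  "overlap (tt i) (tt (Suc i)) (tt j) (tt (Suc j)) = (if i = j then tt (Suc i) - tt i else 0)"
proof -
  consider "i = j" | "Suc i \<le> j" | "Suc j \<le> i" by linarith
  then show ?thesis
  proof cases
    case 1
    then show ?thesis using monoD[OF tt_mono, of i "Suc i"] by (auto simp: overlap_def min_def)
  next
    case 2
    then have "tt i \<le> tt (Suc i)" "tt (Suc i) \<le> tt j" "tt j \<le> tt (Suc j)"
      by (auto intro: monoD[OF tt_mono])
    then show ?thesis using 2 by (auto simp: overlap_def)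
  next
    case 3
    then have "tt j \<le> tt (Suc j)" "tt (Suc j) \<le> tt i" "tt i \<le> tt (Suc i)"
      by (auto intro: monoD[OF tt_mono])
    then show ?thesis using 3 by (auto simp: overlap_def)
  qed
qed

text \<open>One application of \<open>B_exp\<close> to the grid increments together with the
  interval from 0 to t, which is stored at index \<open>n\<close>. Distinct cells are uncorrelated,
  and the mixed terms add up to \<open>tilt_path\<close>.\<close>

lemma nn_integral_tilt:
  assumes t: "0 \<le> t"
  shows "(\<integral>\<^sup>+\<omega>. ennreal (exp (\<alpha> * tilt \<omega> + \<gamma> * B t \<omega>)) \<partial>M)
    = ennreal (exp ((\<alpha>\<^sup>2 * tilt_var + 2 * \<alpha> * \<gamma> * tilt_path t + \<gamma>\<^sup>2 * t) / 2))"
proof -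
  define a where "a i = (if i < n then \<alpha> * d i else \<gamma>)" for i
  define lo where "lo i = (if i < n then tt i else 0)" for i
  define hi where "hi i = (if i < n then tt (Suc i) else t)" for i
  have lin: "(\<Sum>i\<in>{..n}. a i * (B (hi i) \<omega> - B (lo i) \<omega>)) = \<alpha> * tilt \<omega> + \<gamma> * B t \<omega>"
    if "\<omega> \<in> space M" for \<omega>
    using that
    by (simp add: lessThan_Suc_atMost[symmetric] a_def lo_def hi_def tilt_def B_zero sum_distrib_left mult.assoc)
  have "(\<Sum>i\<in>{..n}. \<Sum>j\<in>{..n}. a i * a j * overlap (lo i) (hi i) (lo j) (hi j))
      = (\<Sum>i<n. \<Sum>j<n. \<alpha> * d i * (\<alpha> * d j) * overlap (tt i) (tt (Suc i)) (tt j) (tt (Suc j)))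
        + (\<Sum>i<n. \<alpha> * d i * \<gamma> * overlap (tt i) (tt (Suc i)) 0 t)
        + ((\<Sum>j<n. \<gamma> * (\<alpha> * d j) * overlap 0 t (tt j) (tt (Suc j))) + \<gamma> * \<gamma> * overlap 0 t 0 t)"
    by (simp add: lessThan_Suc_atMost[symmetric] a_def lo_def hi_def sum.distrib)
  also have "(\<Sum>i<n. \<Sum>j<n. \<alpha> * d i * (\<alpha> * d j) * overlap (tt i) (tt (Suc i)) (tt j) (tt (Suc j)))
      = \<alpha>\<^sup>2 * tilt_var"
    by (simp add: overlap_grid tilt_var_def sum_distrib_left power2_eq_square if_distrib[where f = "\<lambda>x. _ * x"] ac_simps cong: if_cong)
  also have "(\<Sum>i<n. \<alpha> * d i * \<gamma> * overlap (tt i) (tt (Suc i)) 0 t) = \<alpha> * \<gamma> * tilt_path t"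
    unfolding tilt_path_def sum_distrib_left
    by (intro sum.cong) (use t tt_nonneg in \<open>auto simp: overlap_def min_absorb2\<close>)
  also have "(\<Sum>j<n. \<gamma> * (\<alpha> * d j) * overlap 0 t (tt j) (tt (Suc j))) = \<alpha> * \<gamma> * tilt_path t"
    unfolding tilt_path_def sum_distrib_left
    by (intro sum.cong) (use t tt_nonneg in \<open>auto simp: overlap_def min.commute min_absorb2\<close>)
  also have "\<gamma> * \<gamma> * overlap 0 t 0 t = \<gamma>\<^sup>2 * t"
    using t by (simp add: overlap_def power2_eq_square)
  finally have quad: "(\<Sum>i\<in>{..n}. \<Sum>j\<in>{..n}. a i * a j * overlap (lo i) (hi i) (lo j) (hi j))
      = \<alpha>\<^sup>2 * tilt_var + 2 * \<alpha> * \<gamma> * tilt_path t + \<gamma>\<^sup>2 * t" by simp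
  have "(\<integral>\<^sup>+\<omega>. ennreal (exp (\<alpha> * tilt \<omega> + \<gamma> * B t \<omega>)) \<partial>M)
      = (\<integral>\<^sup>+\<omega>. ennreal (exp (\<Sum>i\<in>{..n}. a i * (B (hi i) \<omega> - B (lo i) \<omega>))) \<partial>M)"
    by (intro nn_integral_cong) (simp add: lin)
  also have "\<dots> = ennreal (exp ((\<Sum>i\<in>{..n}. \<Sum>j\<in>{..n}. a i * a j * overlap (lo i) (hi i) (lo j) (hi j)) / 2))"
    by (intro B_exp) (use t tt_nonneg monoD[OF tt_mono] in \<open>auto simp: lo_def hi_def\<close>)
  finally show ?thesis unfolding quad .
qed

lemma integral_tilt:
  assumes t: "0 \<le> t"
  shows "has_bochner_integral M (\<lambda>\<omega>. exp (\<alpha> * tilt \<omega> + \<gamma> * B t \<omega>))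
    (exp ((\<alpha>\<^sup>2 * tilt_var + 2 * \<alpha> * \<gamma> * tilt_path t + \<gamma>\<^sup>2 * t) / 2))"
proof (rule has_bochner_integral_nn_integral)
  show "(\<lambda>\<omega>. exp (\<alpha> * tilt \<omega> + \<gamma> * B t \<omega>)) \<in> borel_measurable M"
    using tilt_measurable B_measurable[OF t] by measurable
qed (auto simp: nn_integral_tilt[OF t])

lemma tilt_path_continuous: "continuous_on A tilt_path"
  unfolding tilt_path_def[abs_def] by (intro continuous_intros)

text \<open>Under the tilted measure the process \<open>s * B\<close> is centred at \<open>tilt_path\<close>.\<close>

lemma tilted_mean_square:
  assumes t: "0 \<le> t" and s: "0 < s"
  shows "(\<integral>\<^sup>+\<omega>. ennreal (exp (tilt \<omega> / s - tilt_var / (2 * s\<^sup>2))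
        * (exp (m * t + s * B t \<omega>) - exp (tilt_path t))\<^sup>2) \<partial>M)
    = ennreal (exp (2 * tilt_path t)
        * (exp (2 * m * t + 2 * s\<^sup>2 * t) - 2 * exp (m * t + s\<^sup>2 * t / 2) + 1))"
proof -
  let ?h = "tilt_path t" and ?v = "tilt_var / (2 * s\<^sup>2)"
  \<comment> \<open>Dividing the tilt by \<open>s\<close> shifts \<open>B\<close> by
    \<open>tilt_path / s\<close>, hence \<open>s * B\<close> by \<open>tilt_path\<close>. The
    expanded square consists of Laplace transforms with \<open>\<gamma>\<close> equal to
    \<open>2 * s\<close>, \<open>s\<close> and 0, and the variance of the tilt cancels against the
    normalisation.\<close>
  have expand: "exp (tilt \<omega> / s - ?v) * (exp (m * t + s * B t \<omega>) - exp ?h)\<^sup>2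
      = exp (2 * m * t - ?v) * exp (1 / s * tilt \<omega> + 2 * s * B t \<omega>)
        - 2 * exp (?h + m * t - ?v) * exp (1 / s * tilt \<omega> + s * B t \<omega>)
        + exp (2 * ?h - ?v) * exp (1 / s * tilt \<omega> + 0 * B t \<omega>)" for \<omega>
    by (simp add: power2_eq_square algebra_simps flip: exp_add)
  have "has_bochner_integral M (\<lambda>\<omega>. exp (tilt \<omega> / s - ?v) * (exp (m * t + s * B t \<omega>) - exp ?h)\<^sup>2)
      (exp (2 * m * t - ?v) * exp (((1 / s)\<^sup>2 * tilt_var + 2 * (1 / s) * (2 * s) * ?h + (2 * s)\<^sup>2 * t) / 2)
        - 2 * exp (?h + m * t - ?v) * exp (((1 / s)\<^sup>2 * tilt_var + 2 * (1 / s) * s * ?h + s\<^sup>2 * t) / 2)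
        + exp (2 * ?h - ?v) * exp (((1 / s)\<^sup>2 * tilt_var + 2 * (1 / s) * 0 * ?h + 0\<^sup>2 * t) / 2))"
    unfolding expand
    by (intro has_bochner_integral_add has_bochner_integral_diff has_bochner_integral_mult_right integral_tilt t)
  moreover have "(exp (2 * m * t - ?v) * exp (((1 / s)\<^sup>2 * tilt_var + 2 * (1 / s) * (2 * s) * ?h + (2 * s)\<^sup>2 * t) / 2)
        - 2 * exp (?h + m * t - ?v) * exp (((1 / s)\<^sup>2 * tilt_var + 2 * (1 / s) * s * ?h + s\<^sup>2 * t) / 2)
        + exp (2 * ?h - ?v) * exp (((1 / s)\<^sup>2 * tilt_var + 2 * (1 / s) * 0 * ?h + 0\<^sup>2 * t) / 2))
      = exp (2 * ?h) * (exp (2 * m * t + 2 * s\<^sup>2 * t) - 2 * exp (m * t + s\<^sup>2 * t / 2) + 1)"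
    using s by (simp add: power_divide add_divide_distrib diff_divide_distrib algebra_simps flip: exp_add)
  ultimately have "has_bochner_integral M (\<lambda>\<omega>. exp (tilt \<omega> / s - ?v) * (exp (m * t + s * B t \<omega>) - exp ?h)\<^sup>2)
      (exp (2 * ?h) * (exp (2 * m * t + 2 * s\<^sup>2 * t) - 2 * exp (m * t + s\<^sup>2 * t / 2) + 1))"
    by simp
  then show ?thesis
    by (subst nn_integral_eq_integral) (auto simp: has_bochner_integral_iff)
qed

text \<open>Tonelli reduces the distance of the averages to the mean squares at fixed times. The
  inequality \<open>\<bar>x\<bar> \<le> \<eta> / 2 + x\<^sup>2 / (2 * \<eta>)\<close> takes the role
  of Cauchy-Schwarz and leaves \<open>\<eta>\<close> to be chosen later.\<close>

lemma tilted_mean_distance: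
  assumes \<tau>: "0 \<le> \<tau>" "\<tau> \<le> 1" and s: "0 < s" and \<eta>: "0 < \<eta>"
    and R: "\<And>t. \<tau> \<le> t \<Longrightarrow> t \<le> 1 \<Longrightarrow> exp (2 * tilt_path t)
        * (exp (2 * m * t + 2 * s\<^sup>2 * t) - 2 * exp (m * t + s\<^sup>2 * t / 2) + 1) \<le> R"
  shows "(\<integral>\<^sup>+\<omega>. ennreal (exp (tilt \<omega> / s - tilt_var / (2 * s\<^sup>2))
      * \<bar>integral {\<tau>..1} (\<lambda>t. exp (m * t + s * B t \<omega>)) - integral {\<tau>..1} (\<lambda>t. exp (tilt_path t))\<bar>) \<partial>M)
    \<le> ennreal (\<eta> / 2 + R / (2 * \<eta>))"
proof -
  let ?h = tilt_path and ?v = "tilt_var / (2 * s\<^sup>2)"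
  let ?Z = "\<lambda>\<omega>. exp (tilt \<omega> / s - ?v)"
  let ?f = "\<lambda>\<omega> t. exp (m * t + s * B t \<omega>)"
  let ?f' = "\<lambda>\<omega> t. exp (m * t + s * B (max 0 t) \<omega>)"
  let ?F = "\<lambda>\<omega> t. (ennreal (?Z \<omega>) * ennreal (\<eta> / 2) 
      + ennreal (1 / (2 * \<eta>)) * ennreal (?Z \<omega> * (?f' \<omega> t - exp (?h t))\<^sup>2)) * indicator {\<tau>..1} t"
  have [measurable]: "tilt \<in> borel_measurable M" by (rule tilt_measurable)
  have [measurable]: "?h \<in> borel_measurable borel"
    using tilt_path_continuous by (rule borel_measurable_continuous_onI)
  have Z_int: "(\<integral>\<^sup>+\<omega>. ennreal (?Z \<omega>) \<partial>M) = 1"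
  proof -
    have "(\<integral>\<^sup>+\<omega>. ennreal (?Z \<omega>) \<partial>M)
        = (\<integral>\<^sup>+\<omega>. ennreal (exp (- ?v)) * ennreal (exp (1 / s * tilt \<omega> + 0 * B 0 \<omega>)) \<partial>M)"
      by (intro nn_integral_cong) (simp add: algebra_simps flip: ennreal_mult exp_add)
    also have "\<dots> = ennreal (exp (- ?v)) * ennreal (exp (((1 / s)\<^sup>2 * tilt_var + 2 * (1 / s) * 0 * ?h 0 + 0\<^sup>2 * 0) / 2))"
      using B_measurable[of 0] by (subst nn_integral_cmult, measurable) (subst nn_integral_tilt, auto)
    also have "\<dots> = 1"
      by (simp add: power_divide algebra_simps flip: ennreal_mult exp_add)
    finally show ?thesis .
  qed
  have pw: "ennreal (?Z \<omega> * \<bar>integral {\<tau>..1} (?f \<omega>) - integral {\<tau>..1} (\<lambda>t. exp (?h t))\<bar>)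
      \<le> (\<integral>\<^sup>+t. ?F \<omega> t \<partial>lborel)"
    if \<omega>: "\<omega> \<in> space M" for \<omega>
  proof -
    have f_cont: "continuous_on {\<tau>..1} (?f \<omega>)"
      by (intro continuous_intros continuous_on_B \<omega> \<tau>)
    have h_cont: "continuous_on {\<tau>..1} (\<lambda>t. exp (?h t))"
      by (intro continuous_intros tilt_path_continuous)
    have "\<bar>integral {\<tau>..1} (?f \<omega>) - integral {\<tau>..1} (\<lambda>t. exp (?h t))\<bar>
        = \<bar>integral {\<tau>..1} (\<lambda>t. ?f \<omega> t - exp (?h t))\<bar>"
      using f_cont h_cont by (subst Henstock_Kurzweil_Integration.integral_diff) (auto intro: integrable_continuous_real)
    also have "\<dots> \<le> integral {\<tau>..1} (\<lambda>t. \<eta> / 2 + 1 / (2 * \<eta>) * (?f \<omega> t - exp (?h t))\<^sup>2)"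
    proof -
      have "\<bar>x\<bar> \<le> \<eta> / 2 + 1 / (2 * \<eta>) * x\<^sup>2" for x
      proof -
        have "0 \<le> (\<bar>x\<bar> - \<eta>)\<^sup>2" by simp
        then show ?thesis using \<eta> by (simp add: field_simps power2_eq_square)
      qed
      then have "norm (integral {\<tau>..1} (\<lambda>t. ?f \<omega> t - exp (?h t)))
          \<le> integral {\<tau>..1} (\<lambda>t. \<eta> / 2 + 1 / (2 * \<eta>) * (?f \<omega> t - exp (?h t))\<^sup>2)"
        by (intro integral_norm_bound_integral integrable_continuous_real continuous_intros f_cont h_cont) simp
      then show ?thesis by simp
    qed
    finally have "?Z \<omega> * \<bar>integral {\<tau>..1} (?f \<omega>) - integral {\<tau>..1} (\<lambda>t. exp (?h t))\<bar>
        \<le> ?Z \<omega> * integral {\<tau>..1} (\<lambda>t. \<eta> / 2 + 1 / (2 * \<eta>) * (?f \<omega> t - exp (?h t))\<^sup>2)"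
      by (intro mult_left_mono) auto
    also have "\<dots> = integral {\<tau>..1} (\<lambda>t. ?Z \<omega> * (\<eta> / 2 + 1 / (2 * \<eta>) * (?f \<omega> t - exp (?h t))\<^sup>2))"
      by simp
    finally have "ennreal (?Z \<omega> * \<bar>integral {\<tau>..1} (?f \<omega>) - integral {\<tau>..1} (\<lambda>t. exp (?h t))\<bar>)
        \<le> ennreal (integral {\<tau>..1} (\<lambda>t. ?Z \<omega> * (\<eta> / 2 + 1 / (2 * \<eta>) * (?f \<omega> t - exp (?h t))\<^sup>2)))"
      by (rule ennreal_leI)
    also have "\<dots> = (\<integral>\<^sup>+t. ennreal (?Z \<omega> * (\<eta> / 2 + 1 / (2 * \<eta>) * (?f \<omega> t - exp (?h t))\<^sup>2)) * indicator {\<tau>..1} t \<partial>lborel)"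
      using \<eta> by (intro nn_integral_Icc_eq_integral[symmetric] continuous_intros f_cont h_cont) auto
    also have "\<dots> = (\<integral>\<^sup>+t. ?F \<omega> t \<partial>lborel)"
    proof (intro nn_integral_cong)
      fix t
      show "ennreal (?Z \<omega> * (\<eta> / 2 + 1 / (2 * \<eta>) * (?f \<omega> t - exp (?h t))\<^sup>2)) * indicator {\<tau>..1} t
          = ?F \<omega> t"
        using \<eta> \<tau> by (cases "t \<in> {\<tau>..1}")
          (simp_all add: algebra_simps flip: ennreal_mult ennreal_plus)
    qed
    finally show ?thesis .
  qed
  interpret P: pair_sigma_finite lborel M ..
  have "(\<integral>\<^sup>+\<omega>. ennreal (?Z \<omega> * \<bar>integral {\<tau>..1} (?f \<omega>) - integral {\<tau>..1} (\<lambda>t. exp (?h t))\<bar>) \<partial>M)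
      \<le> (\<integral>\<^sup>+\<omega>. \<integral>\<^sup>+t. ?F \<omega> t \<partial>lborel \<partial>M)"
    by (intro nn_integral_mono pw)
  also have "\<dots> = (\<integral>\<^sup>+t. \<integral>\<^sup>+\<omega>. ?F \<omega> t \<partial>M \<partial>lborel)"
  proof (rule P.Fubini')
    have m1: "(\<lambda>z. indicator {\<tau>..1} (fst z) :: ennreal) \<in> borel_measurable (lborel \<Otimes>\<^sub>M M)"
      by (rule measurable_compose[OF measurable_fst]) simp
    have m2: "(\<lambda>z. ennreal (?Z (snd z))) \<in> borel_measurable (lborel \<Otimes>\<^sub>M M)"
      by measurable
    have m3: "(\<lambda>z. ennreal (?Z (snd z) * (?f' (snd z) (fst z) - exp (?h (fst z)))\<^sup>2)) \<in> borel_measurable (lborel \<Otimes>\<^sub>M M)"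
      by measurable
    show "(\<lambda>(t, \<omega>). ?F \<omega> t)
        \<in> borel_measurable (lborel \<Otimes>\<^sub>M M)"
      unfolding split_beta
      by (intro borel_measurable_times_ennreal borel_measurable_add borel_measurable_const m1 m2 m3)
  qed
  also have "\<dots> \<le> (\<integral>\<^sup>+t. ennreal (\<eta> / 2 + R / (2 * \<eta>)) * indicator {\<tau>..1} t \<partial>lborel)"
  proof (intro nn_integral_mono)
    fix t
    show "(\<integral>\<^sup>+\<omega>. ?F \<omega> t \<partial>M)
        \<le> ennreal (\<eta> / 2 + R / (2 * \<eta>)) * indicator {\<tau>..1} t"
    proof (cases "t \<in> {\<tau>..1}")
      case True
      then have t: "0 \<le> t" "\<tau> \<le> t" "t \<le> 1" using \<tau> by auto
      have [measurable]: "B t \<in> borel_measurable M" using t by (intro B_measurable)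
      have "(\<integral>\<^sup>+\<omega>. ?F \<omega> t \<partial>M)
        = (\<integral>\<^sup>+\<omega>. ennreal (?Z \<omega>) * ennreal (\<eta> / 2)
          + ennreal (1 / (2 * \<eta>)) * ennreal (?Z \<omega> * (?f \<omega> t - exp (?h t))\<^sup>2) \<partial>M)"
        using True t by simp
      also have "\<dots> = (\<integral>\<^sup>+\<omega>. ennreal (?Z \<omega>) \<partial>M) * ennreal (\<eta> / 2)
          + ennreal (1 / (2 * \<eta>)) * (\<integral>\<^sup>+\<omega>. ennreal (?Z \<omega> * (?f \<omega> t - exp (?h t))\<^sup>2) \<partial>M)"
        by (subst nn_integral_add, measurable, subst nn_integral_multc, measurable,
            subst nn_integral_cmult, measurable)
      also have "\<dots> \<le> ennreal (\<eta> / 2) + ennreal (1 / (2 * \<eta>)) * ennreal R"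
        unfolding Z_int tilted_mean_square[OF t(1) s]
        using R[OF t(2,3)] by (intro add_mono mult_left_mono ennreal_leI) auto
      also have "\<dots> = ennreal (\<eta> / 2 + R / (2 * \<eta>))"
      proof -
        have "0 \<le> exp (2 * tilt_path t)
            * (exp (2 * m * t + 2 * s\<^sup>2 * t) - 2 * exp (m * t + s\<^sup>2 * t / 2) + 1)"
        proof -
          \<comment> \<open>The bracket dominates a square, so its upper bound \<open>R\<close> is
            nonnegative and the sum can be formed in the reals.\<close>
          have "0 \<le> (exp (m * t + s\<^sup>2 * t / 2) - 1)\<^sup>2" by simp
          also have "\<dots> = exp (2 * m * t + s\<^sup>2 * t) - 2 * exp (m * t + s\<^sup>2 * t / 2) + 1"
            by (simp add: power2_eq_square algebra_simps flip: exp_add)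
          also have "\<dots> \<le> exp (2 * m * t + 2 * s\<^sup>2 * t) - 2 * exp (m * t + s\<^sup>2 * t / 2) + 1"
            using t by simp
          finally show ?thesis by simp
        qed
        then have "0 \<le> R" using R[OF t(2,3)] by linarith
        then show ?thesis using \<eta> by (simp flip: ennreal_mult ennreal_plus)
      qed
      finally show ?thesis using True by simp
    qed simp
  qed
  also have "\<dots> = ennreal (\<eta> / 2 + R / (2 * \<eta>)) * ennreal (1 - \<tau>)"
    using \<tau> by (simp add: nn_integral_cmult)
  also have "\<dots> \<le> ennreal (\<eta> / 2 + R / (2 * \<eta>)) * 1"
    using \<tau> by (intro mult_left_mono) (auto simp: ennreal_le_1)
  finally show ?thesis by simp
qed

text \<open>The truncation \<open>Z \<le> X + Z powr p * X powr (1 - p)\<close> of the density \<open>Z\<close> transfers a lower bound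
  for the tilted measure to the original one.\<close>

lemma tilt_lower_bound:
  assumes \<tau>: "0 \<le> \<tau>" "\<tau> \<le> 1" and s: "0 < s" and p: "1 < p" and \<delta>: "0 < \<delta>"
    and R: "\<And>t. \<tau> \<le> t \<Longrightarrow> t \<le> 1 \<Longrightarrow> exp (2 * tilt_path t)
        * (exp (2 * m * t + 2 * s\<^sup>2 * t) - 2 * exp (m * t + s\<^sup>2 * t / 2) + 1) \<le> \<delta>\<^sup>2 / 16"
  shows "exp (- (ln 4 / (p - 1) + p * tilt_var / (2 * s\<^sup>2))) / 2
    \<le> prob {\<omega> \<in> space M. \<bar>integral {\<tau>..1} (\<lambda>t. exp (m * t + s * B t \<omega>))
          - integral {\<tau>..1} (\<lambda>t. exp (tilt_path t))\<bar> \<le> \<delta>}"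
proof -
  let ?v = "tilt_var / (2 * s\<^sup>2)"
  let ?Z = "\<lambda>\<omega>. exp (tilt \<omega> / s - ?v)"
  let ?D = "\<lambda>\<omega>. \<bar>integral {\<tau>..1} (\<lambda>t. exp (m * t + s * B t \<omega>)) - integral {\<tau>..1} (\<lambda>t. exp (tilt_path t))\<bar>"
  \<comment> \<open>The threshold for the logarithm of the density. It is chosen so that the tilted
    mass above it is bounded by \<open>exp ((1 - p) * x + p * (p - 1) * ?v) = 1 / 4\<close>.\<close>
  define x where "x = ln 4 / (p - 1) + p * ?v"
  let ?G = "{\<omega> \<in> space M. ?D \<omega> \<le> \<delta>}"
  have [measurable]: "tilt \<in> borel_measurable M" by (rule tilt_measurable)
  have [measurable]: "(\<lambda>\<omega>. integral {\<tau>..1} (\<lambda>t. exp (m * t + s * B t \<omega>))) \<in> borel_measurable M"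
    by (rule integral_exp_B_measurable[OF \<tau>(1)])
  have G [measurable]: "?G \<in> sets M" by measurable
  have [measurable]: "B 0 \<in> borel_measurable M" by (rule B_measurable) simp
  have Z_p: "(\<integral>\<^sup>+\<omega>. ennreal (exp (c + q * tilt \<omega> / s - q * ?v)) \<partial>M) = ennreal (exp (c + q * (q - 1) * ?v))"
    for c q
  proof -
    have "(\<integral>\<^sup>+\<omega>. ennreal (exp (c + q * tilt \<omega> / s - q * ?v)) \<partial>M)
        = (\<integral>\<^sup>+\<omega>. ennreal (exp (c - q * ?v)) * ennreal (exp (q / s * tilt \<omega> + 0 * B 0 \<omega>)) \<partial>M)"
      by (intro nn_integral_cong) (simp add: algebra_simps flip: ennreal_mult exp_add)
    also have "\<dots> = ennreal (exp (c - q * ?v)) * ennreal (exp (((q / s)\<^sup>2 * tilt_var + 2 * (q / s) * 0 * tilt_path 0 + 0\<^sup>2 * 0) / 2))"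
      by (subst nn_integral_cmult, measurable) (subst nn_integral_tilt, auto)
    also have "\<dots> = ennreal (exp (c + q * (q - 1) * ?v))"
      by (simp add: power_divide power2_eq_square diff_divide_distrib algebra_simps flip: ennreal_mult exp_add)
    finally show ?thesis .
  qed
  have "1 = (\<integral>\<^sup>+\<omega>. ennreal (?Z \<omega>) \<partial>M)"
    using Z_p[of 0 1] by simp
  also have "\<dots> \<le> (\<integral>\<^sup>+\<omega>. ennreal (1 / \<delta>) * ennreal (?Z \<omega> * ?D \<omega>)
      + (ennreal (exp x) * indicator ?G \<omega> + ennreal (exp ((1 - p) * x + p * tilt \<omega> / s - p * ?v))) \<partial>M)"
  proof (intro nn_integral_mono)
    fix \<omega> assume \<omega>: "\<omega> \<in> space M"
    have 1: "?Z \<omega> \<le> 1 / \<delta> * (?Z \<omega> * ?D \<omega>)" if "\<omega> \<notin> ?G"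
    proof -
      have "\<delta> \<le> ?D \<omega>" using that \<omega> by simp
      then have "?Z \<omega> * 1 \<le> ?Z \<omega> * (?D \<omega> / \<delta>)"
        using \<delta> by (intro mult_left_mono) auto
      then show ?thesis by simp
    qed
    have 2: "?Z \<omega> \<le> exp x + exp ((1 - p) * x + p * tilt \<omega> / s - p * ?v)"
    proof (cases "tilt \<omega> / s - ?v \<le> x")
      case True
      then have "?Z \<omega> \<le> exp x" by simp
      then show ?thesis by (metis add_increasing2 exp_ge_zero)
    next
      case False
      then have "0 \<le> (p - 1) * (tilt \<omega> / s - ?v - x)" using p by simp
      then have "tilt \<omega> / s - ?v \<le> (1 - p) * x + p * tilt \<omega> / s - p * ?v"
        by (simp add: algebra_simps diff_divide_distrib)
      then have "?Z \<omega> \<le> exp ((1 - p) * x + p * tilt \<omega> / s - p * ?v)" by simp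
      then show ?thesis by (metis add_increasing exp_ge_zero)
    qed
    show "ennreal (?Z \<omega>) \<le> ennreal (1 / \<delta>) * ennreal (?Z \<omega> * ?D \<omega>)
      + (ennreal (exp x) * indicator ?G \<omega> + ennreal (exp ((1 - p) * x + p * tilt \<omega> / s - p * ?v)))"
    proof (cases "\<omega> \<in> ?G")
      case True
      have "ennreal (?Z \<omega>) \<le> ennreal (exp x) * indicator ?G \<omega> + ennreal (exp ((1 - p) * x + p * tilt \<omega> / s - p * ?v))"
        using ennreal_leI[OF 2] True by (simp add: ennreal_plus)
      then show ?thesis by (rule add_increasing[rotated]) simp
    next
      case False
      have "ennreal (?Z \<omega>) \<le> ennreal (1 / \<delta>) * ennreal (?Z \<omega> * ?D \<omega>)"
        using ennreal_leI[OF 1[OF False]] \<delta> by (simp flip: ennreal_mult)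
      then show ?thesis by (rule add_increasing2[rotated]) simp
    qed
  qed
  also have "\<dots> = ennreal (1 / \<delta>) * (\<integral>\<^sup>+\<omega>. ennreal (?Z \<omega> * ?D \<omega>) \<partial>M)
      + (ennreal (exp x) * emeasure M ?G + ennreal (exp ((1 - p) * x + p * (p - 1) * ?v)))"
    unfolding Z_p[symmetric]
    by (simp add: nn_integral_add nn_integral_cmult nn_integral_cmult_indicator)
  \<comment> \<open>With \<open>\<eta> = \<delta> / 4\<close> both terms of the distance bound are
    \<open>\<delta> / 8\<close>, so the tilted mass outside \<open>?G\<close> is at most 1/4.
    Together with the 1/4 above the threshold, at least half of the mass remains in
    \<open>?G\<close> with density at most \<open>exp x\<close>.\<close>
  also have "\<dots> \<le> ennreal (1 / \<delta>) * ennreal (\<delta> / 4 / 2 + \<delta>\<^sup>2 / 16 / (2 * (\<delta> / 4)))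
      + (ennreal (exp x) * emeasure M ?G + ennreal (exp ((1 - p) * x + p * (p - 1) * ?v)))"
    using \<tau> s \<delta> R by (intro add_mono mult_left_mono tilted_mean_distance) auto
  also have "(1 - p) * x + p * (p - 1) * ?v = - ln 4"
  proof -
    have "(p - 1) * (ln 4 / (p - 1)) = ln 4" using p by simp
    moreover have "(1 - p) * x + p * (p - 1) * ?v = - ((p - 1) * (ln 4 / (p - 1)))"
      unfolding x_def by (simp only: algebra_simps)
    ultimately show ?thesis by simp
  qed
  also have "exp (- ln 4 :: real) = 1 / 4" by (simp add: exp_minus)
  also have "ennreal (1 / \<delta>) * ennreal (\<delta> / 4 / 2 + \<delta>\<^sup>2 / 16 / (2 * (\<delta> / 4))) = ennreal (1 / 4)"
    using \<delta> by (simp add: field_simps power2_eq_square flip: ennreal_mult)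
  also have "ennreal (1 / 4) + (ennreal (exp x) * emeasure M ?G + ennreal (1 / 4)) = ennreal (1 / 4 + (exp x * prob ?G + 1 / 4))"
    by (simp add: emeasure_eq_measure flip: ennreal_mult ennreal_plus)
  finally have "1 \<le> 1 / 4 + (exp x * prob ?G + 1 / 4)"
    by (simp only: ennreal_ge_1)
  then have "exp (- x) * (1 / 2) \<le> exp (- x) * (exp x * prob ?G)"
    by (intro mult_left_mono) auto
  also have "\<dots> = prob ?G"
    by (simp flip: mult.assoc exp_add)
  finally show ?thesis unfolding x_def by simp
qed

end

end

section \<open>Discretised paths and Stieltjes sums\<close>

lemma has_integral_increment:
  fixes f f' :: "real \<Rightarrow> real"
  assumes "\<And>t. t \<in> {l..u} \<Longrightarrow> (f has_real_derivative f' t) (at t within {l..u})"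
    and "l \<le> a" "a \<le> b" "b \<le> u"
  shows "(f' has_integral f b - f a) {a..b}"
proof (rule fundamental_theorem_of_calculus)
  fix t assume "t \<in> {a..b}"
  then have "(f has_real_derivative f' t) (at t within {l..u})" using assms by auto
  then have "(f has_real_derivative f' t) (at t within {a..b})"
    by (rule DERIV_subset) (use assms in auto)
  then show "(f has_vector_derivative f' t) (at t within {a..b})"
    by (simp add: has_real_derivative_iff_has_vector_derivative)
qed fact

text \<open>Integrating the square of \<open>g' t - d\<close>, with \<open>d\<close> the slope of
  the chord, gives Cauchy-Schwarz for the energy. Since \<open>E\<close> is a given primitive of the
  squared derivative, no integrability question arises.\<close>

lemma slope_square_le:
  fixes g g' E :: "real \<Rightarrow> real"
  assumes g: "\<And>t. t \<in> {l..u} \<Longrightarrow> (g has_real_derivative g' t) (at t within {l..u})"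
    and E: "\<And>t. t \<in> {l..u} \<Longrightarrow> (E has_real_derivative (g' t)\<^sup>2) (at t within {l..u})"
    and ab: "l \<le> a" "a < b" "b \<le> u"
  shows "((g b - g a) / (b - a))\<^sup>2 * (b - a) \<le> E b - E a"
proof -
  define d where "d = (g b - g a) / (b - a)"
  have d: "g b - g a = d * (b - a)" using ab by (simp add: d_def)
  have "((\<lambda>t. (g' t)\<^sup>2 - 2 * d * g' t + d\<^sup>2) has_integral
      (E b - E a) - 2 * d * (g b - g a) + d\<^sup>2 * (b - a)) {a..b}"
    using ab has_integral_const_real[of "d\<^sup>2" a b]
    by (intro has_integral_add has_integral_diff has_integral_mult_right
        has_integral_increment[OF g] has_integral_increment[OF E]) (auto simp: mult.commute)
  then have "0 \<le> (E b - E a) - 2 * d * (g b - g a) + d\<^sup>2 * (b - a)"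
  proof (rule has_integral_nonneg)
    fix t
    have "(g' t)\<^sup>2 - 2 * d * g' t + d\<^sup>2 = (g' t - d)\<^sup>2" by (simp add: power2_diff)
    then show "0 \<le> (g' t)\<^sup>2 - 2 * d * g' t + d\<^sup>2" by simp
  qed
  then have "d\<^sup>2 * (b - a) \<le> E b - E a"
    unfolding d by (simp add: power2_eq_square algebra_simps)
  then show ?thesis unfolding d_def .
qed

section \<open>Equidistant grids and polygonal interpolation\<close>

context
  fixes \<tau> :: real and N :: nat
  assumes \<tau>: "0 < \<tau>" "\<tau> < 1" and N: "0 < N"
begin

definition node :: "nat \<Rightarrow> real" where
  "node j = \<tau> + real j * ((1 - \<tau>) / real N)"

text \<open>Time 0 is put in front of the nodes, so cell 0 runs from 0 to \<tau> and the cell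
  starting at \<open>node j\<close> has index \<open>Suc j\<close>. Nodes continue beyond 1, which
  keeps the sequence monotone on all indices, as tilting requires.\<close>

definition grid :: "nat \<Rightarrow> real" where
  "grid i = (case i of 0 \<Rightarrow> 0 | Suc j \<Rightarrow> node j)"

lemma node_0: "node 0 = \<tau>" and node_N: "node N = 1"
  using N by (auto simp: node_def)

lemma node_Suc: "node (Suc j) - node j = (1 - \<tau>) / real N"
  by (simp add: node_def algebra_simps add_divide_distrib diff_divide_distrib)

lemma node_step_pos: "0 < (1 - \<tau>) / real N"
  using \<tau> N by simp

lemma node_mono: "i \<le> j \<Longrightarrow> node i \<le> node j"
  unfolding node_def using node_step_pos by (intro add_left_mono mult_right_mono) auto

lemma node_ge: "\<tau> \<le> node j"
  using node_mono[of 0 j] node_0 by simp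

lemma node_le: "j \<le> N \<Longrightarrow> node j \<le> 1"
  using node_mono[of j N] node_N by simp

lemma grid_simps: "grid 0 = 0" "grid (Suc j) = node j"
  by (simp_all add: grid_def)

lemma grid_mono: "mono grid"
proof (rule monoI)
  fix i j :: nat assume "i \<le> j"
  then show "grid i \<le> grid j"
    using \<tau> node_ge[of "j - 1"] node_mono[of "i - 1" "j - 1"]
    by (cases i; cases j) (auto simp: grid_def)
qed

text \<open>The slope on cell 0 belongs to the straight line from the origin to
  \<open>g \<tau>\<close>; values of \<open>g\<close> before \<tau> are never consulted.\<close>

definition chord :: "(real \<Rightarrow> real) \<Rightarrow> nat \<Rightarrow> real" where
  "chord g i = (case i of 0 \<Rightarrow> g \<tau> / \<tau> | Suc j \<Rightarrow> (g (node (Suc j)) - g (node j)) / (node (Suc j) - node j))"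

context
  fixes g g' E :: "real \<Rightarrow> real"
  assumes g: "\<And>t. t \<in> {\<tau>..1} \<Longrightarrow> (g has_real_derivative g' t) (at t within {\<tau>..1})"
    and E: "\<And>t. t \<in> {\<tau>..1} \<Longrightarrow> (E has_real_derivative (g' t)\<^sup>2) (at t within {\<tau>..1})"
begin

text \<open>On each cell the chord has the least energy for its end values, so interpolation never
  makes a path more expensive.\<close>

lemma chord_energy_le:
  "(\<Sum>i<Suc N. (chord g i)\<^sup>2 * (grid (Suc i) - grid i)) \<le> (g \<tau>)\<^sup>2 / \<tau> + (E 1 - E \<tau>)"
proof -
  have "(\<Sum>i<Suc N. (chord g i)\<^sup>2 * (grid (Suc i) - grid i))
      = (g \<tau> / \<tau>)\<^sup>2 * \<tau> + (\<Sum>j<N. (chord g (Suc j))\<^sup>2 * (node (Suc j) - node j))"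
    by (subst sum.lessThan_Suc_shift) (simp add: grid_simps chord_def node_0)
  also have "(g \<tau> / \<tau>)\<^sup>2 * \<tau> = (g \<tau>)\<^sup>2 / \<tau>"
    using \<tau> by (simp add: power2_eq_square)
  also have "(\<Sum>j<N. (chord g (Suc j))\<^sup>2 * (node (Suc j) - node j)) \<le> (\<Sum>j<N. E (node (Suc j)) - E (node j))"
  proof (intro sum_mono)
    fix j assume "j \<in> {..<N}"
    then have j: "Suc j \<le> N" by simp
    have "node j < node (Suc j)" using node_Suc[of j] node_step_pos by simp
    from slope_square_le[OF g E node_ge this node_le[OF j]]
    show "(chord g (Suc j))\<^sup>2 * (node (Suc j) - node j) \<le> E (node (Suc j)) - E (node j)"
      by (simp add: chord_def)
  qed
  also have "(\<Sum>j<N. E (node (Suc j)) - E (node j)) = E 1 - E \<tau>"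
    using sum_lessThan_telescope[of "\<lambda>j. E (node j)" N] by (simp add: node_0 node_N)
  finally show ?thesis by simp
qed

lemma lipschitz_increment:
  assumes L: "\<And>t. t \<in> {\<tau>..1} \<Longrightarrow> \<bar>g' t\<bar> \<le> L" and ab: "\<tau> \<le> a" "a \<le> b" "b \<le> 1"
  shows "\<bar>g b - g a\<bar> \<le> L * (b - a)"
proof -
  have i: "(g' has_integral g b - g a) {a..b}" by (rule has_integral_increment[OF g]) (use ab in auto)
  have "norm (g b - g a) \<le> L * measure lborel (cbox a b)"
    using i ab L by (intro has_integral_bound[of L g']) (auto intro!: order.trans[OF abs_ge_zero L])
  then show ?thesis using ab by simp
qed

text \<open>The cells before the one containing t telescope to \<open>g (node k)\<close>; inside a
  single cell the path and its chord each move by at most \<open>L\<close> times the mesh.\<close>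

lemma chord_path_close:
  assumes L: "\<And>t. t \<in> {\<tau>..1} \<Longrightarrow> \<bar>g' t\<bar> \<le> L" and t: "\<tau> \<le> t" "t \<le> 1"
  shows "\<bar>(\<Sum>i<Suc N. chord g i * (min (grid (Suc i)) t - min (grid i) t)) - g t\<bar>
    \<le> 2 * L * ((1 - \<tau>) / real N)"
proof -
  let ?h = "(1 - \<tau>) / real N"
  have "\<exists>j. t \<le> node (Suc j)"
    using t node_N N by (intro exI[of _ "N - 1"]) simp
  \<comment> \<open>The first cell whose right end reaches t; minimality gives
    \<open>node k \<le> t\<close>.\<close>
  define k where "k = (LEAST j. t \<le> node (Suc j))"
  have k1: "t \<le> node (Suc k)" unfolding k_def by (rule LeastI_ex) fact
  have k2: "k < N"
  proof -
    have "k \<le> N - 1" unfolding k_def by (rule Least_le) (use t node_N N in simp)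
    then show ?thesis using N by simp
  qed
  have k3: "node k \<le> t"
  proof (cases k)
    case 0
    then show ?thesis using t node_0 by simp
  next
    case (Suc j)
    then have "\<not> t \<le> node (Suc j)" using not_less_Least[of j "\<lambda>j. t \<le> node (Suc j)"] k_def by simp
    then show ?thesis using Suc by simp
  qed
  have "(\<Sum>i<Suc N. chord g i * (min (grid (Suc i)) t - min (grid i) t))
      = g \<tau> + (\<Sum>j<N. chord g (Suc j) * (min (node (Suc j)) t - min (node j) t))"
    using \<tau> t by (subst sum.lessThan_Suc_shift) (simp add: grid_simps chord_def node_0)
  also have "(\<Sum>j<N. chord g (Suc j) * (min (node (Suc j)) t - min (node j) t))
      = (\<Sum>j<Suc k. chord g (Suc j) * (min (node (Suc j)) t - min (node j) t))"
  proof (rule sum.mono_neutral_right)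
    show "\<forall>j\<in>{..<N} - {..<Suc k}. chord g (Suc j) * (min (node (Suc j)) t - min (node j) t) = 0"
    proof
      fix j assume "j \<in> {..<N} - {..<Suc k}"
      then have "node (Suc k) \<le> node j" by (intro node_mono) auto
      then have "t \<le> node j" "t \<le> node (Suc j)" using k1 node_mono[of j "Suc j"] by auto
      then show "chord g (Suc j) * (min (node (Suc j)) t - min (node j) t) = 0" by (simp add: min_absorb2)
    qed
  qed (use k2 in auto)
  also have "\<dots> = (\<Sum>j<k. g (node (Suc j)) - g (node j)) + chord g (Suc k) * (t - node k)"
  proof -
    have "chord g (Suc j) * (min (node (Suc j)) t - min (node j) t) = g (node (Suc j)) - g (node j)"
      if "j < k" for j
    proof -
      have "node (Suc j) \<le> node k" "node j \<le> node (Suc j)" using that by (auto intro: node_mono)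
      then have "node (Suc j) \<le> t" "node j \<le> t" using k3 by auto
      moreover have "node (Suc j) - node j \<noteq> 0"
        using node_Suc[of j] node_step_pos by linarith
      ultimately show ?thesis by (simp add: min_absorb1 chord_def)
    qed
    then show ?thesis using k1 k3 by (simp add: min_absorb1 min_absorb2)
  qed
  also have "(\<Sum>j<k. g (node (Suc j)) - g (node j)) = g (node k) - g \<tau>"
    using sum_lessThan_telescope[of "\<lambda>j. g (node j)" k] by (simp add: node_0)
  finally have eq: "(\<Sum>i<Suc N. chord g i * (min (grid (Suc i)) t - min (grid i) t))
      = g (node k) + chord g (Suc k) * (t - node k)" by simp
  have tk: "t - node k \<le> ?h" using k1 node_Suc[of k] by simp
  have L0: "0 \<le> L" using L[of t] t by (auto intro: order.trans[OF abs_ge_zero])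
  have "\<bar>g (node (Suc k)) - g (node k)\<bar> \<le> L * (node (Suc k) - node k)"
    using node_ge node_le[of "Suc k"] k2 node_mono[of k "Suc k"] by (intro lipschitz_increment L) auto
  moreover have "0 < node (Suc k) - node k"
    using node_Suc[of k] node_step_pos by linarith
  ultimately have c: "\<bar>chord g (Suc k)\<bar> \<le> L"
    by (simp add: chord_def pos_divide_le_eq)
  have "\<bar>g t - g (node k)\<bar> \<le> L * (t - node k)"
    using node_ge t k3 by (intro lipschitz_increment L) auto
  also have "\<dots> \<le> L * ?h" using tk L0 by (intro mult_left_mono)
  finally have 1: "\<bar>g t - g (node k)\<bar> \<le> L * ?h" .
  have "\<bar>chord g (Suc k) * (t - node k)\<bar> \<le> L * ?h"
    unfolding abs_mult using c tk k3 L0 by (intro mult_mono) auto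
  with 1 show ?thesis unfolding eq by linarith
qed

end

end

section \<open>Stieltjes sums and Gaussian weighted integrals\<close>

lemma sum_by_parts:
  fixes a b :: "nat \<Rightarrow> real"
  shows "(\<Sum>i<N. a (Suc i) * (b (Suc i) - b i)) = a N * b N - a 0 * b 0 - (\<Sum>i<N. (a (Suc i) - a i) * b i)"
  by (induction N) (auto simp: algebra_simps)

lemma integral_nodes:
  fixes f :: "real \<Rightarrow> real"
  assumes \<tau>: "0 < \<tau>" "\<tau> < 1" and N: "0 < N" and f: "continuous_on {\<tau>..1} f" and k: "k \<le> N"
  shows "(\<Sum>i<k. integral {node \<tau> N i..node \<tau> N (Suc i)} f) = integral {\<tau>..node \<tau> N k} f"
  using k
proof (induction k)
  case 0
  then show ?case using node_0[OF \<tau> N] by simp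
next
  case (Suc k)
  have "integral {\<tau>..node \<tau> N k} f + integral {node \<tau> N k..node \<tau> N (Suc k)} f = integral {\<tau>..node \<tau> N (Suc k)} f"
    using node_ge[OF \<tau> N] node_mono[OF \<tau> N, of k "Suc k"] node_le[OF \<tau> N Suc.prems] f
    by (intro Henstock_Kurzweil_Integration.integral_combine integrable_continuous_real)
      (auto intro: continuous_on_subset)
  then show ?case using Suc by simp
qed

text \<open>Uniform continuity of \<open>f\<close> bounds the error on a cell by \<open>e\<close>
  times the increment of \<open>G\<close>. These increments are nonnegative and add up to a total
  that does not depend on the mesh.\<close>

lemma stieltjes_sums_tendsto:
  fixes f G G' :: "real \<Rightarrow> real"
  assumes \<tau>: "0 < \<tau>" "\<tau> < 1"
    and G: "\<And>t. t \<in> {\<tau>..1} \<Longrightarrow> (G has_real_derivative G' t) (at t within {\<tau>..1})"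
    and G'_nonneg: "\<And>t. t \<in> {\<tau>..1} \<Longrightarrow> 0 \<le> G' t"
    and G'_cont: "continuous_on {\<tau>..1} G'" and f: "continuous_on {\<tau>..1} f"
  shows "(\<lambda>N. \<Sum>i<Suc N. (G (node \<tau> (Suc N) (Suc i)) - G (node \<tau> (Suc N) i)) * f (node \<tau> (Suc N) i))
    \<longlonglongrightarrow> integral {\<tau>..1} (\<lambda>t. G' t * f t)"
proof (rule LIMSEQ_I)
  fix r :: real assume r: "0 < r"
  \<comment> \<open>The summand 1 avoids a division by zero when \<open>G\<close> is constant, and
    half of \<open>r\<close> leaves a strict inequality at the end.\<close>
  define e where "e = r / (2 * (1 + (G 1 - G \<tau>)))"
  have G_incr: "0 \<le> G 1 - G \<tau>"
    using has_integral_nonneg[OF has_integral_increment[OF G, where a = \<tau> and b = 1]] \<tau> G'_nonneg by auto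
  have e: "0 < e" using r G_incr by (simp add: e_def)
  have "uniformly_continuous_on {\<tau>..1} f"
    by (rule compact_uniformly_continuous[OF f]) simp
  then obtain d where d: "0 < d"
    and dist: "\<And>x y. x \<in> {\<tau>..1} \<Longrightarrow> y \<in> {\<tau>..1} \<Longrightarrow> dist x y < d \<Longrightarrow> dist (f x) (f y) < e"
    using e unfolding uniformly_continuous_on_def by metis
  obtain N0 where N0: "(1 - \<tau>) / d < real N0" using reals_Archimedean2 by blast
  have "norm ((\<Sum>i<Suc N. (G (node \<tau> (Suc N) (Suc i)) - G (node \<tau> (Suc N) i)) * f (node \<tau> (Suc N) i))
      - integral {\<tau>..1} (\<lambda>t. G' t * f t)) < r" if N: "N0 \<le> N" for N
  proof -
    let ?u = "node \<tau> (Suc N)"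
    note u = node_ge[OF \<tau>, of "Suc N"] node_le[OF \<tau>, of "Suc N"] node_mono[OF \<tau>, of "Suc N"]
      node_0[OF \<tau>, of "Suc N"] node_N[OF \<tau>, of "Suc N"]
    have step: "?u (Suc i) - ?u i < d" for i
    proof -
      have "(1 - \<tau>) / d < real (Suc N)" using N0 N by linarith
      then have "(1 - \<tau>) / real (Suc N) < d" using d by (simp add: divide_less_eq mult.commute)
      then show ?thesis using node_Suc[OF \<tau>, of "Suc N" i] by simp
    qed
    have cell: "\<bar>(G (?u (Suc i)) - G (?u i)) * f (?u i) - integral {?u i..?u (Suc i)} (\<lambda>t. G' t * f t)\<bar>
        \<le> e * (G (?u (Suc i)) - G (?u i))" if i: "i < Suc N" for i
    proof -
      have ui: "\<tau> \<le> ?u i" "?u i \<le> ?u (Suc i)" "?u (Suc i) \<le> 1" using u i by auto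
      have iG: "(G' has_integral G (?u (Suc i)) - G (?u i)) {?u i..?u (Suc i)}"
        using ui by (intro has_integral_increment[OF G]) auto
      have sub: "{?u i..?u (Suc i)} \<subseteq> {\<tau>..1}" using ui by auto
      have "((\<lambda>t. G' t * f t) has_integral integral {?u i..?u (Suc i)} (\<lambda>t. G' t * f t)) {?u i..?u (Suc i)}"
        by (intro integrable_integral integrable_continuous_real continuous_intros
            continuous_on_subset[OF G'_cont sub] continuous_on_subset[OF f sub])
      from has_integral_diff[OF has_integral_mult_left[OF iG, of "f (?u i)"] this]
      have D: "((\<lambda>t. G' t * f (?u i) - G' t * f t) has_integral
          (G (?u (Suc i)) - G (?u i)) * f (?u i) - integral {?u i..?u (Suc i)} (\<lambda>t. G' t * f t)) {?u i..?u (Suc i)}" .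
      have b: "\<bar>G' t * f (?u i) - G' t * f t\<bar> \<le> e * G' t" if t: "t \<in> {?u i..?u (Suc i)}" for t
      proof -
        have "dist (?u i) t < d" using t step[of i] by (auto simp: dist_real_def)
        then have "\<bar>f (?u i) - f t\<bar> \<le> e"
          using dist[of "?u i" t] t ui by (auto simp: dist_real_def)
        moreover have "0 \<le> G' t" using t ui by (intro G'_nonneg) auto
        ultimately show ?thesis
          by (simp add: abs_mult mult_left_mono mult.commute[of e] flip: right_diff_distrib)
      qed
      have iE: "((\<lambda>t. e * G' t) has_integral e * (G (?u (Suc i)) - G (?u i))) {?u i..?u (Suc i)}"
        by (rule has_integral_mult_right[OF iG])
      have "(G (?u (Suc i)) - G (?u i)) * f (?u i) - integral {?u i..?u (Suc i)} (\<lambda>t. G' t * f t)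
          \<le> e * (G (?u (Suc i)) - G (?u i))"
        by (rule has_integral_le[OF D iE]) (use b in \<open>auto simp: abs_le_iff\<close>)
      moreover have "- (e * (G (?u (Suc i)) - G (?u i)))
          \<le> (G (?u (Suc i)) - G (?u i)) * f (?u i) - integral {?u i..?u (Suc i)} (\<lambda>t. G' t * f t)"
      proof (rule has_integral_le[OF has_integral_neg[OF iE] D])
        fix t assume "t \<in> {?u i..?u (Suc i)}"
        from b[OF this] show "- (e * G' t) \<le> G' t * f (?u i) - G' t * f t" by linarith
      qed
      ultimately show ?thesis by linarith
    qed
    have "integral {\<tau>..1} (\<lambda>t. G' t * f t) = (\<Sum>i<Suc N. integral {?u i..?u (Suc i)} (\<lambda>t. G' t * f t))"
      using integral_nodes[OF \<tau>, of "Suc N" "\<lambda>t. G' t * f t" "Suc N"] u(5) G'_cont f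
      by (simp add: continuous_intros)
    then have "\<bar>(\<Sum>i<Suc N. (G (?u (Suc i)) - G (?u i)) * f (?u i)) - integral {\<tau>..1} (\<lambda>t. G' t * f t)\<bar>
        = \<bar>\<Sum>i<Suc N. (G (?u (Suc i)) - G (?u i)) * f (?u i) - integral {?u i..?u (Suc i)} (\<lambda>t. G' t * f t)\<bar>"
      by (simp only: sum_subtractf)
    also have "\<dots> \<le> (\<Sum>i<Suc N. e * (G (?u (Suc i)) - G (?u i)))"
      by (rule order.trans[OF sum_abs sum_mono]) (use cell in auto)
    also have "\<dots> = e * (G 1 - G \<tau>)"
      unfolding sum_distrib_left[symmetric] sum_lessThan_telescope[of "\<lambda>i. G (?u i)"] using u(4,5) by simp
    also have "\<dots> \<le> e * (1 + (G 1 - G \<tau>))" using e by (intro mult_left_mono) auto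
    also have "\<dots> = r / 2"
    proof -
      have "r / (2 * x) * x = r / 2" if "x \<noteq> 0" for x using that by simp
      from this[of "1 + (G 1 - G \<tau>)"] show ?thesis unfolding e_def using G_incr by linarith
    qed
    also have "\<dots> < r" using r by simp
    finally show ?thesis by simp
  qed
  then show "\<exists>N0. \<forall>N\<ge>N0. norm ((\<Sum>i<Suc N. (G (node \<tau> (Suc N) (Suc i)) - G (node \<tau> (Suc N) i)) * f (node \<tau> (Suc N) i))
      - integral {\<tau>..1} (\<lambda>t. G' t * f t)) < r" by blast
qed

context brownian
begin

text \<open>Since \<open>G 1 = 0\<close>, integration by parts turns minus the weighted integral
  into the Wiener integral of the function equal to \<open>G \<tau>\<close> before \<tau> and to
  \<open>G\<close> afterwards, whose variance is the one shown. The parts are taken on the grid, and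
  Fatou then needs only an upper bound for the discrete variances.\<close>

lemma exp_weighted_integral_le:
  fixes G G' E :: "real \<Rightarrow> real"
  assumes \<tau>: "0 < \<tau>" "\<tau> < 1"
    and G: "\<And>t. t \<in> {\<tau>..1} \<Longrightarrow> (G has_real_derivative G' t) (at t within {\<tau>..1})"
    and G'_nonneg: "\<And>t. t \<in> {\<tau>..1} \<Longrightarrow> 0 \<le> G' t" and G'_cont: "continuous_on {\<tau>..1} G'"
    and G_1: "G 1 = 0"
    and E: "\<And>t. t \<in> {\<tau>..1} \<Longrightarrow> (E has_real_derivative (G t)\<^sup>2) (at t within {\<tau>..1})"
  shows "(\<integral>\<^sup>+\<omega>. ennreal (exp (- \<theta> * integral {\<tau>..1} (\<lambda>t. G' t * B t \<omega>))) \<partial>M)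
    \<le> ennreal (exp (\<theta>\<^sup>2 * ((G \<tau>)\<^sup>2 * \<tau> + (E 1 - E \<tau>)) / 2))"
proof -
  \<comment> \<open>Right end values are used: \<open>G\<close> increases to 0, so its square is
    smallest there and the discrete variance stays below that of the limit.\<close>
  define d where "d N i = (case i of 0 \<Rightarrow> G \<tau> | Suc j \<Rightarrow> G (node \<tau> (Suc N) (Suc j)))" for N i
  define L where "L N = tilt (grid \<tau> (Suc N)) (d N) (Suc (Suc N))" for N
  have m: "mono (grid \<tau> (Suc N))" "grid \<tau> (Suc N) 0 = 0" for N
    using \<tau> by (auto intro!: grid_mono grid_simps)
  have L_eq: "L N \<omega> = - (\<Sum>i<Suc N. (G (node \<tau> (Suc N) (Suc i)) - G (node \<tau> (Suc N) i)) * B (node \<tau> (Suc N) i) \<omega>)"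
    if "\<omega> \<in> space M" for N \<omega>
  proof -
    have "L N \<omega> = G \<tau> * (B \<tau> \<omega> - B 0 \<omega>)
        + (\<Sum>i<Suc N. G (node \<tau> (Suc N) (Suc i)) * (B (node \<tau> (Suc N) (Suc i)) \<omega> - B (node \<tau> (Suc N) i) \<omega>))"
      unfolding L_def tilt_def[OF m]
      by (subst sum.lessThan_Suc_shift) (simp add: grid_simps[OF \<tau>] node_0[OF \<tau>] d_def del: sum.lessThan_Suc)
    also have "\<dots> = - (\<Sum>i<Suc N. (G (node \<tau> (Suc N) (Suc i)) - G (node \<tau> (Suc N) i)) * B (node \<tau> (Suc N) i) \<omega>)"
      using sum_by_parts[of "\<lambda>i. G (node \<tau> (Suc N) i)" "\<lambda>i. B (node \<tau> (Suc N) i) \<omega>" "Suc N"]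
        node_0[OF \<tau>, of "Suc N"] node_N[OF \<tau>, of "Suc N"] B_zero[OF that] G_1 by (simp del: sum.lessThan_Suc)
    finally show ?thesis .
  qed
  have var: "tilt_var (grid \<tau> (Suc N)) (d N) (Suc (Suc N)) \<le> (G \<tau>)\<^sup>2 * \<tau> + (E 1 - E \<tau>)" for N
  proof -
    let ?u = "node \<tau> (Suc N)"
    have "tilt_var (grid \<tau> (Suc N)) (d N) (Suc (Suc N))
        = (G \<tau>)\<^sup>2 * \<tau> + (\<Sum>i<Suc N. (G (?u (Suc i)))\<^sup>2 * (?u (Suc i) - ?u i))"
      unfolding tilt_var_def[OF m]
      by (subst sum.lessThan_Suc_shift) (simp add: grid_simps[OF \<tau>] node_0[OF \<tau>] d_def del: sum.lessThan_Suc)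
    also have "(\<Sum>i<Suc N. (G (?u (Suc i)))\<^sup>2 * (?u (Suc i) - ?u i)) \<le> (\<Sum>i<Suc N. E (?u (Suc i)) - E (?u i))"
    proof (intro sum_mono)
      fix i assume "i \<in> {..<Suc N}"
      then have ui: "\<tau> \<le> ?u i" "?u i \<le> ?u (Suc i)" "?u (Suc i) \<le> 1"
        using node_ge[OF \<tau>, of "Suc N"] node_le[OF \<tau>, of "Suc N"] node_mono[OF \<tau>, of "Suc N"] by auto
      have G_mono: "G x \<le> G y" if "\<tau> \<le> x" "x \<le> y" "y \<le> 1" for x y
        using has_integral_nonneg[OF has_integral_increment[OF G that]] that G'_nonneg by auto
      have "((\<lambda>t. (G (?u (Suc i)))\<^sup>2) has_integral (?u (Suc i) - ?u i) *\<^sub>R (G (?u (Suc i)))\<^sup>2) {?u i..?u (Suc i)}"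
        using has_integral_const_real[of "(G (?u (Suc i)))\<^sup>2" "?u i" "?u (Suc i)"] ui by simp
      from this has_integral_increment[OF E ui]
      have "(?u (Suc i) - ?u i) *\<^sub>R (G (?u (Suc i)))\<^sup>2 \<le> E (?u (Suc i)) - E (?u i)"
      proof (rule has_integral_le)
        fix t assume "t \<in> {?u i..?u (Suc i)}"
        then have "G t \<le> G (?u (Suc i))" "G (?u (Suc i)) \<le> G 1"
          using ui by (auto intro: G_mono)
        then show "(G (?u (Suc i)))\<^sup>2 \<le> (G t)\<^sup>2"
          using G_1 by (simp add: abs_le_square_iff[symmetric])
      qed
      then show "(G (?u (Suc i)))\<^sup>2 * (?u (Suc i) - ?u i) \<le> E (?u (Suc i)) - E (?u i)"
        by (simp add: mult.commute)
    qed
    also have "\<dots> = E 1 - E \<tau>"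
      unfolding sum_lessThan_telescope[of "\<lambda>i. E (?u i)"] using node_0[OF \<tau>, of "Suc N"] node_N[OF \<tau>, of "Suc N"] by simp
    finally show ?thesis by simp
  qed
  have lim: "(\<lambda>N. L N \<omega>) \<longlonglongrightarrow> - integral {\<tau>..1} (\<lambda>t. G' t * B t \<omega>)" if "\<omega> \<in> space M" for \<omega>
    unfolding L_eq[OF that]
    by (intro tendsto_minus stieltjes_sums_tendsto \<tau> G G'_nonneg G'_cont continuous_on_B that) (use \<tau> in auto)
  have L_exp: "(\<integral>\<^sup>+\<omega>. ennreal (exp (\<theta> * L N \<omega>)) \<partial>M) \<le> ennreal (exp (\<theta>\<^sup>2 * ((G \<tau>)\<^sup>2 * \<tau> + (E 1 - E \<tau>)) / 2))" for N
  proof -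
    have "(\<integral>\<^sup>+\<omega>. ennreal (exp (\<theta> * L N \<omega>)) \<partial>M)
        = ennreal (exp (\<theta>\<^sup>2 * tilt_var (grid \<tau> (Suc N)) (d N) (Suc (Suc N)) / 2))"
      using nn_integral_tilt[OF m[of N], of 0 \<theta> "d N" "Suc (Suc N)" 0] by (simp add: L_def)
    also have "\<dots> \<le> ennreal (exp (\<theta>\<^sup>2 * ((G \<tau>)\<^sup>2 * \<tau> + (E 1 - E \<tau>)) / 2))"
      using var[of N] by (intro ennreal_leI) (simp add: mult_left_mono divide_right_mono)
    finally show ?thesis .
  qed
  have L_meas [measurable]: "L N \<in> borel_measurable M" for N
    unfolding L_def by (rule tilt_measurable[OF m])
  have "(\<integral>\<^sup>+\<omega>. ennreal (exp (- \<theta> * integral {\<tau>..1} (\<lambda>t. G' t * B t \<omega>))) \<partial>M)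
      = (\<integral>\<^sup>+\<omega>. liminf (\<lambda>N. ennreal (exp (\<theta> * L N \<omega>))) \<partial>M)"
  proof (intro nn_integral_cong)
    fix \<omega> assume "\<omega> \<in> space M"
    from lim[OF this] have "(\<lambda>N. ennreal (exp (\<theta> * L N \<omega>))) \<longlonglongrightarrow> ennreal (exp (\<theta> * - integral {\<tau>..1} (\<lambda>t. G' t * B t \<omega>)))"
      by (intro tendsto_intros)
    from lim_imp_Liminf[OF _ this]
    show "ennreal (exp (- \<theta> * integral {\<tau>..1} (\<lambda>t. G' t * B t \<omega>))) = liminf (\<lambda>N. ennreal (exp (\<theta> * L N \<omega>)))"
      by simp
  qed
  \<comment> \<open>Fatou's lemma; the bound \<open>L_exp\<close> is uniform in the mesh.\<close>
  also have "\<dots> \<le> liminf (\<lambda>N. \<integral>\<^sup>+\<omega>. ennreal (exp (\<theta> * L N \<omega>)) \<partial>M)"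
    by (intro nn_integral_liminf) measurable
  also have "\<dots> \<le> ennreal (exp (\<theta>\<^sup>2 * ((G \<tau>)\<^sup>2 * \<tau> + (E 1 - E \<tau>)) / 2))"
    by (rule Liminf_le) (use L_exp in \<open>auto intro: always_eventually\<close>)
  finally show ?thesis .
qed

end

section \<open>Upper bounds for the option prices\<close>

text \<open>A crude Stirling bound, obtained from \<open>ln x \<le> x - 1\<close> at
  \<open>n / (n + 1)\<close>. It exceeds \<open>n * ln n - n\<close> only by
  \<open>ln n + 1\<close>, which vanishes after multiplication by T when \<open>n\<close> is of
  order \<open>1 / T\<close>.\<close>

lemma ln_fact_le:
  assumes "1 \<le> n"
  shows "ln (fact n) \<le> (real n + 1) * ln (real n) - real n + 1"
  using assms
proof (induction n rule: dec_induct)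
  case base
  then show ?case by simp
next
  case (step n)
  then have n: "0 < real n" by simp
  have "ln (real n / (real n + 1)) \<le> real n / (real n + 1) - 1"
    using n by (intro ln_le_minus_one) auto
  also have "\<dots> = - 1 / (real n + 1)" using n by (simp add: field_simps)
  finally have "ln (real n) - ln (real n + 1) \<le> - 1 / (real n + 1)"
    using n by (simp add: ln_div)
  then have "(real n + 1) * (ln (real n) - ln (real n + 1)) \<le> (real n + 1) * (- 1 / (real n + 1))"
    using n by (intro mult_left_mono) auto
  then have "(real n + 1) * ln (real n) + 1 \<le> (real n + 1) * ln (real n + 1)"
    using n by (simp add: right_diff_distrib)
  moreover have "ln (fact (Suc n)) = ln (real n + 1) + ln (fact n :: real)"
    using n by (simp add: ln_mult add.commute)
  ultimately show ?case
    using step.IH by (simp add: algebra_simps)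
qed

definition log_mass :: "real \<Rightarrow> real" where
  "log_mass \<rho> = (\<rho> + 1) * ln (\<rho> + 1) - (\<rho> - 1) * ln (\<rho> - 1) - 2"

text \<open>\<^term>\<open>log_mass \<rho>\<close> is the integral of \<open>ln (\<rho>\<^sup>2 - x\<^sup>2)\<close> over the unit interval.\<close>

lemma log_mass_le_sum:
  fixes n :: nat
  assumes \<rho>: "1 < \<rho>" and n: "1 \<le> n"
  shows "real n * log_mass \<rho> + ln (\<rho>\<^sup>2 - 1) - ln (\<rho>\<^sup>2) \<le> (\<Sum>k=1..n. ln (\<rho>\<^sup>2 - (real k / real n)\<^sup>2))"
proof -
  \<comment> \<open>\<open>F\<close> is a primitive of the decreasing function \<open>f\<close> on
    the unit interval. Left Riemann sums therefore dominate the integral, and passing to right sums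
    changes the unnormalised sum by \<open>f 1 - f 0\<close>, the two extra logarithms of the
    claim.\<close>
  define F where "F x = (\<rho> + x) * ln (\<rho> + x) - (\<rho> - x) * ln (\<rho> - x) - 2 * x" for x
  define f where "f x = ln (\<rho>\<^sup>2 - x\<^sup>2)" for x
  have fac: "\<rho>\<^sup>2 - x\<^sup>2 = (\<rho> + x) * (\<rho> - x)" for x by (simp add: power2_eq_square algebra_simps)
  have deriv: "(F has_real_derivative f x) (at x)" if "0 \<le> x" "x \<le> 1" for x
    unfolding F_def f_def fac using that \<rho>
    by (auto intro!: derivative_eq_intros simp: ln_mult)
  have f_anti: "f y \<le> f x" if "0 \<le> x" "x \<le> y" "y \<le> 1" for x y
  proof -
    have "x\<^sup>2 \<le> y\<^sup>2" "y\<^sup>2 \<le> 1" "1 < \<rho>\<^sup>2" using that \<rho> by (auto simp: power_mono power_le_one)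
    then show ?thesis by (simp add: f_def)
  qed
  have cell: "F (real (Suc k) / real n) - F (real k / real n) \<le> f (real k / real n) / real n" if "k < n" for k
  proof -
    have ab: "0 \<le> real k / real n" "real k / real n < real (Suc k) / real n" "real (Suc k) / real n \<le> 1"
      using that n by (auto simp: divide_simps)
    obtain z where z: "real k / real n < z" "z < real (Suc k) / real n"
      "F (real (Suc k) / real n) - F (real k / real n) = (real (Suc k) / real n - real k / real n) * f z"
      using MVT2[OF ab(2), of F f] deriv ab by (smt (verit, best))
    have "real (Suc k) / real n - real k / real n = 1 / real n" by (simp add: diff_divide_distrib[symmetric])
    moreover have "f z \<le> f (real k / real n)" using z ab by (intro f_anti) auto
    ultimately show ?thesis using z(3) by (simp add: divide_right_mono)
  qed
  have "F 1 - F 0 = (\<Sum>k<n. F (real (Suc k) / real n) - F (real k / real n))"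
    using sum_lessThan_telescope[of "\<lambda>k. F (real k / real n)" n] n by simp
  also have "\<dots> \<le> (\<Sum>k<n. f (real k / real n) / real n)"
    by (intro sum_mono cell) auto
  also have "\<dots> = (\<Sum>k<n. f (real k / real n)) / real n"
    by (simp add: sum_divide_distrib)
  finally have "real n * (F 1 - F 0) \<le> (\<Sum>k<n. f (real k / real n))"
    using n by (simp add: le_divide_eq mult.commute)
  moreover have "F 1 - F 0 = log_mass \<rho>" by (simp add: F_def log_mass_def)
  moreover have "(\<Sum>k=1..n. f (real k / real n)) = (\<Sum>k<n. f (real (Suc k) / real n))"
    by (intro sum.reindex_bij_witness[of _ Suc "\<lambda>k. k - 1"]) auto
  moreover have "(\<Sum>k<n. f (real (Suc k) / real n)) - (\<Sum>k<n. f (real k / real n)) = f 1 - f 0"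
    using sum_lessThan_telescope[of "\<lambda>k. f (real k / real n)" n] n by (simp add: sum_subtractf)
  ultimately show ?thesis by (simp add: f_def)
qed

context brownian
begin

definition exp_avg :: "real \<Rightarrow> real \<Rightarrow> real \<Rightarrow> 'a \<Rightarrow> real" where
  "exp_avg \<tau> m s \<omega> = integral {\<tau>..1} (\<lambda>u. exp (m * u + s * B u \<omega>))"

lemma exp_avg_measurable [measurable]: "0 \<le> \<tau> \<Longrightarrow> exp_avg \<tau> m s \<in> borel_measurable M"
  unfolding exp_avg_def[abs_def] by (rule integral_exp_B_measurable)

lemma exp_avg_nonneg:
  assumes "\<omega> \<in> space M" "0 \<le> \<tau>"
  shows "0 \<le> exp_avg \<tau> m s \<omega>"
  unfolding exp_avg_def
  by (intro Henstock_Kurzweil_Integration.integral_nonneg integrable_continuous_real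
      continuous_intros continuous_on_B assms) simp

text \<open>Times are at most 1, so the drift can be removed at the price of a constant. In the n-th
  moment this costs \<open>exp (real n * \<bar>m\<bar>)\<close>, which stays bounded for
  \<open>m\<close> of order \<open>T\<close> and \<open>n\<close> of order
  \<open>1 / T\<close>.\<close>

lemma exp_avg_drift_le:
  assumes "\<omega> \<in> space M" "0 \<le> \<tau>"
  shows "exp_avg \<tau> m s \<omega> \<le> exp \<bar>m\<bar> * exp_avg \<tau> 0 s \<omega>"
proof -
  have "exp_avg \<tau> m s \<omega> \<le> integral {\<tau>..1} (\<lambda>u. exp \<bar>m\<bar> * exp (0 * u + s * B u \<omega>))"
    unfolding exp_avg_def
  proof (intro integral_le integrable_continuous_real continuous_intros continuous_on_B assms)
    fix u assume u: "u \<in> {\<tau>..1}"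
    then have "\<bar>u\<bar> \<le> 1" using assms by auto
    then have "\<bar>m * u\<bar> \<le> \<bar>m\<bar>" unfolding abs_mult by (simp add: mult_left_le)
    then have "m * u \<le> \<bar>m\<bar>" by linarith
    then show "exp (m * u + s * B u \<omega>) \<le> exp \<bar>m\<bar> * exp (0 * u + s * B u \<omega>)"
      by (simp flip: exp_add)
  qed
  then show ?thesis by (simp add: exp_avg_def)
qed

text \<open>The positive part of \<open>X - K\<close> is at most \<open>K * (X / K) ^ n\<close>, so
  the price is controlled by \<open>moment_bound\<close>, started at \<tau> with no extracted time
  points. \<open>x\<close> is the logarithm of the result once the factorial and the product have
  been estimated.\<close>

lemma call_moment_bound:
  fixes n :: nat and m :: real
  assumes \<tau>: "0 < \<tau>" "\<tau> < 1" and s: "0 < s" and n: "1 \<le> n" and \<rho>: "1 < \<rho>" and c: "0 < c" and K: "0 < K"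
  defines "x \<equiv> (1 - real n) * ln K + real n * ln c + real n * \<bar>m\<bar> + ((real n + 1) * ln (real n) - real n + 1)
      - real n * ln ((real n * s)\<^sup>2 / 2) - (real n * log_mass \<rho> + ln (\<rho>\<^sup>2 - 1) - ln (\<rho>\<^sup>2))
      + (real n * s * \<rho>)\<^sup>2 * (1 - \<tau>) / 2 + (real n * s)\<^sup>2 * \<tau> / 2"
  shows "integrable M (\<lambda>\<omega>. max 0 (c * exp_avg \<tau> m s \<omega> - K))"
    and "expectation (\<lambda>\<omega>. max 0 (c * exp_avg \<tau> m s \<omega> - K)) \<le> exp x"
proof -
  \<comment> \<open>Writing \<open>lam\<close> through \<open>\<rho>\<close> makes each factor of
    the product \<open>(real n * s)\<^sup>2 / 2\<close> times
    \<open>\<rho>\<^sup>2 - (real k / real n)\<^sup>2\<close>, so its logarithm becomes a Riemann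
    sum; \<open>\<rho> > 1\<close> is what \<open>moment_bound\<close> demands of
    \<open>lam\<close>.\<close>
  define lam where "lam = (real n * s * \<rho>)\<^sup>2 / 2"
  have lam_diff: "lam - (real k * s)\<^sup>2 / 2 = (real n * s)\<^sup>2 / 2 * (\<rho>\<^sup>2 - (real k / real n)\<^sup>2)" for k
    using n by (simp add: lam_def power_mult_distrib power_divide right_diff_distrib)
  have pos: "0 < \<rho>\<^sup>2 - (real k / real n)\<^sup>2" if "k \<le> n" for k
  proof -
    have "(real k / real n)\<^sup>2 \<le> 1" using that n by (intro power_le_one) auto
    moreover have "1 < \<rho>\<^sup>2" using \<rho> by simp
    ultimately show ?thesis by linarith
  qed
  have lam_pos: "0 < lam - (real k * s)\<^sup>2 / 2" if "k \<le> n" for k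
    unfolding lam_diff using pos[OF that] n s by simp
  have "(\<integral>\<^sup>+\<omega>. ennreal (exp_avg \<tau> 0 s \<omega> ^ n) \<partial>M)
      \<le> ennreal (fact n * (\<Prod>k=1..n. 1 / (lam - (real k * s)\<^sup>2 / 2)) * exp (lam * (1 - \<tau>)) * exp ((real n * s)\<^sup>2 * \<tau> / 2))"
    using moment_bound[of \<tau> n s lam "{}"] \<tau> lam_pos by (simp add: exp_avg_def)
  also have "fact n * (\<Prod>k=1..n. 1 / (lam - (real k * s)\<^sup>2 / 2)) * exp (lam * (1 - \<tau>)) * exp ((real n * s)\<^sup>2 * \<tau> / 2)
      = exp (ln (fact n) - (\<Sum>k=1..n. ln (lam - (real k * s)\<^sup>2 / 2)) + lam * (1 - \<tau>) + (real n * s)\<^sup>2 * \<tau> / 2)"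
  proof -
    have "(\<Prod>k=1..n. 1 / (lam - (real k * s)\<^sup>2 / 2)) = (\<Prod>k=1..n. exp (- ln (lam - (real k * s)\<^sup>2 / 2)))"
      using lam_pos by (intro prod.cong) (auto simp: exp_minus inverse_eq_divide)
    also have "\<dots> = exp (- (\<Sum>k=1..n. ln (lam - (real k * s)\<^sup>2 / 2)))"
      by (simp only: sum_negf[symmetric] exp_sum finite_atLeastAtMost)
    finally have P: "(\<Prod>k=1..n. 1 / (lam - (real k * s)\<^sup>2 / 2)) = exp (- (\<Sum>k=1..n. ln (lam - (real k * s)\<^sup>2 / 2)))" .
    have "fact n * exp (- S) * exp a * exp b = exp (ln (fact n) - S + a + b)" for S a b :: real
      by (simp add: exp_add exp_diff exp_minus divide_inverse)
    then show ?thesis unfolding P .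
  qed
  also have "\<dots> \<le> exp (((real n + 1) * ln (real n) - real n + 1)
      - (real n * ln ((real n * s)\<^sup>2 / 2) + (real n * log_mass \<rho> + ln (\<rho>\<^sup>2 - 1) - ln (\<rho>\<^sup>2)))
      + lam * (1 - \<tau>) + (real n * s)\<^sup>2 * \<tau> / 2)"
  proof -
    have "(\<Sum>k=1..n. ln (lam - (real k * s)\<^sup>2 / 2)) = (\<Sum>k=1..n. ln ((real n * s)\<^sup>2 / 2) + ln (\<rho>\<^sup>2 - (real k / real n)\<^sup>2))"
    proof (intro sum.cong refl)
      fix k assume "k \<in> {1..n}"
      then have "0 < \<rho>\<^sup>2 - (real k / real n)\<^sup>2" by (intro pos) simp
      moreover have "0 < (real n * s)\<^sup>2 / 2" using n s by simp
      ultimately show "ln (lam - (real k * s)\<^sup>2 / 2) = ln ((real n * s)\<^sup>2 / 2) + ln (\<rho>\<^sup>2 - (real k / real n)\<^sup>2)"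
        unfolding lam_diff by (subst ln_mult_pos) simp_all
    qed
    also have "\<dots> = real n * ln ((real n * s)\<^sup>2 / 2) + (\<Sum>k=1..n. ln (\<rho>\<^sup>2 - (real k / real n)\<^sup>2))"
      by (simp add: sum.distrib)
    finally show ?thesis
      using ln_fact_le[OF n] log_mass_le_sum[OF \<rho> n] by simp
  qed
  finally have X0: "(\<integral>\<^sup>+\<omega>. ennreal (exp_avg \<tau> 0 s \<omega> ^ n) \<partial>M) \<le> ennreal (exp (((real n + 1) * ln (real n) - real n + 1)
      - (real n * ln ((real n * s)\<^sup>2 / 2) + (real n * log_mass \<rho> + ln (\<rho>\<^sup>2 - 1) - ln (\<rho>\<^sup>2)))
      + lam * (1 - \<tau>) + (real n * s)\<^sup>2 * \<tau> / 2))" (is "_ \<le> ennreal (exp ?y)")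
    by (simp add: ennreal_leI)
  define z where "z = (1 - real n) * ln K + real n * ln c + real n * \<bar>m\<bar>"
  have pw: "max 0 (c * exp_avg \<tau> m s \<omega> - K) \<le> exp z * exp_avg \<tau> 0 s \<omega> ^ n" if \<omega>: "\<omega> \<in> space M" for \<omega>
  proof -
    let ?X = "c * (exp \<bar>m\<bar> * exp_avg \<tau> 0 s \<omega>)"
    have X: "0 \<le> ?X" using exp_avg_nonneg[OF \<omega>, of \<tau> 0 s] \<tau> c by simp
    have "c * exp_avg \<tau> m s \<omega> \<le> ?X"
      using exp_avg_drift_le[OF \<omega>, of \<tau> m s] \<tau> c by (intro mult_left_mono) auto
    then have "max 0 (c * exp_avg \<tau> m s \<omega> - K) \<le> max 0 (?X - K)" by simp
    also have "\<dots> \<le> K * (?X / K) ^ n"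
    proof (cases "?X \<le> K")
      case True
      then show ?thesis using X K by simp
    next
      case False
      then have "1 \<le> ?X / K" using K by simp
      from power_increasing[OF n this] have "?X / K \<le> (?X / K) ^ n" by simp
      from mult_left_mono[OF this, of K] have "?X \<le> K * (?X / K) ^ n" using K by simp
      then show ?thesis using False K X by simp
    qed
    also have "\<dots> = exp z * exp_avg \<tau> 0 s \<omega> ^ n"
    proof -
      have "exp z = exp (ln K) / exp (ln K) ^ n * exp (ln c) ^ n * exp \<bar>m\<bar> ^ n"
        unfolding z_def by (simp add: exp_add exp_diff left_diff_distrib exp_of_nat_mult)
      then have "exp z = K / K ^ n * c ^ n * exp \<bar>m\<bar> ^ n" using K c by simp
      then show ?thesis by (simp add: power_divide power_mult_distrib)
    qed
    finally show ?thesis .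
  qed
  have [measurable]: "exp_avg \<tau> m s \<in> borel_measurable M" "exp_avg \<tau> 0 s \<in> borel_measurable M"
    using \<tau> by (auto intro!: exp_avg_measurable)
  have "(\<integral>\<^sup>+\<omega>. ennreal (max 0 (c * exp_avg \<tau> m s \<omega> - K)) \<partial>M)
      \<le> (\<integral>\<^sup>+\<omega>. ennreal (exp z) * ennreal (exp_avg \<tau> 0 s \<omega> ^ n) \<partial>M)"
  proof (intro nn_integral_mono)
    fix \<omega> assume "\<omega> \<in> space M"
    from ennreal_leI[OF pw[OF this]]
    show "ennreal (max 0 (c * exp_avg \<tau> m s \<omega> - K)) \<le> ennreal (exp z) * ennreal (exp_avg \<tau> 0 s \<omega> ^ n)"
      by (subst ennreal_mult'[symmetric]) simp_all
  qed
  also have "\<dots> = ennreal (exp z) * (\<integral>\<^sup>+\<omega>. ennreal (exp_avg \<tau> 0 s \<omega> ^ n) \<partial>M)"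
    by (rule nn_integral_cmult) measurable
  also have "\<dots> \<le> ennreal (exp z) * ennreal (exp ?y)"
    by (intro mult_left_mono X0) simp
  also have "\<dots> = ennreal (exp (z + ?y))" by (simp add: exp_add ennreal_mult)
  also have "z + ?y = x" by (simp add: x_def z_def lam_def)
  finally have nn: "(\<integral>\<^sup>+\<omega>. ennreal (max 0 (c * exp_avg \<tau> m s \<omega> - K)) \<partial>M) \<le> ennreal (exp x)" .
  show int: "integrable M (\<lambda>\<omega>. max 0 (c * exp_avg \<tau> m s \<omega> - K))"
    by (rule integrableI_nonneg) (use nn in \<open>auto simp: less_top[symmetric] top_unique\<close>)
  from nn show "expectation (\<lambda>\<omega>. max 0 (c * exp_avg \<tau> m s \<omega> - K)) \<le> exp x"
    by (subst (asm) nn_integral_eq_integral[OF int]) auto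
qed

text \<open>By convexity \<open>exp x \<ge> exp g * (1 + x - g)\<close>, so the event is contained in a half-space bounded
  by a Gaussian functional, to which the Chernoff bound applies.\<close>

lemma put_tail_bound:
  fixes g G E :: "real \<Rightarrow> real"
  assumes \<tau>: "0 < \<tau>" "\<tau> < 1" and s: "0 < s" and \<kappa>: "0 < \<kappa>"
    and g: "\<And>t. t \<in> {\<tau>..1} \<Longrightarrow> (g has_real_derivative G t) (at t within {\<tau>..1})"
    and G: "\<And>t. t \<in> {\<tau>..1} \<Longrightarrow> (G has_real_derivative \<kappa> * exp (g t)) (at t within {\<tau>..1})"
    and E: "\<And>t. t \<in> {\<tau>..1} \<Longrightarrow> (E has_real_derivative (G t)\<^sup>2) (at t within {\<tau>..1})"
    and G_1: "G 1 = 0" and g_\<tau>: "g \<tau> = \<tau> * G \<tau>"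
  shows "prob {\<omega> \<in> space M. exp_avg \<tau> m s \<omega> < integral {\<tau>..1} (\<lambda>t. exp (g t))}
    \<le> exp (- (((g \<tau>)\<^sup>2 / \<tau> + (E 1 - E \<tau>)) / 2 - \<bar>m\<bar> * \<bar>G \<tau>\<bar>) / s\<^sup>2)"
proof -
  define J where "J = (g \<tau>)\<^sup>2 / \<tau> + (E 1 - E \<tau>)"
  \<comment> \<open>The condition \<open>g \<tau> = \<tau> * G \<tau>\<close> makes the cost of the
    path equal to the variance in \<open>exp_weighted_integral_le\<close>. This equality is what
    makes the Chernoff bound sharp.\<close>
  have J_alt: "J = (G \<tau>)\<^sup>2 * \<tau> + (E 1 - E \<tau>)"
    using \<tau> by (simp add: J_def g_\<tau> power2_eq_square)
  have g_cont: "continuous_on {\<tau>..1} g"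
    using g by (meson DERIV_continuous continuous_on_eq_continuous_within)
  let ?w = "\<lambda>t. \<kappa> * exp (g t)"
  have w_cont: "continuous_on {\<tau>..1} ?w" by (intro continuous_intros g_cont)
  have w_int: "(?w has_integral - G \<tau>) {\<tau>..1}"
    using has_integral_increment[OF G, of \<tau> 1] \<tau> G_1 by simp
  have G_\<tau>: "0 \<le> - G \<tau>"
    using has_integral_nonneg[OF w_int] \<kappa> by simp
  \<comment> \<open>Integration by parts for \<open>G * g\<close>: the boundary term at 1 vanishes
    and the one at \<tau> supplies the cost of the initial segment.\<close>
  have wg_int: "((\<lambda>t. ?w t * g t) has_integral - J) {\<tau>..1}"
  proof -
    have "((\<lambda>t. ?w t * g t + (G t)\<^sup>2) has_integral G 1 * g 1 - G \<tau> * g \<tau>) {\<tau>..1}"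
    proof (rule has_integral_increment[where l = \<tau> and u = 1])
      show "((\<lambda>t. G t * g t) has_real_derivative ?w t * g t + (G t)\<^sup>2) (at t within {\<tau>..1})"
        if "t \<in> {\<tau>..1}" for t
        using DERIV_mult[OF G[OF that] g[OF that]] by (simp add: power2_eq_square algebra_simps)
    qed (use \<tau> in auto)
    from has_integral_diff[OF this has_integral_increment[OF E, of \<tau> 1]]
    have "((\<lambda>t. ?w t * g t) has_integral G 1 * g 1 - G \<tau> * g \<tau> - (E 1 - E \<tau>)) {\<tau>..1}"
      using \<tau> by simp
    then show ?thesis by (simp add: J_alt G_1 g_\<tau> power2_eq_square algebra_simps)
  qed
  have key: "J - \<bar>m\<bar> * \<bar>G \<tau>\<bar> \<le> - s * integral {\<tau>..1} (\<lambda>t. ?w t * B t \<omega>)"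
    if \<omega>: "\<omega> \<in> space M" and less: "exp_avg \<tau> m s \<omega> < integral {\<tau>..1} (\<lambda>t. exp (g t))" for \<omega>
  proof -
    have B_cont: "continuous_on {\<tau>..1} (\<lambda>t. B t \<omega>)" by (intro continuous_on_B \<omega>) (use \<tau> in auto)
    have wB: "((\<lambda>t. ?w t * B t \<omega>) has_integral integral {\<tau>..1} (\<lambda>t. ?w t * B t \<omega>)) {\<tau>..1}"
      by (intro integrable_integral integrable_continuous_real continuous_intros g_cont B_cont)
    have w0: "((\<lambda>t. exp (g t)) has_integral integral {\<tau>..1} (\<lambda>t. exp (g t))) {\<tau>..1}"
      by (intro integrable_integral integrable_continuous_real continuous_intros g_cont)
    have "((\<lambda>t. exp (m * t + s * B t \<omega>)) has_integral exp_avg \<tau> m s \<omega>) {\<tau>..1}"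
      unfolding exp_avg_def by (intro integrable_integral integrable_continuous_real continuous_intros B_cont)
    from has_integral_mult_right[OF has_integral_diff[OF this w0], of \<kappa>]
    have l: "((\<lambda>t. \<kappa> * (exp (m * t + s * B t \<omega>) - exp (g t))) has_integral
        \<kappa> * (exp_avg \<tau> m s \<omega> - integral {\<tau>..1} (\<lambda>t. exp (g t)))) {\<tau>..1}" .
    have r: "((\<lambda>t. - \<bar>m\<bar> * ?w t + s * (?w t * B t \<omega>) - ?w t * g t) has_integral
        - \<bar>m\<bar> * (- G \<tau>) + s * integral {\<tau>..1} (\<lambda>t. ?w t * B t \<omega>) - - J) {\<tau>..1}"
      by (intro has_integral_add has_integral_diff has_integral_mult_right w_int wB wg_int)
    have "- \<bar>m\<bar> * (- G \<tau>) + s * integral {\<tau>..1} (\<lambda>t. ?w t * B t \<omega>) - - J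
        \<le> \<kappa> * (exp_avg \<tau> m s \<omega> - integral {\<tau>..1} (\<lambda>t. exp (g t)))"
    proof (rule has_integral_le[OF r l])
      fix t assume t: "t \<in> {\<tau>..1}"
      have "\<bar>m * t\<bar> \<le> \<bar>m\<bar>" unfolding abs_mult using t \<tau> by (intro mult_left_le) auto
      then have mt: "- \<bar>m\<bar> \<le> m * t" by linarith
      have "?w t * (- \<bar>m\<bar> + s * B t \<omega> - g t) \<le> ?w t * (exp (m * t + s * B t \<omega> - g t) - 1)"
      proof (intro mult_left_mono)
        show "- \<bar>m\<bar> + s * B t \<omega> - g t \<le> exp (m * t + s * B t \<omega> - g t) - 1"
          using exp_ge_add_one_self[of "m * t + s * B t \<omega> - g t"] mt by linarith
      qed (use \<kappa> in simp)
      also have "\<dots> = \<kappa> * (exp (m * t + s * B t \<omega>) - exp (g t))"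
        by (simp add: exp_diff right_diff_distrib)
      finally show "- \<bar>m\<bar> * ?w t + s * (?w t * B t \<omega>) - ?w t * g t \<le> \<kappa> * (exp (m * t + s * B t \<omega>) - exp (g t))"
        by (simp add: algebra_simps)
    qed
    moreover have "\<kappa> * (exp_avg \<tau> m s \<omega> - integral {\<tau>..1} (\<lambda>t. exp (g t))) \<le> 0"
      using less \<kappa> by (simp add: mult_nonneg_nonpos)
    ultimately show ?thesis using G_\<tau> by simp
  qed
  let ?S = "{\<omega> \<in> space M. exp_avg \<tau> m s \<omega> < integral {\<tau>..1} (\<lambda>t. exp (g t))}"
  let ?L = "\<lambda>\<omega>. integral {\<tau>..1} (\<lambda>t. ?w t * B t \<omega>)"
  have [measurable]: "exp_avg \<tau> m s \<in> borel_measurable M" using \<tau> by (intro exp_avg_measurable) auto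
  have "ennreal (exp ((J - \<bar>m\<bar> * \<bar>G \<tau>\<bar>) / s\<^sup>2)) * emeasure M ?S
      = (\<integral>\<^sup>+\<omega>. ennreal (exp ((J - \<bar>m\<bar> * \<bar>G \<tau>\<bar>) / s\<^sup>2)) * indicator ?S \<omega> \<partial>M)"
    by (simp add: nn_integral_cmult_indicator)
  also have "\<dots> \<le> (\<integral>\<^sup>+\<omega>. ennreal (exp (- (1 / s) * ?L \<omega>)) \<partial>M)"
  proof (intro nn_integral_mono)
    fix \<omega> assume \<omega>: "\<omega> \<in> space M"
    show "ennreal (exp ((J - \<bar>m\<bar> * \<bar>G \<tau>\<bar>) / s\<^sup>2)) * indicator ?S \<omega> \<le> ennreal (exp (- (1 / s) * ?L \<omega>))"
    proof (cases "\<omega> \<in> ?S")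
      case True
      then have "(J - \<bar>m\<bar> * \<bar>G \<tau>\<bar>) / s\<^sup>2 \<le> (- s * ?L \<omega>) / s\<^sup>2"
        using key[OF \<omega>] by (intro divide_right_mono) auto
      also have "\<dots> = - (1 / s) * ?L \<omega>" using s by (simp add: power2_eq_square)
      finally show ?thesis using True by (simp add: ennreal_leI)
    qed simp
  qed
  \<comment> \<open>Up to the drift term, \<open>\<theta> = 1 / s\<close> is the optimal Chernoff
    parameter for a Gaussian of variance \<open>J\<close> exceeding the level \<open>J / s\<close>:
    it sets \<open>J / (2 * s\<^sup>2)\<close> against \<open>J / s\<^sup>2\<close>.\<close>
  also have "\<dots> \<le> ennreal (exp ((1 / s)\<^sup>2 * ((G \<tau>)\<^sup>2 * \<tau> + (E 1 - E \<tau>)) / 2))"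
    by (rule exp_weighted_integral_le[OF \<tau> G]) (use \<kappa> w_cont G_1 E in auto)
  finally have "ennreal (exp ((J - \<bar>m\<bar> * \<bar>G \<tau>\<bar>) / s\<^sup>2) * prob ?S) \<le> ennreal (exp (J / (2 * s\<^sup>2)))"
    unfolding J_alt[symmetric]
    by (simp add: emeasure_eq_measure ennreal_mult power_divide mult.commute[of "s\<^sup>2" 2])
  then have "exp ((J - \<bar>m\<bar> * \<bar>G \<tau>\<bar>) / s\<^sup>2) * prob ?S \<le> exp (J / (2 * s\<^sup>2))"
    by (subst (asm) ennreal_le_iff) auto
  then have "exp (- ((J - \<bar>m\<bar> * \<bar>G \<tau>\<bar>) / s\<^sup>2)) * (exp ((J - \<bar>m\<bar> * \<bar>G \<tau>\<bar>) / s\<^sup>2) * prob ?S)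
      \<le> exp (- ((J - \<bar>m\<bar> * \<bar>G \<tau>\<bar>) / s\<^sup>2)) * exp (J / (2 * s\<^sup>2))"
    by (intro mult_left_mono) auto
  then have "prob ?S \<le> exp (- ((J - \<bar>m\<bar> * \<bar>G \<tau>\<bar>) / s\<^sup>2) + J / (2 * s\<^sup>2))"
    by (simp flip: mult.assoc exp_add)
  also have "- ((J - \<bar>m\<bar> * \<bar>G \<tau>\<bar>) / s\<^sup>2) + J / (2 * s\<^sup>2) = - (J / 2 - \<bar>m\<bar> * \<bar>G \<tau>\<bar>) / s\<^sup>2"
    using s by (simp add: field_simps)
  finally show ?thesis unfolding J_def .
qed

end

section \<open>Logarithmic asymptotics in small time\<close>

text \<open>Multiplication by T removes the constant \<open>c\<close> and reduces the exponents to
  their rates. The lower bound also supplies \<open>V T > 0\<close>, so that comparing logarithms is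
  legitimate.\<close>

lemma log_sandwich:
  fixes V U :: "real \<Rightarrow> real"
  assumes lower: "\<And>\<epsilon>. 0 < \<epsilon> \<Longrightarrow> \<exists>c>0. \<forall>\<^sub>F T in at_right 0. c * exp (- (a + \<epsilon>) / T) \<le> V T"
    and upper: "\<forall>\<^sub>F T in at_right 0. V T \<le> exp (U T / T)"
    and U: "(U \<longlongrightarrow> - a) (at_right 0)"
  shows "((\<lambda>T. T * ln (V T)) \<longlongrightarrow> - a) (at_right 0)"
proof -
  have pos: "\<forall>\<^sub>F T in at_right (0::real). 0 < T" by (simp add: eventually_at_right_less)
  have *: "\<forall>\<^sub>F T in at_right 0. - a - \<epsilon> < T * ln (V T)" "\<forall>\<^sub>F T in at_right 0. T * ln (V T) < - a + \<epsilon>"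
    if \<epsilon>: "0 < \<epsilon>" for \<epsilon>
  proof -
    obtain c where c: "0 < c" and lo: "\<forall>\<^sub>F T in at_right 0. c * exp (- (a + \<epsilon> / 2) / T) \<le> V T"
      using lower[of "\<epsilon> / 2"] \<epsilon> by auto
    have "((\<lambda>T. T * ln c) \<longlongrightarrow> 0 * ln c) (at_right 0)" by (intro tendsto_intros)
    then have "\<forall>\<^sub>F T in at_right 0. - (\<epsilon> / 2) < T * ln c"
      using \<epsilon> by (intro order_tendstoD(1)[of _ 0]) auto
    with lo pos show "\<forall>\<^sub>F T in at_right 0. - a - \<epsilon> < T * ln (V T)"
    proof eventually_elim
      case (elim T)
      have "ln (c * exp (- (a + \<epsilon> / 2) / T)) \<le> ln (V T)"
        using elim(1) c by (subst ln_le_cancel_iff) (auto intro: less_le_trans[OF _ elim(1)])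
      then have "T * (ln c + - (a + \<epsilon> / 2) / T) \<le> T * ln (V T)"
        using c elim(2) by (intro mult_left_mono) (auto simp: ln_mult_pos)
      moreover have "T * (ln c + - (a + \<epsilon> / 2) / T) = T * ln c - (a + \<epsilon> / 2)"
        using elim(2) by (simp add: field_simps)
      ultimately show ?case using elim(3) by linarith
    qed
    have "\<forall>\<^sub>F T in at_right 0. U T < - a + \<epsilon>"
      using U \<epsilon> by (intro order_tendstoD(2)) auto
    with lo pos upper show "\<forall>\<^sub>F T in at_right 0. T * ln (V T) < - a + \<epsilon>"
    proof eventually_elim
      case (elim T)
      have "0 < V T" using less_le_trans[OF _ elim(1)] c by simp
      then have "ln (V T) \<le> U T / T" using elim(3) by (metis ln_exp ln_le_cancel_iff exp_gt_zero)
      then have "T * ln (V T) \<le> U T" using elim(2) by (simp add: le_divide_eq mult.commute)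
      then show ?case using elim(4) by linarith
    qed
  qed
  show ?thesis
  proof (rule order_tendstoI)
    show "\<forall>\<^sub>F T in at_right 0. b < T * ln (V T)" if "b < - a" for b
      using *(1)[of "- a - b"] that by simp
    show "\<forall>\<^sub>F T in at_right 0. T * ln (V T) < b" if "- a < b" for b
      using *(2)[of "a + b"] that by simp
  qed
qed

text \<open>The cancelling factors \<open>sqrt T\<close> are kept on purpose: in this form it is
  \<open>exp_avg\<close> of the rescaled motion with drift \<open>\<mu> * T\<close> and volatility
  \<open>\<sigma> * sqrt T\<close>.\<close>

definition scaled_avg :: "(real \<Rightarrow> 'a \<Rightarrow> real) \<Rightarrow> real \<Rightarrow> real \<Rightarrow> real \<Rightarrow> real \<Rightarrow> 'a \<Rightarrow> real" where
  "scaled_avg W \<tau> \<mu> \<sigma> T \<omega>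
    = integral {\<tau>..1} (\<lambda>u. exp (\<mu> * T * u + \<sigma> * sqrt T * (W (T * u) \<omega> / sqrt T)))"

lemma fs_average_eq:
  assumes W: "std_brownian_motion M W" and \<omega>: "\<omega> \<in> space M" and T: "0 < T" and \<tau>: "0 < \<tau>" "\<tau> < 1"
  shows "fs_average S0 r q \<sigma> W \<tau> T \<omega> = S0 / (1 - \<tau>) * scaled_avg W \<tau> (r - q - \<sigma>\<^sup>2 / 2) \<sigma> T \<omega>"
proof -
  let ?f = "\<lambda>t. bs_path S0 r q \<sigma> W t \<omega>"
  have W_cont: "continuous_on {0..} (\<lambda>t. W t \<omega>)"
    using W \<omega> unfolding std_brownian_motion_def by auto
  have "continuous_on {\<tau> * T..T} (\<lambda>t. W t \<omega>)"
    by (rule continuous_on_subset[OF W_cont]) (use T \<tau> in \<open>auto intro: order.trans[OF mult_nonneg_nonneg]\<close>)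
  then have "continuous_on {\<tau> * T..T} ?f"
    unfolding bs_path_def by (intro continuous_intros)
  then have "(?f has_integral integral {\<tau> * T..T} ?f) {\<tau> * T..T}"
    by (intro integrable_integral integrable_continuous_real)
  from has_integral_stretch_real[OF this, of T]
  have "((\<lambda>u. ?f (T * u)) has_integral integral {\<tau> * T..T} ?f / T) ((\<lambda>x. x / T) ` {\<tau> * T..T})"
    using T by simp
  also have "(\<lambda>x. x / T) ` {\<tau> * T..T} = {\<tau>..1}"
  proof -
    have "\<tau> * T \<le> T" using T \<tau> by simp
    then show ?thesis using T by (simp add: image_divide_atLeastAtMost)
  qed
  finally have "integral {\<tau>..1} (\<lambda>u. ?f (T * u)) = integral {\<tau> * T..T} ?f / T"
    by (rule integral_unique)
  moreover have "?f (T * u) = S0 * exp ((r - q - \<sigma>\<^sup>2 / 2) * T * u + \<sigma> * sqrt T * (W (T * u) \<omega> / sqrt T))" for u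
    using T by (simp add: bs_path_def mult.assoc)
  ultimately have "integral {\<tau> * T..T} ?f / T = S0 * scaled_avg W \<tau> (r - q - \<sigma>\<^sup>2 / 2) \<sigma> T \<omega>"
    unfolding scaled_avg_def by simp
  moreover have "fs_average S0 r q \<sigma> W \<tau> T \<omega> = integral {\<tau> * T..T} ?f / T / (1 - \<tau>)"
    by (simp add: fs_average_def mult.commute)
  ultimately show ?thesis by simp
qed

lemma continuous_Icc_bounded:
  fixes f :: "real \<Rightarrow> real"
  assumes "continuous_on {a..b} f"
  shows "\<exists>L. \<forall>t\<in>{a..b}. \<bar>f t\<bar> \<le> L"
  using compact_imp_bounded[OF compact_continuous_image[OF assms compact_Icc]]
  by (simp add: bounded_iff)

lemma exp_path_close:
  fixes x y C k :: real
  assumes "y \<le> C" "\<bar>x - y\<bar> \<le> k"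
  shows "\<bar>exp x - exp y\<bar> \<le> exp C * (exp k - 1)"
proof -
  have e: "exp x - exp y = exp y * (exp (x - y) - 1)" by (simp add: exp_diff right_diff_distrib)
  have "\<bar>exp (x - y) - 1\<bar> \<le> exp k - 1"
  proof (cases "0 \<le> x - y")
    case True
    then show ?thesis using assms by simp
  next
    case False
    have "1 - exp (x - y) \<le> 1 - exp (- k)" using assms by simp
    also have "\<dots> \<le> exp k - 1"
    proof -
      \<comment> \<open>This square expands to \<open>exp k + exp (- k) - 2\<close>.\<close>
      have "0 \<le> (exp (k / 2) - exp (- k / 2))\<^sup>2" by simp
      then show ?thesis by (simp add: power2_eq_square algebra_simps flip: exp_add)
    qed
    finally show ?thesis using False by (simp add: abs_if)
  qed
  then show ?thesis unfolding e abs_mult using assms by (intro mult_mono) auto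
qed

section \<open>Lower bounds along a given path\<close>

context
  fixes M :: "'a measure" and W :: "real \<Rightarrow> 'a \<Rightarrow> real" and \<tau> \<mu> \<sigma> :: real
  assumes W: "std_brownian_motion M W" and \<tau>: "0 < \<tau>" "\<tau> < 1" and \<sigma>: "0 < \<sigma>"
begin

lemma scaled_brownian: "0 < T \<Longrightarrow> brownian M (\<lambda>u \<omega>. W (T * u) \<omega> / sqrt T)"
  by (rule brownian_scaled[OF W])

lemma scaled_avg_eq:
  "0 < T \<Longrightarrow> scaled_avg W \<tau> \<mu> \<sigma> T = brownian.exp_avg (\<lambda>u \<omega>. W (T * u) \<omega> / sqrt T) \<tau> (\<mu> * T) (\<sigma> * sqrt T)"
  by (rule ext) (simp add: scaled_avg_def brownian.exp_avg_def[OF scaled_brownian])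

lemma scaled_avg_measurable: "0 < T \<Longrightarrow> scaled_avg W \<tau> \<mu> \<sigma> T \<in> borel_measurable M"
  unfolding scaled_avg_eq using \<tau> by (intro brownian.exp_avg_measurable[OF scaled_brownian]) auto

lemma scaled_avg_nonneg: "0 < T \<Longrightarrow> \<omega> \<in> space M \<Longrightarrow> 0 \<le> scaled_avg W \<tau> \<mu> \<sigma> T \<omega>"
  unfolding scaled_avg_eq using \<tau> by (intro brownian.exp_avg_nonneg[OF scaled_brownian]) auto

text \<open>The exponent \<open>p\<close> and the number of cells are fixed before T, spending half
  of \<open>\<epsilon>\<close> and half of \<open>\<delta>\<close> respectively. With these choices
  held fixed the remaining errors vanish as T tends to 0.\<close>

lemma path_probability_lower:
  fixes g G E :: "real \<Rightarrow> real"
  assumes g: "\<And>t. t \<in> {\<tau>..1} \<Longrightarrow> (g has_real_derivative G t) (at t within {\<tau>..1})"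
    and G_cont: "continuous_on {\<tau>..1} G"
    and E: "\<And>t. t \<in> {\<tau>..1} \<Longrightarrow> (E has_real_derivative (G t)\<^sup>2) (at t within {\<tau>..1})"
    and \<delta>: "0 < \<delta>" and \<epsilon>: "0 < \<epsilon>"
  shows "\<forall>\<^sub>F T in at_right 0. exp (- (((g \<tau>)\<^sup>2 / \<tau> + (E 1 - E \<tau>)) / (2 * \<sigma>\<^sup>2) + \<epsilon>) / T)
    \<le> measure M {\<omega> \<in> space M. \<bar>scaled_avg W \<tau> \<mu> \<sigma> T \<omega> - integral {\<tau>..1} (\<lambda>t. exp (g t))\<bar> \<le> \<delta>}"
proof -
  define J where "J = (g \<tau>)\<^sup>2 / \<tau> + (E 1 - E \<tau>)"
  have J: "0 \<le> J"
    using has_integral_nonneg[OF has_integral_increment[OF E, of \<tau> 1]] \<tau> by (simp add: J_def)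
  have g_cont: "continuous_on {\<tau>..1} g"
    using g by (meson DERIV_continuous continuous_on_eq_continuous_within)
  obtain L where L: "\<And>t. t \<in> {\<tau>..1} \<Longrightarrow> \<bar>G t\<bar> \<le> L"
    using continuous_Icc_bounded[OF G_cont] by blast
  obtain C where C: "\<And>t. t \<in> {\<tau>..1} \<Longrightarrow> \<bar>g t\<bar> \<le> C"
    using continuous_Icc_bounded[OF g_cont] by blast
  \<comment> \<open>Close enough to 1 that replacing \<open>J\<close> by \<open>p * J\<close> costs
    at most half of \<open>\<epsilon>\<close>; \<open>J + 1\<close> keeps the denominator positive
    even for a path without cost.\<close>
  define p where "p = 1 + \<sigma>\<^sup>2 * \<epsilon> / (J + 1)"
  have p: "1 < p" using \<sigma> \<epsilon> J by (simp add: p_def)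
  have pJ: "p * J / (2 * \<sigma>\<^sup>2) \<le> J / (2 * \<sigma>\<^sup>2) + \<epsilon> / 2"
  proof -
    have "J / (J + 1) \<le> 1" using J by simp
    then have "\<sigma>\<^sup>2 * \<epsilon> * (J / (J + 1)) \<le> \<sigma>\<^sup>2 * \<epsilon> * 1" using \<epsilon> by (intro mult_left_mono) auto
    then have "p * J \<le> J + \<sigma>\<^sup>2 * \<epsilon>" by (simp add: p_def distrib_right)
    then have "p * J / (2 * \<sigma>\<^sup>2) \<le> (J + \<sigma>\<^sup>2 * \<epsilon>) / (2 * \<sigma>\<^sup>2)" by (intro divide_right_mono) auto
    also have "\<dots> = J / (2 * \<sigma>\<^sup>2) + \<epsilon> / 2" using \<sigma> by (simp add: add_divide_distrib)
    finally show ?thesis .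
  qed
  have "((\<lambda>N. exp C * (exp (2 * L * ((1 - \<tau>) / real N)) - 1)) \<longlongrightarrow> exp C * (exp (2 * L * 0) - 1)) sequentially"
    by (intro tendsto_intros lim_const_over_n)
  from order_tendstoD(2)[OF this, of "\<delta> / 2"] \<delta>
  have "\<forall>\<^sub>F N in sequentially. exp C * (exp (2 * L * ((1 - \<tau>) / real N)) - 1) < \<delta> / 2"
    by simp
  then obtain N where N: "0 < N" "exp C * (exp (2 * L * ((1 - \<tau>) / real N)) - 1) < \<delta> / 2"
    using eventually_conj[OF _ eventually_gt_at_top[of 0]] by (metis (no_types, lifting) eventually_happens trivial_limit_sequentially)
  define k where "k = 2 * L * ((1 - \<tau>) / real N)"
  define H where "H t = (\<Sum>i<Suc N. chord \<tau> N g i * (min (grid \<tau> N (Suc i)) t - min (grid \<tau> N i) t))" for t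
  define v where "v = (\<Sum>i<Suc N. (chord \<tau> N g i)\<^sup>2 * (grid \<tau> N (Suc i) - grid \<tau> N i))"
  have v: "v \<le> J" unfolding v_def J_def by (rule chord_energy_le[OF \<tau> N(1) g E])
  have H: "\<bar>H t - g t\<bar> \<le> k" if "\<tau> \<le> t" "t \<le> 1" for t
    unfolding H_def k_def by (rule chord_path_close[OF \<tau> N(1) g E L that])
  have H_cont: "continuous_on {\<tau>..1} H" unfolding H_def[abs_def] by (intro continuous_intros)
  have int_close: "\<bar>integral {\<tau>..1} (\<lambda>t. exp (H t)) - integral {\<tau>..1} (\<lambda>t. exp (g t))\<bar> \<le> \<delta> / 2"
  proof -
    have "\<bar>integral {\<tau>..1} (\<lambda>t. exp (H t)) - integral {\<tau>..1} (\<lambda>t. exp (g t))\<bar>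
        = norm (integral {\<tau>..1} (\<lambda>t. exp (H t) - exp (g t)))"
      by (subst Henstock_Kurzweil_Integration.integral_diff)
        (auto intro!: integrable_continuous_real continuous_intros H_cont g_cont)
    also have "\<dots> \<le> \<delta> / 2 * (1 - \<tau>)"
    proof (rule integral_bound)
      show "norm (exp (H t) - exp (g t)) \<le> \<delta> / 2" if "t \<in> {\<tau>..1}" for t
      proof -
        have "\<bar>exp (H t) - exp (g t)\<bar> \<le> exp C * (exp k - 1)"
          using C[OF that] H[of t] that by (intro exp_path_close) auto
        then show ?thesis using N(2) by (simp add: k_def)
      qed
    qed (use \<tau> in \<open>auto intro!: continuous_intros H_cont g_cont\<close>)
    also have "\<dots> \<le> \<delta> / 2 * 1" using \<delta> \<tau> by (intro mult_left_mono) auto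
    finally show ?thesis by simp
  qed
  \<comment> \<open>A majorant, uniform in t, of the mean square required by
    \<open>tilt_lower_bound\<close>; its bracket tends to \<open>1 - 2 + 1\<close>.\<close>
  let ?Q = "\<lambda>T. exp (2 * (C + k)) * (exp (2 * (\<bar>\<mu>\<bar> * T) + 2 * (\<sigma>\<^sup>2 * T)) - 2 * exp (- (\<bar>\<mu>\<bar> * T)) + 1)"
  have "(?Q \<longlongrightarrow> exp (2 * (C + k)) * (exp (2 * (\<bar>\<mu>\<bar> * 0) + 2 * (\<sigma>\<^sup>2 * 0)) - 2 * exp (- (\<bar>\<mu>\<bar> * 0)) + 1)) (at_right 0)"
    by (intro tendsto_intros)
  then have Q: "\<forall>\<^sub>F T in at_right 0. ?Q T < (\<delta> / 2)\<^sup>2 / 16"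
    using \<delta> by (intro order_tendstoD(2)) auto
  \<comment> \<open>The truncation and the factor 1/2 of \<open>tilt_lower_bound\<close> contribute
    constants to the logarithm, negligible after multiplication by T.\<close>
  have "((\<lambda>T. T * (ln 4 / (p - 1) + ln 2)) \<longlongrightarrow> 0 * (ln 4 / (p - 1) + ln 2)) (at_right 0)"
    by (intro tendsto_intros)
  then have P: "\<forall>\<^sub>F T in at_right 0. T * (ln 4 / (p - 1) + ln 2) < \<epsilon> / 2"
    using \<epsilon> by (intro order_tendstoD(2)) auto
  have pos: "\<forall>\<^sub>F T in at_right (0::real). 0 < T" by (simp add: eventually_at_right_less)
  show ?thesis unfolding J_def[symmetric] using P Q pos
  proof eventually_elim
    case (elim T)
    interpret b: brownian M "\<lambda>u \<omega>. W (T * u) \<omega> / sqrt T" using scaled_brownian elim(3) .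
    let ?s = "\<sigma> * sqrt T"
    have s: "0 < ?s" using \<sigma> elim(3) by simp
    have s2: "?s\<^sup>2 = \<sigma>\<^sup>2 * T" using elim(3) by (simp add: power_mult_distrib)
    have mono: "mono (grid \<tau> N)" by (rule grid_mono[OF \<tau> N(1)])
    have g0: "grid \<tau> N 0 = 0" by (rule grid_simps(1)[OF \<tau> N(1)])
    have path: "b.tilt_path (grid \<tau> N) (chord \<tau> N g) (Suc N) = H"
      by (rule ext) (simp only: b.tilt_path_def[OF mono g0] H_def)
    have var: "b.tilt_var (grid \<tau> N) (chord \<tau> N g) (Suc N) = v"
      by (simp only: b.tilt_var_def[OF mono g0] v_def)
    have R: "exp (2 * H t) * (exp (2 * (\<mu> * T) * t + 2 * ?s\<^sup>2 * t) - 2 * exp (\<mu> * T * t + ?s\<^sup>2 * t / 2) + 1)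
        \<le> (\<delta> / 2)\<^sup>2 / 16" if t: "\<tau> \<le> t" "t \<le> 1" for t
    proof -
      have t0: "0 \<le> t" using t \<tau> by simp
      have "\<bar>\<mu> * T * t\<bar> \<le> \<bar>\<mu>\<bar> * T"
        unfolding abs_mult using t0 t elim(3) by (simp add: mult_left_le)
      then have mt: "\<mu> * T * t \<le> \<bar>\<mu>\<bar> * T" "- (\<bar>\<mu>\<bar> * T) \<le> \<mu> * T * t" by linarith+
      have st: "0 \<le> \<sigma>\<^sup>2 * T * t" "\<sigma>\<^sup>2 * T * t \<le> \<sigma>\<^sup>2 * T"
        using t0 t elim(3) by (auto simp: mult_left_le)
      have "exp (2 * (\<mu> * T) * t + 2 * ?s\<^sup>2 * t) \<le> exp (2 * (\<bar>\<mu>\<bar> * T) + 2 * (\<sigma>\<^sup>2 * T))"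
        using mt st by (simp add: s2 mult.assoc)
      moreover have "exp (- (\<bar>\<mu>\<bar> * T)) \<le> exp (\<mu> * T * t + ?s\<^sup>2 * t / 2)"
        unfolding exp_le_cancel_iff s2 using mt(2) st(1) by linarith
      ultimately have 1: "exp (2 * (\<mu> * T) * t + 2 * ?s\<^sup>2 * t) - 2 * exp (\<mu> * T * t + ?s\<^sup>2 * t / 2) + 1
          \<le> exp (2 * (\<bar>\<mu>\<bar> * T) + 2 * (\<sigma>\<^sup>2 * T)) - 2 * exp (- (\<bar>\<mu>\<bar> * T)) + 1" by linarith
      have 2: "0 \<le> exp (2 * (\<bar>\<mu>\<bar> * T) + 2 * (\<sigma>\<^sup>2 * T)) - 2 * exp (- (\<bar>\<mu>\<bar> * T)) + 1"
      proof -
        have "1 \<le> exp (2 * (\<bar>\<mu>\<bar> * T) + 2 * (\<sigma>\<^sup>2 * T))" "exp (- (\<bar>\<mu>\<bar> * T)) \<le> 1"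
          using elim(3) by auto
        then show ?thesis by linarith
      qed
      have "exp (2 * H t) \<le> exp (2 * (C + k))"
        using C[of t] H[OF t] t by auto
      from order.trans[OF mult_left_mono[OF 1] mult_right_mono[OF this 2]]
      show ?thesis using elim(2) by simp
    qed
    have "exp (- (J / (2 * \<sigma>\<^sup>2) + \<epsilon>) / T) \<le> exp (- (ln 4 / (p - 1) + p * v / (2 * ?s\<^sup>2)) - ln 2)"
    proof -
      have "p * v / (2 * ?s\<^sup>2) \<le> p * J / (2 * ?s\<^sup>2)"
        using v p by (intro divide_right_mono mult_left_mono) auto
      also have "\<dots> = p * J / (2 * \<sigma>\<^sup>2) / T" by (simp add: s2)
      also have "\<dots> \<le> (J / (2 * \<sigma>\<^sup>2) + \<epsilon> / 2) / T" using pJ elim(3) by (intro divide_right_mono) auto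
      finally have 1: "p * v / (2 * ?s\<^sup>2) \<le> (J / (2 * \<sigma>\<^sup>2) + \<epsilon> / 2) / T" .
      have "ln 4 / (p - 1) + ln 2 \<le> \<epsilon> / 2 / T"
        unfolding pos_le_divide_eq[OF elim(3)] using elim(1) by (simp add: mult.commute)
      with 1 have "(ln 4 / (p - 1) + ln 2) + p * v / (2 * ?s\<^sup>2) \<le> \<epsilon> / 2 / T + (J / (2 * \<sigma>\<^sup>2) + \<epsilon> / 2) / T"
        by (rule add_mono[rotated])
      also have "\<dots> = (J / (2 * \<sigma>\<^sup>2) + \<epsilon>) / T" by (simp add: add_divide_distrib)
      also have "\<dots> = - (- (J / (2 * \<sigma>\<^sup>2) + \<epsilon>) / T)"
        by (simp only: minus_divide_left[symmetric] minus_minus)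
      finally show ?thesis unfolding exp_le_cancel_iff by linarith
    qed
    also have "\<dots> = exp (- (ln 4 / (p - 1) + p * v / (2 * ?s\<^sup>2))) / 2"
      by (simp add: exp_diff)
    also have "\<dots> \<le> measure M {\<omega> \<in> space M. \<bar>integral {\<tau>..1} (\<lambda>t. exp (\<mu> * T * t + ?s * (W (T * t) \<omega> / sqrt T)))
        - integral {\<tau>..1} (\<lambda>t. exp (H t))\<bar> \<le> \<delta> / 2}"
      using b.tilt_lower_bound[OF mono g0, where d = "chord \<tau> N g" and n = "Suc N", unfolded path var,
          of \<tau> ?s p "\<delta> / 2" "\<mu> * T"] \<tau> s p \<delta> R by simp
    also have "\<dots> \<le> measure M {\<omega> \<in> space M. \<bar>scaled_avg W \<tau> \<mu> \<sigma> T \<omega> - integral {\<tau>..1} (\<lambda>t. exp (g t))\<bar> \<le> \<delta>}"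
    proof (rule b.finite_measure_mono)
      show "{\<omega> \<in> space M. \<bar>integral {\<tau>..1} (\<lambda>t. exp (\<mu> * T * t + ?s * (W (T * t) \<omega> / sqrt T)))
        - integral {\<tau>..1} (\<lambda>t. exp (H t))\<bar> \<le> \<delta> / 2}
        \<subseteq> {\<omega> \<in> space M. \<bar>scaled_avg W \<tau> \<mu> \<sigma> T \<omega> - integral {\<tau>..1} (\<lambda>t. exp (g t))\<bar> \<le> \<delta>}"
      proof (rule Collect_mono, rule impI, elim conjE, intro conjI)
        fix \<omega>
        assume "\<bar>integral {\<tau>..1} (\<lambda>t. exp (\<mu> * T * t + ?s * (W (T * t) \<omega> / sqrt T)))
          - integral {\<tau>..1} (\<lambda>t. exp (H t))\<bar> \<le> \<delta> / 2"
        then show "\<bar>scaled_avg W \<tau> \<mu> \<sigma> T \<omega> - integral {\<tau>..1} (\<lambda>t. exp (g t))\<bar> \<le> \<delta>"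
          using int_close unfolding scaled_avg_def by linarith
      qed
      show "{\<omega> \<in> space M. \<bar>scaled_avg W \<tau> \<mu> \<sigma> T \<omega> - integral {\<tau>..1} (\<lambda>t. exp (g t))\<bar> \<le> \<delta>} \<in> sets M"
        using scaled_avg_measurable[OF elim(3)] by measurable
    qed
    finally show ?case .
  qed
qed

text \<open>Moving the optimal path by a small constant \<open>\<eta>\<close> on \<open>[\<tau>, 1]\<close> brings the option into the
  money at an arbitrarily small extra cost.\<close>

lemma payoff_lower:
  fixes g G E \<phi> :: "real \<Rightarrow> real"
  assumes g: "\<And>t. t \<in> {\<tau>..1} \<Longrightarrow> (g has_real_derivative G t) (at t within {\<tau>..1})"
    and G_cont: "continuous_on {\<tau>..1} G"
    and E: "\<And>t. t \<in> {\<tau>..1} \<Longrightarrow> (E has_real_derivative (G t)\<^sup>2) (at t within {\<tau>..1})"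
    and \<epsilon>: "0 < \<epsilon>" and \<phi>_nonneg: "\<And>x. 0 \<le> \<phi> x"
    and int: "\<forall>\<^sub>F T in at_right 0. integrable M (\<lambda>\<omega>. \<phi> (scaled_avg W \<tau> \<mu> \<sigma> T \<omega>))"
    and \<phi>: "\<And>\<eta>. 0 < \<eta> \<Longrightarrow> \<exists>\<delta>>0. \<exists>k>0. \<forall>x. \<bar>x - exp (\<iota> * \<eta>) * integral {\<tau>..1} (\<lambda>t. exp (g t))\<bar> \<le> \<delta> \<longrightarrow> k \<le> \<phi> x"
  shows "\<exists>k>0. \<forall>\<^sub>F T in at_right 0. k * exp (- (((g \<tau>)\<^sup>2 / \<tau> + (E 1 - E \<tau>)) / (2 * \<sigma>\<^sup>2) + \<epsilon>) / T)
    \<le> exp (- r * T) * (\<integral>\<omega>. \<phi> (scaled_avg W \<tau> \<mu> \<sigma> T \<omega>) \<partial>M)"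
proof -
  interpret prob_space M using W by (simp add: std_brownian_motion_def)
  let ?J = "((g \<tau>)\<^sup>2 / \<tau> + (E 1 - E \<tau>)) / (2 * \<sigma>\<^sup>2)"
  \<comment> \<open>Adding a constant leaves the derivative after \<tau> unchanged, so only the cost
    of the initial segment moves. \<open>\<iota>\<close> is the direction into the money: 1 for the
    call and -1 for the put.\<close>
  let ?J' = "\<lambda>\<eta>. ((g \<tau> + \<iota> * \<eta>)\<^sup>2 / \<tau> + (E 1 - E \<tau>)) / (2 * \<sigma>\<^sup>2)"
  have "(?J' \<longlongrightarrow> ((g \<tau> + \<iota> * 0)\<^sup>2 / \<tau> + (E 1 - E \<tau>)) / (2 * \<sigma>\<^sup>2)) (at_right 0)"
    by (intro tendsto_intros) (use \<tau> \<sigma> in auto)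
  then have "\<forall>\<^sub>F \<eta> in at_right 0. ?J' \<eta> < ?J + \<epsilon> / 2"
    using \<epsilon> by (intro order_tendstoD(2)) auto
  then have "\<forall>\<^sub>F \<eta> in at_right 0. ?J' \<eta> < ?J + \<epsilon> / 2 \<and> 0 < \<eta>"
    by (rule eventually_conj) (simp add: eventually_at_right_less)
  then obtain \<eta> where \<eta>: "?J' \<eta> < ?J + \<epsilon> / 2" "0 < \<eta>"
    using eventually_happens[of _ "at_right (0::real)"] by auto
  obtain \<delta> k where \<delta>: "0 < \<delta>" and k: "0 < k"
    and near: "\<And>x. \<bar>x - exp (\<iota> * \<eta>) * integral {\<tau>..1} (\<lambda>t. exp (g t))\<bar> \<le> \<delta> \<Longrightarrow> k \<le> \<phi> x"
    using \<phi>[OF \<eta>(2)] by blast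
  have shift: "integral {\<tau>..1} (\<lambda>t. exp (g t + \<iota> * \<eta>)) = exp (\<iota> * \<eta>) * integral {\<tau>..1} (\<lambda>t. exp (g t))"
    by (simp add: exp_add mult.commute)
  have "\<forall>\<^sub>F T in at_right 0. exp (- (?J' \<eta> + \<epsilon> / 2) / T)
      \<le> measure M {\<omega> \<in> space M. \<bar>scaled_avg W \<tau> \<mu> \<sigma> T \<omega> - integral {\<tau>..1} (\<lambda>t. exp (g t + \<iota> * \<eta>))\<bar> \<le> \<delta>}"
  proof (rule path_probability_lower[where g = "\<lambda>t. g t + \<iota> * \<eta>" and G = G])
    show "((\<lambda>t. g t + \<iota> * \<eta>) has_real_derivative G t) (at t within {\<tau>..1})" if "t \<in> {\<tau>..1}" for t
      using DERIV_add[OF g[OF that] DERIV_const[of "\<iota> * \<eta>"]] by simp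
  qed (use G_cont E \<delta> \<epsilon> in auto)
  moreover have "\<forall>\<^sub>F T in at_right (0::real). 0 < T" by (simp add: eventually_at_right_less)
  moreover have "\<forall>\<^sub>F T in at_right (0::real). T < 1" by (rule eventually_at_right_real[THEN eventually_mono]) auto
  ultimately have "\<forall>\<^sub>F T in at_right 0. exp (- \<bar>r\<bar>) * k * exp (- (?J + \<epsilon>) / T)
      \<le> exp (- r * T) * (\<integral>\<omega>. \<phi> (scaled_avg W \<tau> \<mu> \<sigma> T \<omega>) \<partial>M)" using int
  proof eventually_elim
    case (elim T)
    let ?S = "{\<omega> \<in> space M. \<bar>scaled_avg W \<tau> \<mu> \<sigma> T \<omega> - integral {\<tau>..1} (\<lambda>t. exp (g t + \<iota> * \<eta>))\<bar> \<le> \<delta>}"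
    have S: "?S \<in> sets M" using scaled_avg_measurable[OF elim(2)] by measurable
    have "k * exp (- (?J + \<epsilon>) / T) \<le> k * exp (- (?J' \<eta> + \<epsilon> / 2) / T)"
      using \<eta>(1) elim(2) k by (intro mult_left_mono) (auto intro!: divide_right_mono)
    also have "\<dots> \<le> k * prob ?S" using elim(1) k by (intro mult_left_mono) auto
    also have "\<dots> = (\<integral>\<omega>. k * indicator ?S \<omega> \<partial>M)" using S by simp
    also have "\<dots> \<le> (\<integral>\<omega>. \<phi> (scaled_avg W \<tau> \<mu> \<sigma> T \<omega>) \<partial>M)"
    proof (rule integral_mono)
      show "integrable M (\<lambda>\<omega>. k * indicator ?S \<omega>)"
        using S by (intro integrable_mult_right integrable_real_indicator) (auto simp: less_top[symmetric])
      show "k * indicator ?S \<omega> \<le> \<phi> (scaled_avg W \<tau> \<mu> \<sigma> T \<omega>)" if "\<omega> \<in> space M" for \<omega>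
        using near[of "scaled_avg W \<tau> \<mu> \<sigma> T \<omega>"] \<phi>_nonneg unfolding shift by (auto simp: indicator_def)
    qed (use elim in auto)
    finally have 1: "k * exp (- (?J + \<epsilon>) / T) \<le> (\<integral>\<omega>. \<phi> (scaled_avg W \<tau> \<mu> \<sigma> T \<omega>) \<partial>M)" .
    \<comment> \<open>For \<open>T < 1\<close> the discount factor is at least
      \<open>exp (- \<bar>r\<bar>)\<close>, a constant without influence on the rate.\<close>
    have "r * T \<le> \<bar>r\<bar> * 1" using elim(2,3) by (intro mult_mono) auto
    then have "exp (- \<bar>r\<bar>) \<le> exp (- r * T)" by simp
    from mult_mono[OF this 1] k show ?case by (simp add: mult.assoc)
  qed
  then show ?thesis using k by (intro exI[of _ "exp (- \<bar>r\<bar>) * k"]) auto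
qed

end

text \<open>Any path whose average meets the strike gives a lower bound, and any admissible
  \<open>\<theta>\<close> and \<open>\<rho>\<close> give an upper bound. The hypothesis
  \<open>rate\<close> demands that the two exponents agree; \<open>call_rate\<close> verifies it for
  the explicit path.\<close>

lemma call_asymptotics:
  fixes M :: "'a measure" and g G E :: "real \<Rightarrow> real"
  assumes W: "std_brownian_motion M W" and r: "0 \<le> r" and \<sigma>: "0 < \<sigma>" and S0: "0 < S0"
    and \<tau>: "0 < \<tau>" "\<tau> < 1" and K: "0 < K"
    and g: "\<And>t. t \<in> {\<tau>..1} \<Longrightarrow> (g has_real_derivative G t) (at t within {\<tau>..1})"
    and G_cont: "continuous_on {\<tau>..1} G"
    and E: "\<And>t. t \<in> {\<tau>..1} \<Longrightarrow> (E has_real_derivative (G t)\<^sup>2) (at t within {\<tau>..1})"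
    and g_K: "S0 / (1 - \<tau>) * integral {\<tau>..1} (\<lambda>t. exp (g t)) = K"
    and \<rho>: "1 < \<rho>" and \<theta>: "0 < \<theta>"
    and rate: "- \<theta> * ln K + \<theta> * ln (S0 / (1 - \<tau>)) - \<theta> * ln (\<sigma>\<^sup>2 * \<theta> / 2) - \<theta> - \<theta> * log_mass \<rho>
      + \<sigma>\<^sup>2 * \<theta>\<^sup>2 * \<rho>\<^sup>2 * (1 - \<tau>) / 2 + \<sigma>\<^sup>2 * \<theta>\<^sup>2 * \<tau> / 2 = - a"
    and a: "a = ((g \<tau>)\<^sup>2 / \<tau> + (E 1 - E \<tau>)) / (2 * \<sigma>\<^sup>2)"
  shows "((\<lambda>T. T * ln (asian_call M W S0 r q \<sigma> \<tau> K T)) \<longlongrightarrow> - a) (at_right 0)"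
proof -
  interpret prob_space M using W by (simp add: std_brownian_motion_def)
  define \<mu> where "\<mu> = r - q - \<sigma>\<^sup>2 / 2"
  define c where "c = S0 / (1 - \<tau>)"
  have c: "0 < c" using S0 \<tau> by (simp add: c_def)
  let ?X = "scaled_avg W \<tau> \<mu> \<sigma>"
  let ?\<phi> = "\<lambda>x. max 0 (c * x - K)"
  have pos: "\<forall>\<^sub>F T in at_right (0::real). 0 < T" by (simp add: eventually_at_right_less)
  have price: "asian_call M W S0 r q \<sigma> \<tau> K T = exp (- r * T) * (\<integral>\<omega>. ?\<phi> (?X T \<omega>) \<partial>M)" if "0 < T" for T
    unfolding asian_call_def c_def \<mu>_def
    by (intro arg_cong2[where f = "(*)"] Bochner_Integration.integral_cong refl) (simp add: fs_average_eq[OF W _ that \<tau>])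
  \<comment> \<open>Rounding up ensures \<open>n T \<ge> 1\<close> and keeps \<open>T * n T\<close>
    between \<open>\<theta>\<close> and \<open>\<theta> + T\<close>.\<close>
  define n where "n T = nat \<lceil>\<theta> / T\<rceil>" for T
  define y where "y T = T * real (n T)" for T
  have n: "1 \<le> n T" if "0 < T" for T
    using that \<theta> by (simp add: n_def Suc_le_eq)
  have y_bounds: "\<theta> \<le> y T" "y T \<le> \<theta> + T" if "0 < T" for T
  proof -
    have nn: "0 \<le> \<theta> / T" using that \<theta> by simp
    have "\<theta> / T \<le> real (n T)" unfolding n_def by linarith
    then show "\<theta> \<le> y T" using that by (simp add: y_def pos_divide_le_eq mult.commute)
    have "real (n T) \<le> \<theta> / T + 1" unfolding n_def using nn by linarith
    then have "T * real (n T) \<le> T * (\<theta> / T + 1)" using that by (intro mult_left_mono) auto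
    then show "y T \<le> \<theta> + T" using that by (simp add: y_def distrib_left)
  qed
  have y_lim: "(y \<longlongrightarrow> \<theta>) (at_right 0)"
  proof (rule tendsto_sandwich)
    show "\<forall>\<^sub>F T in at_right 0. \<theta> \<le> y T" using pos by eventually_elim (rule y_bounds)
    show "\<forall>\<^sub>F T in at_right 0. y T \<le> \<theta> + T" using pos by eventually_elim (rule y_bounds)
    have "((\<lambda>T. \<theta> + T) \<longlongrightarrow> \<theta> + 0) (at_right 0)" by (intro tendsto_intros)
    then show "((\<lambda>T. \<theta> + T) \<longlongrightarrow> \<theta>) (at_right 0)" by simp
  qed simp
  define x where "x T = (1 - real (n T)) * ln K + real (n T) * ln c + real (n T) * \<bar>\<mu> * T\<bar>
      + ((real (n T) + 1) * ln (real (n T)) - real (n T) + 1)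
      - real (n T) * ln ((real (n T) * (\<sigma> * sqrt T))\<^sup>2 / 2) - (real (n T) * log_mass \<rho> + ln (\<rho>\<^sup>2 - 1) - ln (\<rho>\<^sup>2))
      + (real (n T) * (\<sigma> * sqrt T) * \<rho>)\<^sup>2 * (1 - \<tau>) / 2 + (real (n T) * (\<sigma> * sqrt T))\<^sup>2 * \<tau> / 2" for T
  have mom: "integrable M (\<lambda>\<omega>. ?\<phi> (?X T \<omega>))" "(\<integral>\<omega>. ?\<phi> (?X T \<omega>) \<partial>M) \<le> exp (x T)" if "0 < T" for T
  proof -
    interpret b: brownian M "\<lambda>u \<omega>. W (T * u) \<omega> / sqrt T" using brownian_scaled[OF W that] .
    note * = b.call_moment_bound[OF \<tau> _ n[OF that] \<rho> c K, of "\<sigma> * sqrt T" "\<mu> * T"]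
    show "integrable M (\<lambda>\<omega>. ?\<phi> (?X T \<omega>))"
      using *(1) \<sigma> that by (simp add: scaled_avg_eq[OF W \<tau> \<sigma> that])
    show "(\<integral>\<omega>. ?\<phi> (?X T \<omega>) \<partial>M) \<le> exp (x T)"
      using *(2) \<sigma> that by (simp add: scaled_avg_eq[OF W \<tau> \<sigma> that] x_def)
  qed
  \<comment> \<open>\<open>T * x T\<close> as a function of T, of \<open>y = T * n T\<close> and of
    \<open>L = T * ln T\<close>. The terms \<open>y * ln T\<close> from Stirling's bound and from
    the moment product cancel, and only \<open>T * ln T\<close> survives, so the limit at 0 is found
    by continuity.\<close>
  define R where "R T y L = (T - y) * ln K + y * ln c + y * (\<bar>\<mu>\<bar> * T)
      + (T * ln y - L) - y * ln (\<sigma>\<^sup>2 * y / 2) - y + T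
      - (y * log_mass \<rho> + T * (ln (\<rho>\<^sup>2 - 1) - ln (\<rho>\<^sup>2)))
      + \<sigma>\<^sup>2 * y\<^sup>2 * \<rho>\<^sup>2 * (1 - \<tau>) / 2 + \<sigma>\<^sup>2 * y\<^sup>2 * \<tau> / 2" for T y L
  have Tx: "T * x T = R T (y T) (T * ln T)" if T: "0 < T" for T
  proof -
    have y: "0 < y T" using y_bounds[OF T] \<theta> by linarith
    have nT: "real (n T) = y T / T" using T by (simp add: y_def)
    have ln_n: "ln (real (n T)) = ln (y T) - ln T"
      unfolding nT using y T by (simp add: ln_div)
    have sq: "(real (n T) * (\<sigma> * sqrt T))\<^sup>2 = \<sigma>\<^sup>2 * (y T)\<^sup>2 / T"
    proof -
      have "(y T / T * (\<sigma> * sqrt T))\<^sup>2 = (y T)\<^sup>2 / T\<^sup>2 * (\<sigma>\<^sup>2 * T)"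
        using T by (simp add: power_mult_distrib power_divide)
      also have "\<dots> = \<sigma>\<^sup>2 * (y T)\<^sup>2 / T"
        using T by (simp add: power2_eq_square[of T])
      finally show ?thesis unfolding nT .
    qed
    have "(real (n T) * (\<sigma> * sqrt T))\<^sup>2 / 2 = (\<sigma>\<^sup>2 * y T / 2) * (y T / T)"
      unfolding sq by (simp add: power2_eq_square)
    then have ln_sq: "ln ((real (n T) * (\<sigma> * sqrt T))\<^sup>2 / 2) = ln (\<sigma>\<^sup>2 * y T / 2) + (ln (y T) - ln T)"
      using y T \<sigma> by (simp only: ln_mult_pos[of "\<sigma>\<^sup>2 * y T / 2" "y T / T"] ln_div) (simp add: ln_mult_pos ln_div)
    have sq\<rho>: "(real (n T) * (\<sigma> * sqrt T) * \<rho>)\<^sup>2 = \<sigma>\<^sup>2 * (y T)\<^sup>2 / T * \<rho>\<^sup>2"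
      unfolding power_mult_distrib[of "real (n T) * (\<sigma> * sqrt T)"] sq ..
    show ?thesis
      unfolding x_def R_def ln_sq unfolding sq\<rho> unfolding sq ln_n unfolding nT
      using T by (simp add: abs_mult field_simps)
  qed
  have lower: "\<exists>k>0. \<forall>\<^sub>F T in at_right 0. k * exp (- (a + \<epsilon>) / T) \<le> asian_call M W S0 r q \<sigma> \<tau> K T"
    if \<epsilon>: "0 < \<epsilon>" for \<epsilon>
  proof -
    have "\<exists>k>0. \<forall>\<^sub>F T in at_right 0. k * exp (- (a + \<epsilon>) / T) \<le> exp (- r * T) * (\<integral>\<omega>. ?\<phi> (?X T \<omega>) \<partial>M)"
      unfolding a
    proof (rule payoff_lower[OF W \<tau> \<sigma> g G_cont E \<epsilon>, where \<iota> = 1])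
      show "\<forall>\<^sub>F T in at_right 0. integrable M (\<lambda>\<omega>. ?\<phi> (?X T \<omega>))"
        using pos by eventually_elim (rule mom)
      fix \<eta> :: real assume \<eta>: "0 < \<eta>"
      define \<Delta> where "\<Delta> = K * (exp \<eta> - 1)"
      have \<Delta>: "0 < \<Delta>" using K \<eta> by (simp add: \<Delta>_def)
      show "\<exists>\<delta>>0. \<exists>k>0. \<forall>x. \<bar>x - exp (1 * \<eta>) * integral {\<tau>..1} (\<lambda>t. exp (g t))\<bar> \<le> \<delta> \<longrightarrow> k \<le> ?\<phi> x"
      proof (intro exI conjI allI impI)
        show "0 < \<Delta> / (2 * c)" "0 < \<Delta> / 2" using \<Delta> c by auto
        fix x assume "\<bar>x - exp (1 * \<eta>) * integral {\<tau>..1} (\<lambda>t. exp (g t))\<bar> \<le> \<Delta> / (2 * c)"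
        then have "exp \<eta> * integral {\<tau>..1} (\<lambda>t. exp (g t)) - \<Delta> / (2 * c) \<le> x" by simp
        then have "c * (exp \<eta> * integral {\<tau>..1} (\<lambda>t. exp (g t)) - \<Delta> / (2 * c)) \<le> c * x"
          using c by (intro mult_left_mono) auto
        moreover have "c * (exp \<eta> * integral {\<tau>..1} (\<lambda>t. exp (g t)) - \<Delta> / (2 * c)) = exp \<eta> * K - \<Delta> / 2"
          unfolding g_K[folded c_def, symmetric] using c by (simp add: right_diff_distrib)
        moreover have "\<Delta> = exp \<eta> * K - K" by (simp add: \<Delta>_def algebra_simps)
        ultimately have "\<Delta> / 2 \<le> c * x - K" by linarith
        then show "\<Delta> / 2 \<le> ?\<phi> x" by (rule max.coboundedI2)
      qed
    qed (simp_all add: le_max_iff_disj)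
    then obtain k where k: "0 < k"
      and ev: "\<forall>\<^sub>F T in at_right 0. k * exp (- (a + \<epsilon>) / T) \<le> exp (- r * T) * (\<integral>\<omega>. ?\<phi> (?X T \<omega>) \<partial>M)" by blast
    have "\<forall>\<^sub>F T in at_right 0. k * exp (- (a + \<epsilon>) / T) \<le> asian_call M W S0 r q \<sigma> \<tau> K T"
      using ev pos by eventually_elim (simp add: price)
    then show ?thesis using k by blast
  qed
  have upper: "\<forall>\<^sub>F T in at_right 0. asian_call M W S0 r q \<sigma> \<tau> K T \<le> exp ((T * x T) / T)"
    using pos
  proof eventually_elim
    case (elim T)
    have "exp (- r * T) * (\<integral>\<omega>. ?\<phi> (?X T \<omega>) \<partial>M) \<le> 1 * exp (x T)"
      using r elim mom(2)[OF elim] by (intro mult_mono) (auto intro: integral_nonneg_AE)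
    then show ?case using elim by (simp add: price)
  qed
  have "((\<lambda>T. R T (y T) (T * ln T)) \<longlongrightarrow> R 0 \<theta> 0) (at_right 0)"
  proof -
    have "((\<lambda>T::real. T * ln T) \<longlongrightarrow> 0) (at_right 0)" by real_asymp
    then show ?thesis unfolding R_def using \<theta> \<sigma> by (intro tendsto_intros y_lim) auto
  qed
  also have "R 0 \<theta> 0 = - a"
    using rate by (simp add: R_def c_def)
  finally have "((\<lambda>T. T * x T) \<longlongrightarrow> - a) (at_right 0)"
    by (rule Lim_transform_eventually) (use pos in eventually_elim, simp add: Tx)
  with lower upper show ?thesis by (intro log_sandwich)
qed

text \<open>The payoff is at most \<open>K\<close>, and it is positive only when the average falls
  below that of the path, which is the event of \<open>put_tail_bound\<close>.
  \<open>\<kappa>\<close> is the multiplier of the constraint in the Euler-Lagrange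
  equation.\<close>

lemma put_asymptotics:
  fixes M :: "'a measure" and g G E :: "real \<Rightarrow> real"
  assumes W: "std_brownian_motion M W" and r: "0 \<le> r" and \<sigma>: "0 < \<sigma>" and S0: "0 < S0"
    and \<tau>: "0 < \<tau>" "\<tau> < 1" and K: "0 < K" and \<kappa>: "0 < \<kappa>"
    and g: "\<And>t. t \<in> {\<tau>..1} \<Longrightarrow> (g has_real_derivative G t) (at t within {\<tau>..1})"
    and G: "\<And>t. t \<in> {\<tau>..1} \<Longrightarrow> (G has_real_derivative \<kappa> * exp (g t)) (at t within {\<tau>..1})"
    and E: "\<And>t. t \<in> {\<tau>..1} \<Longrightarrow> (E has_real_derivative (G t)\<^sup>2) (at t within {\<tau>..1})"
    and g_K: "S0 / (1 - \<tau>) * integral {\<tau>..1} (\<lambda>t. exp (g t)) = K"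
    and G_1: "G 1 = 0" and g_\<tau>: "g \<tau> = \<tau> * G \<tau>"
    and a: "a = ((g \<tau>)\<^sup>2 / \<tau> + (E 1 - E \<tau>)) / (2 * \<sigma>\<^sup>2)"
  shows "((\<lambda>T. T * ln (asian_put M W S0 r q \<sigma> \<tau> K T)) \<longlongrightarrow> - a) (at_right 0)"
proof -
  interpret prob_space M using W by (simp add: std_brownian_motion_def)
  define \<mu> where "\<mu> = r - q - \<sigma>\<^sup>2 / 2"
  define c where "c = S0 / (1 - \<tau>)"
  have c: "0 < c" using S0 \<tau> by (simp add: c_def)
  let ?X = "scaled_avg W \<tau> \<mu> \<sigma>"
  let ?\<phi> = "\<lambda>x. max 0 (K - c * x)"
  let ?g = "integral {\<tau>..1} (\<lambda>t. exp (g t))"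
  have G_cont: "continuous_on {\<tau>..1} G"
    using G by (meson DERIV_continuous continuous_on_eq_continuous_within)
  have pos: "\<forall>\<^sub>F T in at_right (0::real). 0 < T" by (simp add: eventually_at_right_less)
  have price: "asian_put M W S0 r q \<sigma> \<tau> K T = exp (- r * T) * (\<integral>\<omega>. ?\<phi> (?X T \<omega>) \<partial>M)" if "0 < T" for T
    unfolding asian_put_def c_def \<mu>_def
    by (intro arg_cong2[where f = "(*)"] Bochner_Integration.integral_cong refl) (simp add: fs_average_eq[OF W _ that \<tau>])
  have X_meas: "?X T \<in> borel_measurable M" if "0 < T" for T
    by (rule scaled_avg_measurable[OF W \<tau> \<sigma> that])
  have X_nonneg: "0 \<le> ?X T \<omega>" if "0 < T" "\<omega> \<in> space M" for T \<omega>
    by (rule scaled_avg_nonneg[OF W \<tau> \<sigma> that])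
  have int: "integrable M (\<lambda>\<omega>. ?\<phi> (?X T \<omega>))" if "0 < T" for T
  proof (rule integrable_const_bound[where B = K])
    show "AE \<omega> in M. norm (?\<phi> (?X T \<omega>)) \<le> K"
      using X_nonneg[OF that] c K by (intro AE_I2) auto
    show "(\<lambda>\<omega>. ?\<phi> (?X T \<omega>)) \<in> borel_measurable M"
      using X_meas[OF that] by measurable
  qed
  have lower: "\<exists>k>0. \<forall>\<^sub>F T in at_right 0. k * exp (- (a + \<epsilon>) / T) \<le> asian_put M W S0 r q \<sigma> \<tau> K T"
    if \<epsilon>: "0 < \<epsilon>" for \<epsilon>
  proof -
    have "\<exists>k>0. \<forall>\<^sub>F T in at_right 0. k * exp (- (a + \<epsilon>) / T) \<le> exp (- r * T) * (\<integral>\<omega>. ?\<phi> (?X T \<omega>) \<partial>M)"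
      unfolding a
    proof (rule payoff_lower[OF W \<tau> \<sigma> g G_cont E \<epsilon>, where \<iota> = "- 1"])
      show "\<forall>\<^sub>F T in at_right 0. integrable M (\<lambda>\<omega>. ?\<phi> (?X T \<omega>))"
        using pos by eventually_elim (rule int)
      fix \<eta> :: real assume \<eta>: "0 < \<eta>"
      define \<Delta> where "\<Delta> = K * (1 - exp (- \<eta>))"
      have \<Delta>: "0 < \<Delta>" using K \<eta> by (simp add: \<Delta>_def)
      show "\<exists>\<delta>>0. \<exists>k>0. \<forall>x. \<bar>x - exp (- 1 * \<eta>) * ?g\<bar> \<le> \<delta> \<longrightarrow> k \<le> ?\<phi> x"
      proof (intro exI conjI allI impI)
        show "0 < \<Delta> / (2 * c)" "0 < \<Delta> / 2" using \<Delta> c by auto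
        fix x assume "\<bar>x - exp (- 1 * \<eta>) * ?g\<bar> \<le> \<Delta> / (2 * c)"
        then have "x \<le> exp (- \<eta>) * ?g + \<Delta> / (2 * c)" by simp
        then have "c * x \<le> c * (exp (- \<eta>) * ?g + \<Delta> / (2 * c))"
          using c by (intro mult_left_mono) auto
        moreover have "c * (exp (- \<eta>) * ?g + \<Delta> / (2 * c)) = exp (- \<eta>) * K + \<Delta> / 2"
          unfolding g_K[folded c_def, symmetric] using c by (simp add: distrib_left)
        moreover have "\<Delta> = K - exp (- \<eta>) * K" by (simp add: \<Delta>_def algebra_simps)
        ultimately have "\<Delta> / 2 \<le> K - c * x" by linarith
        then show "\<Delta> / 2 \<le> ?\<phi> x" by (rule max.coboundedI2)
      qed
    qed (simp_all add: le_max_iff_disj)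
    then obtain k where k: "0 < k"
      and ev: "\<forall>\<^sub>F T in at_right 0. k * exp (- (a + \<epsilon>) / T) \<le> exp (- r * T) * (\<integral>\<omega>. ?\<phi> (?X T \<omega>) \<partial>M)" by blast
    have "\<forall>\<^sub>F T in at_right 0. k * exp (- (a + \<epsilon>) / T) \<le> asian_put M W S0 r q \<sigma> \<tau> K T"
      using ev pos by eventually_elim (simp add: price)
    then show ?thesis using k by blast
  qed
  \<comment> \<open>The rate, corrected by the bound \<open>K\<close> on the payoff and by the
    drift; both corrections carry a factor \<open>T\<close>.\<close>
  define U where "U T = T * ln K - (a - \<bar>\<mu>\<bar> * T * \<bar>G \<tau>\<bar> / \<sigma>\<^sup>2)" for T
  have upper: "\<forall>\<^sub>F T in at_right 0. asian_put M W S0 r q \<sigma> \<tau> K T \<le> exp (U T / T)"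
    using pos
  proof eventually_elim
    case (elim T)
    interpret b: brownian M "\<lambda>u \<omega>. W (T * u) \<omega> / sqrt T" using brownian_scaled[OF W elim] .
    let ?S = "{\<omega> \<in> space M. ?X T \<omega> < ?g}"
    have S: "?S \<in> sets M" using X_meas[OF elim] by measurable
    have "(\<integral>\<omega>. ?\<phi> (?X T \<omega>) \<partial>M) \<le> (\<integral>\<omega>. K * indicator ?S \<omega> \<partial>M)"
    proof (rule integral_mono[OF int[OF elim]])
      show "integrable M (\<lambda>\<omega>. K * indicator ?S \<omega>)"
        using S by (intro integrable_mult_right integrable_real_indicator) (auto simp: less_top[symmetric])
      fix \<omega> assume \<omega>: "\<omega> \<in> space M"
      show "?\<phi> (?X T \<omega>) \<le> K * indicator ?S \<omega>"
      proof (cases "\<omega> \<in> ?S")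
        case True
        then show ?thesis using X_nonneg[OF elim \<omega>] c K by simp
      next
        case False
        then have "c * ?g \<le> c * ?X T \<omega>" using \<omega> c by (intro mult_left_mono) auto
        then show ?thesis using False g_K by (simp add: c_def)
      qed
    qed
    also have "\<dots> = K * prob ?S" using S by simp
    also have "\<dots> \<le> K * exp (- (((g \<tau>)\<^sup>2 / \<tau> + (E 1 - E \<tau>)) / 2 - \<bar>\<mu> * T\<bar> * \<bar>G \<tau>\<bar>) / (\<sigma> * sqrt T)\<^sup>2)"
      unfolding scaled_avg_eq[OF W \<tau> \<sigma> elim]
      using K \<sigma> elim by (intro mult_left_mono b.put_tail_bound[OF \<tau> _ \<kappa> g G E G_1 g_\<tau>]) auto
    also have "\<dots> = exp (U T / T)"
    proof -
      have "- (((g \<tau>)\<^sup>2 / \<tau> + (E 1 - E \<tau>)) / 2 - \<bar>\<mu> * T\<bar> * \<bar>G \<tau>\<bar>) / (\<sigma> * sqrt T)\<^sup>2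
          = - (a - \<bar>\<mu>\<bar> * T * \<bar>G \<tau>\<bar> / \<sigma>\<^sup>2) / T"
        using elim \<sigma> by (simp add: a power_mult_distrib abs_mult diff_divide_distrib)
      moreover have "U T / T = ln K + - (a - \<bar>\<mu>\<bar> * T * \<bar>G \<tau>\<bar> / \<sigma>\<^sup>2) / T"
        using elim by (simp add: U_def diff_divide_distrib)
      ultimately show ?thesis using K by (simp add: exp_add)
    qed
    finally have "exp (- r * T) * (\<integral>\<omega>. ?\<phi> (?X T \<omega>) \<partial>M) \<le> 1 * exp (U T / T)"
      using r elim by (intro mult_mono) (auto intro: integral_nonneg_AE)
    then show ?case using elim by (simp add: price)
  qed
  have "(U \<longlongrightarrow> 0 * ln K - (a - \<bar>\<mu>\<bar> * 0 * \<bar>G \<tau>\<bar> / \<sigma>\<^sup>2)) (at_right 0)"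
    unfolding U_def[abs_def] using \<sigma> by (intro tendsto_intros) auto
  then have "(U \<longlongrightarrow> - a) (at_right 0)" by simp
  with lower upper show ?thesis by (intro log_sandwich)
qed

section \<open>Optimal paths and their parameters\<close>

text \<open>The path solves \<open>g'' = - (b\<^sup>2 / 2) * exp (g - a0)\<close> with vanishing
  slope at time 1, and the equation for \<beta> says that its average meets the strike. What remains
  is to match its cost with the exponent of the moment bound.\<close>

lemma call_rate:
  fixes M :: "'a measure"
  assumes W: "std_brownian_motion M W" and r: "0 \<le> r" and \<sigma>: "0 < \<sigma>" and S0: "0 < S0"
    and \<tau>: "0 < \<tau>" "\<tau> < 1" and K: "0 < K" and \<beta>: "0 < \<beta>"
    and eq: "sinh \<beta> / \<beta> = K / S0 * exp (- (\<tau> / (1 - \<tau>)) * \<beta> * tanh (\<beta> / 2))"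
  shows "((\<lambda>T. T * ln (asian_call M W S0 r q \<sigma> \<tau> K T)) \<longlongrightarrow>
    - (1 / (2 * \<sigma>\<^sup>2 * (1 - \<tau>)\<^sup>2)) *
      (\<tau> * \<beta>\<^sup>2 * (tanh (\<beta> / 2))\<^sup>2 + (1 - \<tau>) * \<beta>\<^sup>2 - 2 * (1 - \<tau>) * \<beta> * tanh (\<beta> / 2))) (at_right 0)"
proof -
  define th where "th = tanh (\<beta> / 2)"
  define b where "b = \<beta> / (1 - \<tau>)"
  define z where "z t = b * (1 - t) / 2" for t
  define l where "l = \<tau> * b * th"
  \<comment> \<open>Fixed by \<open>g \<tau> = l\<close>, where \<open>l\<close> is \<tau> times the
    slope \<open>b * th\<close> at \<tau>, so that the straight initial segment joins without a
    kink.\<close>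
  define a0 where "a0 = 2 * ln (cosh (\<beta> / 2)) + l"
  define g where "g t = a0 - 2 * ln (cosh (z t))" for t
  define G where "G t = b * tanh (z t)" for t
  define E where "E t = b\<^sup>2 * t + 2 * b * tanh (z t)" for t
  have b: "0 < b" using \<beta> \<tau> by (simp add: b_def)
  have th: "0 < th" using \<beta> by (simp add: th_def tanh_real_pos_iff)
  have z\<tau>: "z \<tau> = \<beta> / 2" and z1: "z 1 = 0" using \<tau> by (auto simp: z_def b_def)
  have cosh_pos: "0 < cosh x" for x :: real by (rule cosh_real_pos)
  have z_deriv: "(z has_real_derivative - b / 2) (at t within A)" for t A
    unfolding z_def[abs_def] by (auto intro!: derivative_eq_intros)
  have tanh_deriv: "((\<lambda>t. tanh (z t)) has_real_derivative (1 - (tanh (z t))\<^sup>2) * (- b / 2)) (at t within A)" for t A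
    by (rule has_field_derivative_tanh[OF _ z_deriv]) simp
  have g_deriv: "(g has_real_derivative G t) (at t within A)" for t A
  proof -
    have "((\<lambda>t. cosh (z t)) has_real_derivative sinh (z t) * (- b / 2)) (at t within A)"
      by (auto intro!: derivative_eq_intros z_deriv)
    note DERIV_diff[OF DERIV_const[of a0] DERIV_cmult[OF DERIV_chain2[OF DERIV_ln[OF cosh_pos] this], of 2]]
    moreover have "0 - 2 * (i * (x * (- b / 2))) = b * (x * i)" for i x :: real
      by simp
    ultimately show ?thesis unfolding g_def[abs_def] G_def tanh_def divide_inverse[of "sinh (z t)"] by metis
  qed
  have G_cont: "continuous_on {\<tau>..1} G"
    unfolding G_def[abs_def] z_def by (intro continuous_intros) auto
  have E_deriv: "(E has_real_derivative (G t)\<^sup>2) (at t within A)" for t A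
    using DERIV_add[OF DERIV_cmult_Id[of "b\<^sup>2"] DERIV_cmult[OF tanh_deriv[of t A], of "2 * b"]]
    unfolding E_def[abs_def] G_def by (simp add: power2_eq_square algebra_simps)
  have exp_g: "exp (g t) = exp a0 * (1 - (tanh (z t))\<^sup>2)" for t
  proof -
    have "exp (g t) = exp a0 / (cosh (z t))\<^sup>2"
      unfolding g_def exp_diff using cosh_pos[of "z t"] by (simp add: exp_double)
    also have "\<dots> = exp a0 * (1 - (tanh (z t))\<^sup>2)"
    proof -
      have "1 - (tanh (z t))\<^sup>2 = ((cosh (z t))\<^sup>2 - (sinh (z t))\<^sup>2) / (cosh (z t))\<^sup>2"
        by (simp add: tanh_def power_divide diff_divide_distrib)
      also have "\<dots> = 1 / (cosh (z t))\<^sup>2"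
        by (simp add: cosh_square_eq)
      finally show ?thesis by simp
    qed
    finally show ?thesis .
  qed
  have int: "integral {\<tau>..1} (\<lambda>t. exp (g t)) = 2 * exp a0 / b * th"
  proof -
    have "((\<lambda>t. exp a0 * (1 - (tanh (z t))\<^sup>2)) has_integral
        - (2 / b) * exp a0 * tanh (z 1) - - (2 / b) * exp a0 * tanh (z \<tau>)) {\<tau>..1}"
    proof (rule has_integral_increment[where l = \<tau> and u = 1 and f = "\<lambda>t. - (2 / b) * exp a0 * tanh (z t)"])
      show "((\<lambda>t. - (2 / b) * exp a0 * tanh (z t)) has_real_derivative exp a0 * (1 - (tanh (z t))\<^sup>2)) (at t within {\<tau>..1})" for t
        using DERIV_cmult[OF tanh_deriv[of t "{\<tau>..1}"], of "- (2 / b) * exp a0"] b by simp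
    qed (use \<tau> in auto)
    then show ?thesis unfolding exp_g by (intro integral_unique) (simp add: z1 z\<tau> th_def)
  qed
  have sinh2: "sinh \<beta> = 2 * sinh (\<beta> / 2) * cosh (\<beta> / 2)"
    using sinh_double[of "\<beta> / 2"] by simp
  have l_exp: "- (\<tau> / (1 - \<tau>)) * \<beta> * tanh (\<beta> / 2) = - l" by (simp add: l_def b_def th_def)
  have g_K: "S0 / (1 - \<tau>) * integral {\<tau>..1} (\<lambda>t. exp (g t)) = K"
  proof -
    have "exp a0 = (cosh (\<beta> / 2))\<^sup>2 * exp l"
      unfolding a0_def exp_add using cosh_pos[of "\<beta> / 2"] by (simp add: exp_double)
    then have "S0 / (1 - \<tau>) * integral {\<tau>..1} (\<lambda>t. exp (g t))
        = S0 * exp l * ((2 * (cosh (\<beta> / 2))\<^sup>2 * th) / \<beta>)"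
      unfolding int using \<tau> by (simp add: b_def)
    also have "2 * (cosh (\<beta> / 2))\<^sup>2 * th = sinh \<beta>"
      unfolding th_def tanh_def sinh2 using cosh_pos[of "\<beta> / 2"] by (simp add: power2_eq_square)
    also have "S0 * exp l * (sinh \<beta> / \<beta>) = K"
      unfolding eq l_exp using S0 by (simp add: exp_minus)
    finally show ?thesis .
  qed
  \<comment> \<open>the stationary point of the exponent of \<open>call_moment_bound\<close> in \<open>\<rho>\<close> and \<open>\<theta>\<close>, where \<open>\<theta>\<close> is the
    limit of \<open>T * n\<close> for moments of order \<open>n\<close>\<close>
  define \<rho> where "\<rho> = 1 / th"
  define \<theta> where "\<theta> = b * th / \<sigma>\<^sup>2"
  have th1: "th < 1" unfolding th_def by (rule tanh_real_lt_1)
  have \<rho>: "1 < \<rho>" using th th1 by (simp add: \<rho>_def)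
  have \<theta>: "0 < \<theta>" using b th \<sigma> by (simp add: \<theta>_def)
  have \<sigma>\<theta>: "\<sigma>\<^sup>2 * \<theta> = b * th" using \<sigma> by (simp add: \<theta>_def)
  define a where "a = ((g \<tau>)\<^sup>2 / \<tau> + (E 1 - E \<tau>)) / (2 * \<sigma>\<^sup>2)"
  have g\<tau>: "g \<tau> = l" unfolding g_def z\<tau> a0_def by simp
  have a_eq: "a = (\<tau> * b\<^sup>2 * th\<^sup>2 + b * \<beta> - 2 * b * th) / (2 * \<sigma>\<^sup>2)"
  proof -
    have "b\<^sup>2 * (1 - \<tau>) = b * \<beta>" using \<tau> by (simp add: b_def power2_eq_square)
    moreover have "E 1 - E \<tau> = b\<^sup>2 * (1 - \<tau>) - 2 * b * th"
      by (simp add: E_def z1 z\<tau> th_def algebra_simps)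
    ultimately have "E 1 - E \<tau> = b * \<beta> - 2 * b * th"
      by (simp only:)
    moreover have "(g \<tau>)\<^sup>2 / \<tau> = \<tau> * b\<^sup>2 * th\<^sup>2" using \<tau> by (simp add: g\<tau> l_def power2_eq_square)
    ultimately show ?thesis by (simp add: a_def)
  qed
  have rate: "- \<theta> * ln K + \<theta> * ln (S0 / (1 - \<tau>)) - \<theta> * ln (\<sigma>\<^sup>2 * \<theta> / 2) - \<theta> - \<theta> * log_mass \<rho>
      + \<sigma>\<^sup>2 * \<theta>\<^sup>2 * \<rho>\<^sup>2 * (1 - \<tau>) / 2 + \<sigma>\<^sup>2 * \<theta>\<^sup>2 * \<tau> / 2 = - a"
  proof -
    let ?s = "sinh (\<beta> / 2)" and ?c = "cosh (\<beta> / 2)"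
    have s: "0 < ?s" using \<beta> by simp
    have c: "0 < ?c" by (rule cosh_pos)
    have \<rho>_eq: "\<rho> = ?c / ?s" by (simp add: \<rho>_def th_def tanh_def)
    \<comment> \<open>For \<open>\<rho> = cosh (\<beta> / 2) / sinh (\<beta> / 2)\<close> both
      \<open>\<rho> + 1\<close> and \<open>\<rho> - 1\<close> are exponentials divided by sinh,
      which makes \<open>log_mass \<rho>\<close> explicit.\<close>
    have \<rho>p: "\<rho> + 1 = exp (\<beta> / 2) / ?s"
    proof -
      have "\<rho> + 1 = (?c + ?s) / ?s" unfolding \<rho>_eq add_divide_distrib using s by simp
      then show ?thesis by (simp only: cosh_plus_sinh)
    qed
    have \<rho>m: "\<rho> - 1 = exp (- (\<beta> / 2)) / ?s"
    proof -
      have "\<rho> - 1 = (?c - ?s) / ?s" unfolding \<rho>_eq diff_divide_distrib using s by simp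
      then show ?thesis by (simp only: cosh_minus_sinh)
    qed
    have lm: "log_mass \<rho> = \<rho> * \<beta> - 2 * ln ?s - 2"
    proof -
      have "ln (\<rho> + 1) = \<beta> / 2 - ln ?s" "ln (\<rho> - 1) = - (\<beta> / 2) - ln ?s"
        unfolding \<rho>p \<rho>m using s by (simp_all add: ln_div)
      then show ?thesis unfolding log_mass_def by (simp only:) (simp add: field_simps)
    qed
    have lnK: "ln K = ln S0 + l + ln 2 + ln ?s + ln ?c - ln \<beta>"
    proof -
      have "K = S0 * exp l * (sinh \<beta> / \<beta>)"
        unfolding eq l_exp using S0 by (simp add: exp_minus)
      then have "K = S0 * exp l * (2 * ?s * ?c / \<beta>)" unfolding sinh2 .
      then show ?thesis using S0 s c \<beta> by (simp add: ln_mult_pos ln_div)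
    qed
    have lnc: "ln (S0 / (1 - \<tau>)) = ln S0 - ln (1 - \<tau>)" using S0 \<tau> by (simp add: ln_div)
    have ln\<theta>: "ln (\<sigma>\<^sup>2 * \<theta> / 2) = ln \<beta> - ln (1 - \<tau>) + ln ?s - ln ?c - ln 2"
      unfolding \<sigma>\<theta> b_def th_def tanh_def using \<beta> \<tau> s c by (simp add: ln_mult_pos ln_div)
    have q1: "\<sigma>\<^sup>2 * \<theta>\<^sup>2 * \<rho>\<^sup>2 * (1 - \<tau>) / 2 = \<theta> * (\<rho> * \<beta>) / 2"
    proof -
      have "\<sigma>\<^sup>2 * \<theta>\<^sup>2 * \<rho>\<^sup>2 * (1 - \<tau>) = \<theta> * (\<sigma>\<^sup>2 * \<theta> * \<rho> * (1 - \<tau>)) * \<rho>" by (simp add: power2_eq_square)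
      also have "\<sigma>\<^sup>2 * \<theta> * \<rho> * (1 - \<tau>) = \<beta>"
        unfolding \<sigma>\<theta> \<rho>_def using th \<tau> by (simp add: b_def)
      finally show ?thesis by simp
    qed
    have q2: "\<sigma>\<^sup>2 * \<theta>\<^sup>2 * \<tau> / 2 = \<theta> * l / 2"
    proof -
      have "\<sigma>\<^sup>2 * \<theta>\<^sup>2 * \<tau> = \<theta> * (\<sigma>\<^sup>2 * \<theta>) * \<tau>" by (simp add: power2_eq_square)
      then show ?thesis unfolding \<sigma>\<theta> by (simp add: l_def)
    qed
    \<comment> \<open>All logarithms cancel; the equation for \<beta> enters here, through
      \<open>lnK\<close>.\<close>
    have "- \<theta> * ln K + \<theta> * ln (S0 / (1 - \<tau>)) - \<theta> * ln (\<sigma>\<^sup>2 * \<theta> / 2) - \<theta> - \<theta> * log_mass \<rho>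
      + \<sigma>\<^sup>2 * \<theta>\<^sup>2 * \<rho>\<^sup>2 * (1 - \<tau>) / 2 + \<sigma>\<^sup>2 * \<theta>\<^sup>2 * \<tau> / 2 = \<theta> * (1 - \<rho> * \<beta> / 2 - l / 2)"
      unfolding lnK lnc ln\<theta> lm q1 q2 by (simp add: algebra_simps)
    also have "\<dots> = - a"
    proof -
      have "th * \<rho> = 1" using th by (simp add: \<rho>_def)
      moreover have "b * th * (1 - \<rho> * \<beta> / 2 - l / 2) = b * th - b * \<beta> * (th * \<rho>) / 2 - b * th * l / 2"
        by (simp add: algebra_simps)
      ultimately have "b * th * (1 - \<rho> * \<beta> / 2 - l / 2) = - (\<tau> * b\<^sup>2 * th\<^sup>2 + b * \<beta> - 2 * b * th) / 2"
        by (simp add: l_def power2_eq_square diff_divide_distrib add_divide_distrib ac_simps)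
      then have "\<theta> * (1 - \<rho> * \<beta> / 2 - l / 2) = - (\<tau> * b\<^sup>2 * th\<^sup>2 + b * \<beta> - 2 * b * th) / 2 / \<sigma>\<^sup>2"
        unfolding \<theta>_def times_divide_eq_left by (simp only:)
      then show ?thesis by (simp only: a_eq minus_divide_left divide_divide_eq_left)
    qed
    finally show ?thesis .
  qed
  have "((\<lambda>T. T * ln (asian_call M W S0 r q \<sigma> \<tau> K T)) \<longlongrightarrow> - a) (at_right 0)"
    by (rule call_asymptotics[OF W r \<sigma> S0 \<tau> K g_deriv G_cont E_deriv g_K \<rho> \<theta> rate a_def])
  also have "- a = - (1 / (2 * \<sigma>\<^sup>2 * (1 - \<tau>)\<^sup>2)) *
      (\<tau> * \<beta>\<^sup>2 * (tanh (\<beta> / 2))\<^sup>2 + (1 - \<tau>) * \<beta>\<^sup>2 - 2 * (1 - \<tau>) * \<beta> * tanh (\<beta> / 2))"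
  proof -
    have "\<beta> = b * (1 - \<tau>)" using \<tau> by (simp add: b_def)
    moreover have "\<tau> * (b * k)\<^sup>2 * th\<^sup>2 + k * (b * k)\<^sup>2 - 2 * k * (b * k) * th
        = k\<^sup>2 * (\<tau> * b\<^sup>2 * th\<^sup>2 + b * (b * k) - 2 * b * th)" for k
      by (simp add: power2_eq_square algebra_simps)
    ultimately have "\<tau> * \<beta>\<^sup>2 * th\<^sup>2 + (1 - \<tau>) * \<beta>\<^sup>2 - 2 * (1 - \<tau>) * \<beta> * th
        = (1 - \<tau>)\<^sup>2 * (\<tau> * b\<^sup>2 * th\<^sup>2 + b * \<beta> - 2 * b * th)"
      by metis
    then show ?thesis unfolding a_eq th_def[symmetric] using \<tau> by simp
  qed
  finally show ?thesis .
qed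

text \<open>Formally these are the call formulas at \<open>\<beta> = 2 * i * \<xi>\<close> with i
  the imaginary unit: cosh becomes cos and tanh becomes i times tan, which explains the changed
  signs and factors. The restriction \<open>\<xi> < pi / 2\<close> keeps the cosine positive along
  the whole path, so that its logarithm makes sense.\<close>

lemma put_rate:
  fixes M :: "'a measure"
  assumes W: "std_brownian_motion M W" and r: "0 \<le> r" and \<sigma>: "0 < \<sigma>" and S0: "0 < S0"
    and \<tau>: "0 < \<tau>" "\<tau> < 1" and K: "0 < K" and \<xi>: "0 < \<xi>" "\<xi> < pi / 2"
    and eq: "sin (2 * \<xi>) / (2 * \<xi>) = K / S0 * exp (2 * \<tau> / (1 - \<tau>) * \<xi> * tan \<xi>)"
  shows "((\<lambda>T. T * ln (asian_put M W S0 r q \<sigma> \<tau> K T)) \<longlongrightarrow>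
    - (2 / (\<sigma>\<^sup>2 * (1 - \<tau>)\<^sup>2)) *
      (\<tau> * \<xi>\<^sup>2 * (tan \<xi>)\<^sup>2 - (1 - \<tau>) * \<xi>\<^sup>2 + (1 - \<tau>) * \<xi> * tan \<xi>)) (at_right 0)"
proof -
  define b where "b = \<xi> / (1 - \<tau>)"
  define z where "z t = b * (1 - t)" for t
  define l where "l = 2 * \<tau> * b * tan \<xi>"
  define a0 where "a0 = 2 * ln (cos \<xi>) - l"
  define g where "g t = a0 - 2 * ln (cos (z t))" for t
  define G where "G t = - 2 * b * tan (z t)" for t
  define E where "E t = - 4 * b\<^sup>2 * t - 4 * b * tan (z t)" for t
  \<comment> \<open>The multiplier in \<open>g'' = \<kappa> * exp g\<close>. Its sign is opposite to
    that of the call and is the one needed for the half-space argument.\<close>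
  define \<kappa> where "\<kappa> = 2 * b\<^sup>2 * exp (- a0)"
  have b: "0 < b" using \<xi> \<tau> by (simp add: b_def)
  have \<kappa>: "0 < \<kappa>" using b by (simp add: \<kappa>_def)
  have z\<tau>: "z \<tau> = \<xi>" and z1: "z 1 = 0" using \<tau> by (auto simp: z_def b_def)
  have cos_pos: "0 < cos (z t)" if t: "t \<in> {\<tau>..1}" for t
  proof -
    have "z t \<le> z \<tau>" unfolding z_def using t b by (intro mult_left_mono) auto
    then have "z t < pi / 2" using z\<tau> \<xi> by simp
    moreover have "0 \<le> z t" using t b by (simp add: z_def)
    ultimately show ?thesis by (intro cos_gt_zero_pi) auto
  qed
  have cos_\<xi>: "0 < cos \<xi>" using cos_pos[of \<tau>] z\<tau> \<tau> by simp
  have z_deriv: "(z has_real_derivative - b) (at t within A)" for t A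
    unfolding z_def[abs_def] by (auto intro!: derivative_eq_intros)
  have tan_deriv: "((\<lambda>t. tan (z t)) has_real_derivative inverse ((cos (z t))\<^sup>2) * - b) (at t within A)"
    if "t \<in> {\<tau>..1}" for t A
    by (rule DERIV_chain2[OF DERIV_tan z_deriv]) (use cos_pos[OF that] in auto)
  have g_deriv: "(g has_real_derivative G t) (at t within A)" if t: "t \<in> {\<tau>..1}" for t A
  proof -
    have "((\<lambda>t. cos (z t)) has_real_derivative - sin (z t) * (- b)) (at t within A)"
      by (auto intro!: derivative_eq_intros z_deriv)
    from DERIV_diff[OF DERIV_const[of a0] DERIV_cmult[OF DERIV_chain2[OF DERIV_ln[OF cos_pos[OF t]] this], of 2]]
    show ?thesis unfolding g_def[abs_def] G_def tan_def by (simp add: divide_inverse ac_simps)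
  qed
  have exp_g: "exp (g t) = exp a0 * inverse ((cos (z t))\<^sup>2)" if "t \<in> {\<tau>..1}" for t
    unfolding g_def exp_diff using cos_pos[OF that] by (simp add: exp_double divide_inverse)
  have G_deriv: "(G has_real_derivative \<kappa> * exp (g t)) (at t within A)" if t: "t \<in> {\<tau>..1}" for t A
  proof -
    have "- 2 * b * (inverse ((cos (z t))\<^sup>2) * - b) = \<kappa> * exp (g t)"
      unfolding \<kappa>_def exp_g[OF t] by (simp add: exp_minus power2_eq_square)
    then show ?thesis
      using DERIV_cmult[OF tan_deriv[OF t, of A], of "- 2 * b"] unfolding G_def[abs_def] by metis
  qed
  have E_deriv: "(E has_real_derivative (G t)\<^sup>2) (at t within A)" if t: "t \<in> {\<tau>..1}" for t A
  proof -
    have "- 4 * b\<^sup>2 - 4 * b * (inverse ((cos (z t))\<^sup>2) * - b) = (G t)\<^sup>2"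
    proof -
      have "inverse ((cos (z t))\<^sup>2) = 1 + (tan (z t))\<^sup>2"
        using cos_pos[OF t] tan_sec[of "z t"] by (simp add: power_inverse)
      then show ?thesis by (simp add: G_def power2_eq_square algebra_simps)
    qed
    then show ?thesis
      using DERIV_diff[OF DERIV_cmult_Id[of "- 4 * b\<^sup>2"] DERIV_cmult[OF tan_deriv[OF t, of A], of "4 * b"]]
      unfolding E_def[abs_def] by metis
  qed
  have int: "integral {\<tau>..1} (\<lambda>t. exp (g t)) = exp a0 / b * tan \<xi>"
  proof -
    have "((\<lambda>t. exp (g t)) has_integral
        - (1 / b) * exp a0 * tan (z 1) - - (1 / b) * exp a0 * tan (z \<tau>)) {\<tau>..1}"
    proof (rule has_integral_increment[where l = \<tau> and u = 1 and f = "\<lambda>t. - (1 / b) * exp a0 * tan (z t)"])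
      show "((\<lambda>t. - (1 / b) * exp a0 * tan (z t)) has_real_derivative exp (g t)) (at t within {\<tau>..1})"
        if t: "t \<in> {\<tau>..1}" for t
        using DERIV_cmult[OF tan_deriv[OF t, of "{\<tau>..1}"], of "- (1 / b) * exp a0"] b
        by (simp add: exp_g[OF t])
    qed (use \<tau> in auto)
    then show ?thesis by (intro integral_unique) (simp add: z1 z\<tau>)
  qed
  have l_exp: "2 * \<tau> / (1 - \<tau>) * \<xi> * tan \<xi> = l" by (simp add: l_def b_def)
  have g_K: "S0 / (1 - \<tau>) * integral {\<tau>..1} (\<lambda>t. exp (g t)) = K"
  proof -
    have "exp a0 = (cos \<xi>)\<^sup>2 * exp (- l)"
      unfolding a0_def diff_conv_add_uminus exp_add using cos_\<xi> by (simp add: exp_double)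
    then have "S0 / (1 - \<tau>) * integral {\<tau>..1} (\<lambda>t. exp (g t))
        = S0 * exp (- l) * ((2 * (cos \<xi>)\<^sup>2 * tan \<xi>) / (2 * \<xi>))"
      unfolding int using \<tau> by (simp add: b_def)
    also have "2 * (cos \<xi>)\<^sup>2 * tan \<xi> = sin (2 * \<xi>)"
      unfolding tan_def sin_double using cos_\<xi> by (simp add: power2_eq_square)
    also have "S0 * exp (- l) * (sin (2 * \<xi>) / (2 * \<xi>)) = K"
      unfolding eq l_exp using S0 by (simp add: exp_minus)
    finally show ?thesis .
  qed
  have g\<tau>: "g \<tau> = \<tau> * G \<tau>" unfolding g_def G_def z\<tau> a0_def l_def by simp
  have G1: "G 1 = 0" by (simp add: G_def z1)
  define a where "a = ((g \<tau>)\<^sup>2 / \<tau> + (E 1 - E \<tau>)) / (2 * \<sigma>\<^sup>2)"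
  have "((\<lambda>T. T * ln (asian_put M W S0 r q \<sigma> \<tau> K T)) \<longlongrightarrow> - a) (at_right 0)"
    by (rule put_asymptotics[OF W r \<sigma> S0 \<tau> K \<kappa> g_deriv G_deriv E_deriv g_K G1 g\<tau> a_def])
  also have "- a = - (2 / (\<sigma>\<^sup>2 * (1 - \<tau>)\<^sup>2)) *
      (\<tau> * \<xi>\<^sup>2 * (tan \<xi>)\<^sup>2 - (1 - \<tau>) * \<xi>\<^sup>2 + (1 - \<tau>) * \<xi> * tan \<xi>)"
  proof -
    have \<xi>b: "\<xi> = b * (1 - \<tau>)" using \<tau> by (simp add: b_def)
    have "(g \<tau>)\<^sup>2 / \<tau> = 4 * (\<tau> * b\<^sup>2 * (tan \<xi>)\<^sup>2)"
      using \<tau> by (simp add: g\<tau> G_def z\<tau> power2_eq_square)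
    moreover have "E 1 - E \<tau> = 4 * (b * tan \<xi> - b\<^sup>2 * (1 - \<tau>))"
      by (simp add: E_def z1 z\<tau> algebra_simps)
    ultimately have "a = (4 * (\<tau> * b\<^sup>2 * (tan \<xi>)\<^sup>2) + 4 * (b * tan \<xi> - b\<^sup>2 * (1 - \<tau>))) / (2 * \<sigma>\<^sup>2)"
      by (simp only: a_def)
    then have a_eq: "a = 2 * (\<tau> * b\<^sup>2 * (tan \<xi>)\<^sup>2 + b * tan \<xi> - b\<^sup>2 * (1 - \<tau>)) / \<sigma>\<^sup>2"
      using \<sigma> by (simp add: field_simps)
    have "\<tau> * \<xi>\<^sup>2 * x\<^sup>2 - (1 - \<tau>) * \<xi>\<^sup>2 + (1 - \<tau>) * \<xi> * x
        = (1 - \<tau>)\<^sup>2 * (\<tau> * b\<^sup>2 * x\<^sup>2 + b * x - b\<^sup>2 * (1 - \<tau>))" for x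
      unfolding \<xi>b by (simp add: power2_eq_square algebra_simps)
    from this[of "tan \<xi>"] show ?thesis unfolding a_eq using \<tau> by simp
  qed
  finally show ?thesis .
qed

section \<open>Existence and uniqueness of \<beta> and \<xi>\<close>

lemma sinh_ratio_strict_mono:
  fixes x y :: real
  assumes "0 < x" "x < y"
  shows "sinh x / x < sinh y / y"
proof (rule DERIV_pos_imp_increasing_open[OF assms(2)])
  fix z assume z: "x < z" "z < y"
  \<comment> \<open>This is the numerator of the derivative of \<open>sinh z / z\<close>; it
    vanishes at 0 and has the positive derivative \<open>w * sinh w\<close>.\<close>
  have "0 * cosh 0 - sinh 0 < z * cosh z - sinh z"
  proof (rule DERIV_pos_imp_increasing_open[of 0 z "\<lambda>z. z * cosh z - sinh z"])
    show "\<exists>d. ((\<lambda>z. z * cosh z - sinh z) has_real_derivative d) (at w) \<and> 0 < d" if "0 < w" "w < z" for w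
      using that by (intro exI[of _ "w * sinh w"]) (auto intro!: derivative_eq_intros)
  qed (use assms z in \<open>auto intro!: continuous_intros\<close>)
  then have "0 < (cosh z * z - sinh z) / (z * z)"
    using assms z by (intro divide_pos_pos) (auto simp: mult.commute)
  then show "\<exists>d. ((\<lambda>z. sinh z / z) has_real_derivative d) (at z) \<and> 0 < d"
    using assms z by (intro exI[of _ "(cosh z * z - sinh z) / (z * z)"]) (auto intro!: derivative_eq_intros)
qed (use assms in \<open>auto intro!: continuous_intros\<close>)

text \<open>The numerator of the derivative starts at 0 and has derivative
  \<open>- w * sin w\<close>, negative up to \<open>pi\<close>. This range covers the argument
  \<open>2 * \<xi>\<close> for \<open>\<xi> < pi / 2\<close>.\<close>

lemma sin_ratio_strict_anti:
  fixes x y :: real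
  assumes "0 < x" "x < y" "y < pi"
  shows "sin y / y < sin x / x"
proof (rule DERIV_neg_imp_decreasing_open[OF assms(2)])
  fix z assume z: "x < z" "z < y"
  have "0 * cos 0 - sin 0 > z * cos z - sin z"
  proof (rule DERIV_neg_imp_decreasing_open[of 0 z "\<lambda>z. z * cos z - sin z"])
    show "\<exists>d. ((\<lambda>z. z * cos z - sin z) has_real_derivative d) (at w) \<and> d < 0" if "0 < w" "w < z" for w
      using that assms z sin_gt_zero[of w] by (intro exI[of _ "- w * sin w"]) (auto intro!: derivative_eq_intros)
  qed (use assms z in \<open>auto intro!: continuous_intros\<close>)
  then have "(cos z * z - sin z) / (z * z) < 0"
    using assms z by (intro divide_neg_pos) (auto simp: mult.commute)
  then show "\<exists>d. ((\<lambda>z. sin z / z) has_real_derivative d) (at z) \<and> d < 0"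
    using assms z by (intro exI[of _ "(cos z * z - sin z) / (z * z)"]) (auto intro!: derivative_eq_intros)
qed (use assms in \<open>auto intro!: continuous_intros\<close>)

lemma mult_exp_eq_iff:
  fixes s x k :: real
  shows "s * exp x = k \<longleftrightarrow> s = k * exp (- x)"
  by (auto simp: exp_minus field_simps)

text \<open>With the exponential moved to the left, the left side is strictly increasing from its
  limit 1 at 0 to infinity, and \<open>k > 1\<close> places the value in its range.\<close>

lemma call_parameter_unique:
  fixes k c :: real
  assumes k: "1 < k" and c: "0 \<le> c"
  shows "\<exists>!\<beta>. \<beta> > 0 \<and> sinh \<beta> / \<beta> = k * exp (- c * \<beta> * tanh (\<beta> / 2))"
proof -
  define F where "F \<beta> = sinh \<beta> / \<beta> * exp (c * \<beta> * tanh (\<beta> / 2))" for \<beta>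
  have eq: "sinh \<beta> / \<beta> = k * exp (- c * \<beta> * tanh (\<beta> / 2)) \<longleftrightarrow> F \<beta> = k" for \<beta>
    using mult_exp_eq_iff[of "sinh \<beta> / \<beta>" "c * \<beta> * tanh (\<beta> / 2)" k] by (simp add: F_def)
  have mono: "F x < F y" if "0 < x" "x < y" for x y
  proof -
    have "c * (x * tanh (x / 2)) \<le> c * (y * tanh (y / 2))"
      using that c by (intro mult_left_mono mult_mono) auto
    then have "exp (c * x * tanh (x / 2)) \<le> exp (c * y * tanh (y / 2))" by (simp add: mult.assoc)
    with sinh_ratio_strict_mono[OF that] show ?thesis
      unfolding F_def using that by (intro mult_less_le_imp_less) auto
  qed
  have cont: "continuous_on {a..b} F" if "0 < a" for a b
    unfolding F_def[abs_def] using that by (intro continuous_intros) auto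
  have "((\<lambda>\<beta>::real. sinh \<beta> / \<beta>) \<longlongrightarrow> 1) (at_right 0)" by real_asymp
  moreover have "((\<lambda>\<beta>. exp (c * \<beta> * tanh (\<beta> / 2))) \<longlongrightarrow> exp (c * 0 * tanh (0 / 2))) (at_right 0)"
    by (intro tendsto_intros) auto
  ultimately have "(F \<longlongrightarrow> 1 * exp (c * 0 * tanh (0 / 2))) (at_right 0)"
    unfolding F_def[abs_def] by (rule tendsto_mult)
  then have "\<forall>\<^sub>F \<beta> in at_right 0. F \<beta> < k" using k by (intro order_tendstoD(2)) auto
  then have "\<forall>\<^sub>F \<beta> in at_right 0. F \<beta> < k \<and> 0 < \<beta>"
    by (rule eventually_conj) (simp add: eventually_at_right_less)
  then obtain a where a: "F a < k" "0 < a" using eventually_happens[of _ "at_right (0::real)"] by auto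
  have "filterlim (\<lambda>\<beta>::real. sinh \<beta> / \<beta>) at_top at_top" by real_asymp
  then have "\<forall>\<^sub>F \<beta> in at_top. k \<le> sinh \<beta> / \<beta>" by (simp add: filterlim_at_top)
  then have "\<forall>\<^sub>F \<beta> in at_top. k \<le> sinh \<beta> / \<beta> \<and> a < \<beta>"
    by (rule eventually_conj) (rule eventually_gt_at_top)
  then obtain b where b: "k \<le> sinh b / b" "a < b" using eventually_happens[of _ "at_top :: real filter"] by auto
  \<comment> \<open>The exponential factor is at least 1, so the growth of
    \<open>sinh \<beta> / \<beta>\<close> alone provides the upper end point.\<close>
  have "sinh b / b * 1 \<le> F b"
    unfolding F_def using a b c by (intro mult_left_mono) auto
  then have "\<exists>\<beta>\<ge>a. \<beta> \<le> b \<and> F \<beta> = k"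
    using a b by (intro IVT' cont) auto
  then obtain \<beta> where "a \<le> \<beta>" "F \<beta> = k" by blast
  with a have \<beta>: "0 < \<beta>" "F \<beta> = k" by linarith+
  have "\<beta>' = \<beta>" if "0 < \<beta>'" "F \<beta>' = k" for \<beta>'
    using mono[of \<beta> \<beta>'] mono[of \<beta>' \<beta>] \<beta> that by (cases \<beta>' \<beta> rule: linorder_cases) auto
  with \<beta> show ?thesis unfolding eq by blast
qed

text \<open>With the exponential moved to the left, the left side is strictly decreasing from its
  limit 1 at 0 to its limit 0 at \<open>pi / 2\<close>, and k lies strictly between.\<close>

lemma put_parameter_unique:
  fixes k c :: real
  assumes k: "0 < k" "k < 1" and c: "0 \<le> c"
  shows "\<exists>!\<xi>. 0 < \<xi> \<and> \<xi> < pi / 2 \<and> sin (2 * \<xi>) / (2 * \<xi>) = k * exp (c * \<xi> * tan \<xi>)"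
proof -
  define F where "F \<xi> = sin (2 * \<xi>) / (2 * \<xi>) * exp (- (c * \<xi> * tan \<xi>))" for \<xi>
  have eq: "sin (2 * \<xi>) / (2 * \<xi>) = k * exp (c * \<xi> * tan \<xi>) \<longleftrightarrow> F \<xi> = k" for \<xi>
    using mult_exp_eq_iff[of "sin (2 * \<xi>) / (2 * \<xi>)" "- (c * \<xi> * tan \<xi>)" k] by (simp add: F_def)
  have tan_pos: "0 < tan x" if "0 < x" "x < pi / 2" for x
    using that by (rule tan_gt_zero)
  have anti: "F y < F x" if xy: "0 < x" "x < y" "y < pi / 2" for x y
  proof -
    have "tan x \<le> tan y" using xy tan_mono_lt_eq[of x y] by simp
    then have "c * (x * tan x) \<le> c * (y * tan y)"
      using xy c tan_pos[of x] by (intro mult_left_mono mult_mono) auto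
    then have "exp (- (c * y * tan y)) \<le> exp (- (c * x * tan x))" by (simp add: mult.assoc)
    moreover have "sin (2 * y) / (2 * y) < sin (2 * x) / (2 * x)"
      using xy by (intro sin_ratio_strict_anti) auto
    moreover have "0 < sin (2 * y) / (2 * y)"
      using xy by (intro divide_pos_pos sin_gt_zero) auto
    ultimately show ?thesis
      unfolding F_def by (intro mult_less_le_imp_less) auto
  qed
  have cont: "continuous_on {a..b} F" if "0 < a" "b < pi / 2" for a b
  proof -
    have "cos x \<noteq> 0" if "x \<in> {a..b}" for x
      using \<open>0 < a\<close> \<open>b < pi / 2\<close> that cos_gt_zero[of x] by auto
    then show ?thesis
      unfolding F_def[abs_def] using that by (intro continuous_intros) auto
  qed
  have "((\<lambda>\<xi>::real. sin (2 * \<xi>) / (2 * \<xi>)) \<longlongrightarrow> 1) (at_right 0)" by real_asymp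
  moreover have "((\<lambda>\<xi>. exp (- (c * \<xi> * tan \<xi>))) \<longlongrightarrow> exp (- (c * 0 * tan 0))) (at_right 0)"
    by (intro tendsto_intros) auto
  ultimately have "(F \<longlongrightarrow> 1 * exp (- (c * 0 * tan 0))) (at_right 0)"
    unfolding F_def[abs_def] by (rule tendsto_mult)
  then have "\<forall>\<^sub>F \<xi> in at_right 0. k < F \<xi>" using k by (intro order_tendstoD(1)) auto
  moreover have "\<forall>\<^sub>F \<xi> in at_right (0::real). \<xi> \<in> {0<..<pi / 2}"
    by (rule eventually_at_right_real) simp
  ultimately have "\<forall>\<^sub>F \<xi> in at_right 0. k < F \<xi> \<and> \<xi> \<in> {0<..<pi / 2}" by (rule eventually_conj)
  then obtain a where a: "k < F a" "0 < a" "a < pi / 2"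
    using eventually_happens[of _ "at_right (0::real)"] by auto
  \<comment> \<open>The exponential factor is at most 1, so the limit 0 of the sine ratio suffices
    and the pole of tan at \<open>pi / 2\<close> needs no estimate.\<close>
  have "((\<lambda>\<xi>::real. sin (2 * \<xi>) / (2 * \<xi>)) \<longlongrightarrow> sin (2 * (pi / 2)) / (2 * (pi / 2))) (at_left (pi / 2))"
    by (intro tendsto_intros) auto
  then have "\<forall>\<^sub>F \<xi> in at_left (pi / 2). sin (2 * \<xi>) / (2 * \<xi>) < k"
    using k by (intro order_tendstoD(2)) auto
  moreover have "\<forall>\<^sub>F \<xi> in at_left (pi / 2). \<xi> \<in> {a<..<pi / 2}"
    using a by (intro eventually_at_left_real) simp
  ultimately have "\<forall>\<^sub>F \<xi> in at_left (pi / 2). sin (2 * \<xi>) / (2 * \<xi>) < k \<and> \<xi> \<in> {a<..<pi / 2}" by (rule eventually_conj)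
  then obtain b where b: "sin (2 * b) / (2 * b) < k" "a < b" "b < pi / 2"
    using eventually_happens[of _ "at_left (pi / 2)"] by auto
  have "F b \<le> sin (2 * b) / (2 * b) * 1"
    unfolding F_def using a b c tan_pos[of b] sin_gt_zero[of "2 * b"]
    by (intro mult_left_mono) auto
  then have "\<exists>\<xi>\<ge>a. \<xi> \<le> b \<and> F \<xi> = k"
    using a b by (intro IVT2' cont) auto
  then obtain \<xi> where "a \<le> \<xi>" "\<xi> \<le> b" "F \<xi> = k" by blast
  with a b have \<xi>: "0 < \<xi>" "\<xi> < pi / 2" "F \<xi> = k" by linarith+
  have "\<xi>' = \<xi>" if "0 < \<xi>'" "\<xi>' < pi / 2" "F \<xi>' = k" for \<xi>'
    using anti[of \<xi> \<xi>'] anti[of \<xi>' \<xi>] \<xi> that by (cases \<xi>' \<xi> rule: linorder_cases) auto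
  with \<xi> show ?thesis unfolding eq by blast
qed

theorem theorem3p6:
  fixes M :: "'a measure" and W :: "real \<Rightarrow> 'a \<Rightarrow> real"
    and S0 r q \<sigma> \<tau> K :: real
  assumes BM: "std_brownian_motion M W"
    and r: "r \<ge> 0" and q: "q \<ge> 0" and \<sigma>: "\<sigma> > 0" and S0: "S0 > 0"
    and \<tau>: "0 < \<tau>" "\<tau> < 1" and K: "K > 0"
  shows
    "(K > S0 \<longrightarrow>
       (\<exists>!\<beta>. \<beta> > 0 \<and> sinh \<beta> / \<beta> = K / S0 * exp (- (\<tau> / (1 - \<tau>)) * \<beta> * tanh (\<beta> / 2))) \<and>
       (\<forall>\<beta>. \<beta> > 0 \<and> sinh \<beta> / \<beta> = K / S0 * exp (- (\<tau> / (1 - \<tau>)) * \<beta> * tanh (\<beta> / 2)) \<longrightarrow>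
          ((\<lambda>T. T * ln (asian_call M W S0 r q \<sigma> \<tau> K T)) \<longlongrightarrow>
             - (1 / (2 * \<sigma>\<^sup>2 * (1 - \<tau>)\<^sup>2)) *
               (\<tau> * \<beta>\<^sup>2 * (tanh (\<beta> / 2))\<^sup>2 + (1 - \<tau>) * \<beta>\<^sup>2 - 2 * (1 - \<tau>) * \<beta> * tanh (\<beta> / 2)))
           (at_right 0))) \<and>
     (K < S0 \<longrightarrow>
       (\<exists>!\<xi>. 0 < \<xi> \<and> \<xi> < pi / 2 \<and> sin (2 * \<xi>) / (2 * \<xi>) = K / S0 * exp (2 * \<tau> / (1 - \<tau>) * \<xi> * tan \<xi>)) \<and>
       (\<forall>\<xi>. 0 < \<xi> \<and> \<xi> < pi / 2 \<and> sin (2 * \<xi>) / (2 * \<xi>) = K / S0 * exp (2 * \<tau> / (1 - \<tau>) * \<xi> * tan \<xi>) \<longrightarrow>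
          ((\<lambda>T. T * ln (asian_put M W S0 r q \<sigma> \<tau> K T)) \<longlongrightarrow>
             - (2 / (\<sigma>\<^sup>2 * (1 - \<tau>)\<^sup>2)) *
               (\<tau> * \<xi>\<^sup>2 * (tan \<xi>)\<^sup>2 - (1 - \<tau>) * \<xi>\<^sup>2 + (1 - \<tau>) * \<xi> * tan \<xi>))
           (at_right 0)))"
proof (intro conjI impI allI; (elim conjE)?)
  assume "S0 < K"
  then show "\<exists>!\<beta>. \<beta> > 0 \<and> sinh \<beta> / \<beta> = K / S0 * exp (- (\<tau> / (1 - \<tau>)) * \<beta> * tanh (\<beta> / 2))"
    using S0 \<tau> by (intro call_parameter_unique) auto
next
  assume "K < S0"
  then show "\<exists>!\<xi>. 0 < \<xi> \<and> \<xi> < pi / 2 \<and> sin (2 * \<xi>) / (2 * \<xi>) = K / S0 * exp (2 * \<tau> / (1 - \<tau>) * \<xi> * tan \<xi>)"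
    using S0 K \<tau> by (intro put_parameter_unique) auto
qed (rule call_rate[OF BM r \<sigma> S0 \<tau> K] put_rate[OF BM r \<sigma> S0 \<tau> K]; assumption)+

end
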